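(* Consider the sequences generated by the communication-compressed and momentum-accelerated distributed learning algorithm of the context for $k\in[K]$. Under conditions (a)--(e) of the context, if selecting the step sizes as $\alpha^k=\Theta\left(\frac{\log K}{K}\right)$ and $\beta_n^k=\Theta\left(\frac{\log K}{K}\right)$ for any $n\in[N]$, it holds that $$\mathbb{E}[\|x^K-x^\ast\|^2]=\tilde{\mathcal{O}}\left(\frac1K\right),\qquad \mathbb{E}[\|y_n^K-\nabla f_n(x^K)\|^2]=\tilde{\mathcal{O}}\left(\frac1K\right),\ \forall n\in[N].$$ Alternatively, under conditions (a)--(d) and (f) of the context, if selecting the step sizes as $\alpha^k=\Theta\left(\frac{1}{\sqrt K}\right)$ and $\beta_n^k=\Theta\left(\frac{1}{\sqrt K}\right)$ for any $n\in[N]$, then it holds that for any $n\in[N]$, $$\frac1K\sum_{k=0}^{K-1}\mathbb{E}[\|\nabla F(x^k)\|^2]=\mathcal{O}\left(\frac{1}{\sqrt K}\right),\qquad \frac1K\sum_{k=0}^{K-1}\mathbb{E}[\|y_n^k-\nabla f_n(x^k)\|^2]=\mathcal{O}\left(\frac{1}{\sqrt K}\right).$$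
   Context: Problem: $\min_{x\in\mathbb{R}^d}F(x):=\frac1N\sum_{n=1}^Nf_n(x)$, where $N$ is the number of nodes and $f_n(x)=\mathbb{E}_{\zeta_n\sim\mathcal{D}_n}[f_n(x;\zeta_n)]$ is the local loss function of node $n\in[N]=\{1,\dots,N\}$, with $\mathcal{D}_n$ the local data distribution; $\|\cdot\|$ is the $\ell_2$-norm. $[K]=\{1,\dots,K\}$, $K$ the total number of iterations. Algorithm, with positive step sizes $\alpha^k,\beta_n^k$: $$y_n^{k+1}=y_n^k-\beta_n^k\big(y_n^k-\nabla f_n(x^k;\zeta_n^k)\big)\ (n\in[N]),\qquad x^{k+1}=x^k-\alpha^k\frac1N\sum_{n=1}^N\mathcal{C}_n(y_n^k),$$ where $\mathcal{C}_n(\cdot)$ is the random compression operator used in node $n$, and the samples $\zeta_n^k\sim\mathcal{D}_n$ and the randomness of the compressors at iteration $k$ are drawn independently of the past. Conditions: (a) For any $n\in[N]$, $\nabla f_n(x)$ is $\ell_f$-Lipschitz continuous. (b) For any $n\in[N]$ and any $x$, $\nabla f_n(x;\zeta)$ is an unbiased estimator of $\nabla f_n(x)$ with its variance bounded by $\sigma_f^2$. (c) There exist positive constants $a,b$ such that $\frac1N\sum_{n=1}^N\|\nabla f_n(x)\|^2\le a\|\nabla F(x)\|^2+b^2$ for all $x\in\mathbb{R}^d$. (d) For any $n\in[N]$, $\mathbb{E}[\mathcal{C}_n(x)]=x$ and $\mathbb{E}[\|\mathcal{C}_n(x)-x\|^2]\le\omega\|x\|^2$ for all $x\in\mathbb{R}^d$.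 (e) $F(x)$ is $\mu$-strongly convex in $x$, where the constant $\mu>0$. (f) $F(x)$ is lower bounded by a constant $C_F$. Under (e), $x^\ast$ denotes the unique point with $\nabla F(x^\ast)=0$. Asymptotic notation (in $K$): $f=\mathcal{O}(g)$ if there are constants $c<\infty$, $M>0$ with $f(K)\le c\,g(K)$ for all $K\ge M$; $f=\Omega(g)$ if there are $c>0$, $M>0$ with $f(K)\ge c\,g(K)$ for all $K\ge M$; $f=\Theta(g)$ if both hold; $f=\tilde{\mathcal{O}}(g)$ means $f=\mathcal{O}(g\max\{1,|\log g|\})$.
   Formalization: The rates fail for arbitrary constants hidden in Θ; they are proved when every ratio β_n^k/α^k exceeds a problem-dependent threshold and, in the strongly convex part, the constant in α^k=Θ(log K/K) also exceeds one. *)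

theory Defs
  imports "HOL-Probability.Probability" "HOL-Library.Landau_Symbols"
begin

section \<open>Gradients and convexity\<close>

definition grad :: "('a::real_inner \<Rightarrow> real) \<Rightarrow> 'a \<Rightarrow> 'a" where
  "grad f x = (THE g. GDERIV f x :> g)"

definition strongly_convex :: "real \<Rightarrow> ('a::real_inner \<Rightarrow> real) \<Rightarrow> bool" where
  "strongly_convex \<mu> f \<longleftrightarrow> (\<forall>x y. \<forall>t\<in>{0..1}.
     f (t *\<^sub>R x + (1 - t) *\<^sub>R y)
       \<le> t * f x + (1 - t) * f y - \<mu> / 2 * t * (1 - t) * (norm (x - y))\<^sup>2)"

definition stationary_point :: "('a::real_inner \<Rightarrow> real) \<Rightarrow> 'a" where
  "stationary_point f = (THE x. grad f x = 0)"


section \<open>The distributed learning problem\<close>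

text \<open>Node \<open>n \<in> {1..N}\<close> has the data distribution \<open>D n\<close> and the sample loss
  \<open>loss n x z\<close>. Its compressor is driven by a random seed with distribution \<open>R n\<close>:
  \<open>C n v r\<close> is the compression of \<open>v\<close> under the seed \<open>r\<close>.\<close>

definition local_loss ::
    "(nat \<Rightarrow> 'z measure) \<Rightarrow> (nat \<Rightarrow> real^'d \<Rightarrow> 'z \<Rightarrow> real) \<Rightarrow> nat \<Rightarrow> real^'d \<Rightarrow> real" where
  "local_loss D loss n x = (LINT z|D n. loss n x z)"

definition global_loss ::
    "nat \<Rightarrow> (nat \<Rightarrow> 'z measure) \<Rightarrow> (nat \<Rightarrow> real^'d \<Rightarrow> 'z \<Rightarrow> real) \<Rightarrow> real^'d \<Rightarrow> real" where
  "global_loss N D loss x = (\<Sum>n=1..N. local_loss D loss n x) / real N"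

definition sample_grad ::
    "(nat \<Rightarrow> real^'d \<Rightarrow> 'z \<Rightarrow> real) \<Rightarrow> nat \<Rightarrow> real^'d \<Rightarrow> 'z \<Rightarrow> real^'d" where
  "sample_grad loss n x z = grad (\<lambda>u. loss n u z) x"

text \<open>What is implicit in writing down the problem and the algorithm: the expectations defining
  the local losses exist, the sample losses are differentiable, and sample gradients and
  compressed vectors are jointly measurable, so that the iterates are random vectors.\<close>

definition learning_problem ::
    "nat \<Rightarrow> (nat \<Rightarrow> 'z measure) \<Rightarrow> (nat \<Rightarrow> real^'d \<Rightarrow> 'z \<Rightarrow> real) \<Rightarrow>
     (nat \<Rightarrow> 'r measure) \<Rightarrow> (nat \<Rightarrow> real^'d \<Rightarrow> 'r \<Rightarrow> real^'d) \<Rightarrow> bool" where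
  "learning_problem N D loss R C \<longleftrightarrow> N \<ge> 1 \<and> (\<forall>n\<in>{1..N}.
     prob_space (D n) \<and> prob_space (R n) \<and>
     (\<forall>x. integrable (D n) (loss n x)) \<and>
     (\<forall>z\<in>space (D n). \<forall>x. (\<lambda>u. loss n u z) differentiable (at x)) \<and>
     (\<lambda>(x, z). sample_grad loss n x z) \<in> borel_measurable (borel \<Otimes>\<^sub>M D n) \<and>
     (\<lambda>(v, r). C n v r) \<in> borel_measurable (borel \<Otimes>\<^sub>M R n))"

definition smooth_losses ::
    "nat \<Rightarrow> (nat \<Rightarrow> 'z measure) \<Rightarrow> (nat \<Rightarrow> real^'d \<Rightarrow> 'z \<Rightarrow> real) \<Rightarrow> real \<Rightarrow> bool" where
  "smooth_losses N D loss \<ll> \<longleftrightarrow> (\<forall>n\<in>{1..N}.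
     (\<forall>x. local_loss D loss n differentiable (at x)) \<and>
     \<ll>-lipschitz_on UNIV (grad (local_loss D loss n)))"

text \<open>The Bochner integral of a non-integrable function is \<open>0\<close>; therefore integrability is
  always required along with a bound on an expectation.\<close>

definition unbiased_bounded_variance ::
    "'s measure \<Rightarrow> ('s \<Rightarrow> real^'d) \<Rightarrow> real^'d \<Rightarrow> real \<Rightarrow> bool" where
  "unbiased_bounded_variance P X v s \<longleftrightarrow>
     integrable P X \<and> (LINT w|P. X w) = v \<and>
     integrable P (\<lambda>w. (norm (X w - v))\<^sup>2) \<and> (LINT w|P. (norm (X w - v))\<^sup>2) \<le> s"

definition stochastic_gradients ::
    "nat \<Rightarrow> (nat \<Rightarrow> 'z measure) \<Rightarrow> (nat \<Rightarrow> real^'d \<Rightarrow> 'z \<Rightarrow> real) \<Rightarrow> real \<Rightarrow> bool" where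
  "stochastic_gradients N D loss \<sigma> \<longleftrightarrow> (\<forall>n\<in>{1..N}. \<forall>x.
     unbiased_bounded_variance (D n) (sample_grad loss n x) (grad (local_loss D loss n) x) (\<sigma>\<^sup>2))"

definition bounded_heterogeneity ::
    "nat \<Rightarrow> (nat \<Rightarrow> 'z measure) \<Rightarrow> (nat \<Rightarrow> real^'d \<Rightarrow> 'z \<Rightarrow> real) \<Rightarrow> real \<Rightarrow> real \<Rightarrow> bool" where
  "bounded_heterogeneity N D loss a b \<longleftrightarrow> (\<forall>x.
     (\<Sum>n=1..N. (norm (grad (local_loss D loss n) x))\<^sup>2) / real N
       \<le> a * (norm (grad (global_loss N D loss) x))\<^sup>2 + b\<^sup>2)"

definition unbiased_compressors ::
    "nat \<Rightarrow> (nat \<Rightarrow> 'r measure) \<Rightarrow> (nat \<Rightarrow> real^'d \<Rightarrow> 'r \<Rightarrow> real^'d) \<Rightarrow> real \<Rightarrow> bool" where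
  "unbiased_compressors N R C \<omega> \<longleftrightarrow> (\<forall>n\<in>{1..N}. \<forall>v.
     unbiased_bounded_variance (R n) (C n v) v (\<omega> * (norm v)\<^sup>2))"


section \<open>The algorithm\<close>

text \<open>A run of \<open>K\<close> iterations on the probability space \<open>M\<close> with samples \<open>\<zeta> n k\<close> and compressor
  seeds \<open>\<xi> n k\<close>. Independence of the past is expressed as independence, over the iterations \<open>k\<close>,
  of the tuples of all draws made in iteration \<open>k\<close>. The draws within one iteration (across nodes,
  and between sample and seed) may depend on each other.\<close>

definition algorithm_run ::
    "nat \<Rightarrow> (nat \<Rightarrow> 'z measure) \<Rightarrow> (nat \<Rightarrow> real^'d \<Rightarrow> 'z \<Rightarrow> real) \<Rightarrow>
     (nat \<Rightarrow> 'r measure) \<Rightarrow> (nat \<Rightarrow> real^'d \<Rightarrow> 'r \<Rightarrow> real^'d) \<Rightarrow>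
     nat \<Rightarrow> (nat \<Rightarrow> real) \<Rightarrow> (nat \<Rightarrow> nat \<Rightarrow> real) \<Rightarrow> real^'d \<Rightarrow> (nat \<Rightarrow> real^'d) \<Rightarrow>
     'w measure \<Rightarrow> (nat \<Rightarrow> nat \<Rightarrow> 'w \<Rightarrow> 'z) \<Rightarrow> (nat \<Rightarrow> nat \<Rightarrow> 'w \<Rightarrow> 'r) \<Rightarrow>
     (nat \<Rightarrow> 'w \<Rightarrow> real^'d) \<Rightarrow> (nat \<Rightarrow> nat \<Rightarrow> 'w \<Rightarrow> real^'d) \<Rightarrow> bool" where
  "algorithm_run N D loss R C K \<alpha> \<beta> x0 y0 M \<zeta> \<xi> x y \<longleftrightarrow>
     prob_space M \<and>
     (\<forall>n\<in>{1..N}. \<forall>k<K.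
        \<zeta> n k \<in> measurable M (D n) \<and> distr M (D n) (\<zeta> n k) = D n \<and>
        \<xi> n k \<in> measurable M (R n) \<and> distr M (R n) (\<xi> n k) = R n) \<and>
     prob_space.indep_vars M (\<lambda>_. \<Pi>\<^sub>M n\<in>{1..N}. D n \<Otimes>\<^sub>M R n)
        (\<lambda>k w. \<lambda>n\<in>{1..N}. (\<zeta> n k w, \<xi> n k w)) {..<K} \<and>
     (\<forall>w\<in>space M.
        x 0 w = x0 \<and> (\<forall>n\<in>{1..N}. y n 0 w = y0 n) \<and>
        (\<forall>k<K.
           (\<forall>n\<in>{1..N}. y n (Suc k) w
              = y n k w - \<beta> n k *\<^sub>R (y n k w - sample_grad loss n (x k w) (\<zeta> n k w))) \<and>
           x (Suc k) w
              = x k w - (\<alpha> k / real N) *\<^sub>R (\<Sum>n=1..N. C n (y n k w) (\<xi> n k w))))"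


section \<open>Step sizes and asymptotics in the number of iterations\<close>

text \<open>Step sizes depend on the total number \<open>K\<close> of iterations and on the iteration \<open>k\<close>;
  the constants hidden in the asymptotic notation are uniform in \<open>k\<close>.\<close>

definition step_theta :: "(nat \<Rightarrow> nat \<Rightarrow> real) \<Rightarrow> (nat \<Rightarrow> real) \<Rightarrow> bool" where
  "step_theta s g \<longleftrightarrow> (\<exists>c1>0. \<exists>c2. \<forall>\<^sub>F K in sequentially. \<forall>k<K.
     c1 * g K \<le> s K k \<and> s K k \<le> c2 * g K)"

definition step_sizes ::
    "nat \<Rightarrow> (nat \<Rightarrow> real) \<Rightarrow> (nat \<Rightarrow> nat \<Rightarrow> real) \<Rightarrow> (nat \<Rightarrow> nat \<Rightarrow> nat \<Rightarrow> real) \<Rightarrow> bool" where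
  "step_sizes N g \<alpha> \<beta> \<longleftrightarrow>
     (\<forall>K. \<forall>k<K. \<alpha> K k > 0 \<and> (\<forall>n\<in>{1..N}. \<beta> K n k > 0)) \<and>
     step_theta \<alpha> g \<and> (\<forall>n\<in>{1..N}. step_theta (\<lambda>K k. \<beta> K n k) g)"

text \<open>The rates below do not hold for arbitrary hidden constants: a step size
  \<open>\<alpha> = c ln K / K\<close> only contracts the initial error by a power of \<open>K\<close> that depends on \<open>c\<close>, and
  the iteration can diverge when the momentum step sizes are too small relative to \<open>\<alpha>\<close>. So the
  constant of \<open>\<alpha>\<close> has to exceed some \<open>c\<close>, and the ratios \<open>\<beta> / \<alpha>\<close> some \<open>\<rho>\<close>. For \<open>c = 0\<close>
  the first requirement is void for positive step sizes.\<close>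

definition admissible_constants ::
    "nat \<Rightarrow> real \<Rightarrow> real \<Rightarrow> (nat \<Rightarrow> real) \<Rightarrow> (nat \<Rightarrow> nat \<Rightarrow> real) \<Rightarrow> (nat \<Rightarrow> nat \<Rightarrow> nat \<Rightarrow> real) \<Rightarrow> bool"
where
  "admissible_constants N c \<rho> g \<alpha> \<beta> \<longleftrightarrow> (\<forall>\<^sub>F K in sequentially. \<forall>k<K.
     c * g K \<le> \<alpha> K k \<and> (\<forall>n\<in>{1..N}. \<rho> * \<alpha> K k \<le> \<beta> K n k))"

definition soft_bigo :: "(nat \<Rightarrow> real) \<Rightarrow> (nat \<Rightarrow> real) set" where
  "soft_bigo g = O(\<lambda>K. g K * max 1 \<bar>ln (g K)\<bar>)"

end

theory Submission
  imports Defs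
begin

text \<open>The errors \<open>y n k - g n (x k)\<close>, where \<open>g n\<close> is the gradient of node \<open>n\<close>, cannot be bounded by
  a recursion of their own: \<open>g n\<close> is only Lipschitz, so the compression noise in \<open>x (k + 1)\<close> can
  shift \<open>g n (x k)\<close> by a conditional mean of the order of the step size, and this noise does not
  vanish at the optimum. But \<open>y n k\<close> is an exponentially weighted average of the gradients at the
  past iterates plus a weighted sum of sampling noise. By convexity and the Lipschitz condition, the
  first part deviates from \<open>g n (x k)\<close> by at most \<open>\<ll>\<close> times the root of the weighted mean squared
  distance of \<open>x k\<close> to the past iterates. That distance is quadratic in \<open>x k\<close>, so only the
  conditional mean of the search direction, which is close to the gradient of \<open>F\<close>, enters its
  recursion to first order; the compression noise contributes to second order. The second part
  contracts with the momentum step sizes. Adding both to the squared distance to the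
  minimizer, or to the optimality gap of \<open>F\<close>, gives a Lyapunov function whose expectation
  decreases up to an error quadratic in the step sizes, provided the momentum steps are a large
  enough multiple of \<open>\<alpha>\<close>.\<close>

section \<open>Gradients and elementary inequalities\<close>

text \<open>The threshold on the ratio of the step sizes comes from a feedback loop. The decrease of
  the distance or of the optimality gap is spoiled by the momentum error with a fixed coefficient.
  That error is at most a multiple of spread plus accumulated noise, and both contract at a rate of
  at least \<open>\<rho> * \<alpha> / 2\<close>. The spread in turn is fed by gradient and momentum
  error with the coefficient \<open>4 * \<alpha> / \<rho>\<close>, the result of Young's inequality
  paid with half of the contraction. A large \<open>\<rho>\<close> thus strengthens the absorption
  and weakens the feeding at once. The gradient part of the feeding has to be paid by a negative
  gradient term, which is why such a term is kept even where strong convexity would already give a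
  contraction. The terms quadratic in \<open>\<alpha>\<close> contain the second moment of the
  search direction, for which there is no a priori bound; it is estimated by the same quantities,
  and small steps absorb it. Independence is used only between an iteration and its past; averages
  over nodes are handled by convexity.\<close>

lemma GDERIV_unique:
  fixes f :: "'a::real_inner \<Rightarrow> real"
  assumes "GDERIV f x :> g" "GDERIV f x :> h"
  shows "g = h"
proof -
  have "(\<lambda>u. u \<bullet> g) = (\<lambda>u. u \<bullet> h)"
    using assms has_derivative_unique unfolding gderiv_def by blast
  then show ?thesis
    by (metis inner_commute vector_eq_ldot)
qed

lemma grad_eqI: "GDERIV f x :> g \<Longrightarrow> grad f x = g"
  unfolding grad_def by (blast intro: GDERIV_unique)

text \<open>The \<open>THE\<close> in \<open>grad\<close> is meaningful only once some gradient
  exists. In finite dimension the derivative is a linear functional, represented by the vector of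
  its values on the basis.\<close>

lemma GDERIV_grad:
  fixes f :: "'a::euclidean_space \<Rightarrow> real"
  assumes "f differentiable (at x)"
  shows "GDERIV f x :> grad f x"
proof -
  obtain f' where f': "(f has_derivative f') (at x)"
    using assms by (auto simp: differentiable_def)
  interpret bounded_linear f' using f' by (rule has_derivative_bounded_linear)
  define g where "g = (\<Sum>i\<in>Basis. f' i *\<^sub>R i)"
  have "f' h = h \<bullet> g" for h
  proof -
    have "f' h = f' (\<Sum>i\<in>Basis. (h \<bullet> i) *\<^sub>R i)" by (simp add: euclidean_representation)
    also have "\<dots> = h \<bullet> g" by (simp add: sum scaleR g_def inner_sum_right mult.commute)
    finally show ?thesis .
  qed
  then have "f' = (\<lambda>h. h \<bullet> g)" by blast
  then have "GDERIV f x :> g" using f' by (simp add: gderiv_def)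
  then show ?thesis using grad_eqI by blast
qed

text \<open>The mean value theorem along the segment gives the factor \<open>L\<close> where
  integrating the gradient would give \<open>L / 2\<close>; the rates are insensitive to this
  factor.\<close>

lemma lipschitz_grad_descent:
  fixes f :: "'a::euclidean_space \<Rightarrow> real"
  assumes diff: "\<And>x. f differentiable (at x)"
    and lip: "\<And>x y. norm (grad f x - grad f y) \<le> L * norm (x - y)"
  shows "f (x + h) \<le> f x + grad f x \<bullet> h + L * (norm h)\<^sup>2"
proof -
  define \<phi> where "\<phi> t = f (x + t *\<^sub>R h)" for t
  \<comment> \<open>The sign of \<open>L\<close> is not assumed; the Lipschitz bound itself forces
    this product to be nonnegative.\<close>
  have L: "L * norm h \<ge> 0"
    using lip[of "x + h" x] norm_ge_zero by (metis add_diff_cancel_left' order_trans)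
  have d: "(\<phi> has_real_derivative grad f (x + t *\<^sub>R h) \<bullet> h) (at t)" for t
  proof -
    have 1: "((\<lambda>t. x + t *\<^sub>R h) has_derivative (\<lambda>t. t *\<^sub>R h)) (at t)"
      by (auto intro!: derivative_eq_intros)
    have "(\<phi> has_derivative (\<lambda>s. (s *\<^sub>R h) \<bullet> grad f (x + t *\<^sub>R h))) (at t)"
      unfolding \<phi>_def
      using has_derivative_compose[OF 1] GDERIV_grad[OF diff, unfolded gderiv_def] by blast
    then show ?thesis
      by (simp add: has_field_derivative_def inner_commute mult.commute[of _ "_ \<bullet> _"])
  qed
  obtain t where t: "0 < t" "t < 1" "\<phi> 1 - \<phi> 0 = (1 - 0) * (grad f (x + t *\<^sub>R h) \<bullet> h)"
    using MVT2[of 0 1 \<phi> "\<lambda>t. grad f (x + t *\<^sub>R h) \<bullet> h"] d by auto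
  have "(grad f (x + t *\<^sub>R h) - grad f x) \<bullet> h \<le> norm (grad f (x + t *\<^sub>R h) - grad f x) * norm h"
    by (rule norm_cauchy_schwarz)
  also have "\<dots> \<le> (L * norm (t *\<^sub>R h)) * norm h"
    using lip[of "x + t *\<^sub>R h" x] by (intro mult_right_mono) auto
  also have "\<dots> = t * ((L * norm h) * norm h)" using t by simp
  also have "\<dots> \<le> 1 * ((L * norm h) * norm h)"
    using t mult_nonneg_nonneg[OF L norm_ge_zero] by (intro mult_right_mono) auto
  finally show ?thesis
    using t(3) by (simp add: \<phi>_def inner_diff_left power2_eq_square mult.assoc)
qed

text \<open>Dividing the defining inequality by \<open>t\<close> and letting \<open>t\<close> tend
  to \<open>0\<close> from the right turns the difference quotient into the directional
  derivative.\<close>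

lemma strongly_convex_grad:
  fixes f :: "'a::euclidean_space \<Rightarrow> real"
  assumes sc: "strongly_convex \<mu> f" and diff: "f differentiable (at x)"
  shows "f x + grad f x \<bullet> h + \<mu> / 2 * (norm h)\<^sup>2 \<le> f (x + h)"
proof -
  define \<phi> where "\<phi> t = f (x + t *\<^sub>R h)" for t
  have d: "(\<phi> has_real_derivative grad f x \<bullet> h) (at 0)"
  proof -
    have 1: "((\<lambda>t. x + t *\<^sub>R h) has_derivative (\<lambda>t. t *\<^sub>R h)) (at 0)"
      by (auto intro!: derivative_eq_intros)
    have "(f has_derivative (\<lambda>s. s \<bullet> grad f x)) (at (x + 0 *\<^sub>R h))"
      using GDERIV_grad[OF diff, unfolded gderiv_def] by simp
    from has_derivative_compose[OF 1 this]
    have "(\<phi> has_derivative (\<lambda>s. (s *\<^sub>R h) \<bullet> grad f x)) (at 0)"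
      unfolding \<phi>_def .
    then show ?thesis
      by (simp add: has_field_derivative_def inner_commute mult.commute[of _ "_ \<bullet> _"])
  qed
  have "((\<lambda>t. (\<phi> t - \<phi> 0) / t) \<longlongrightarrow> grad f x \<bullet> h) (at_right 0)"
    using d unfolding has_field_derivative_iff
    by (simp add: filterlim_at_split)
  moreover have "((\<lambda>t. f (x + h) - f x - \<mu> / 2 * (1 - t) * (norm h)\<^sup>2)
      \<longlongrightarrow> f (x + h) - f x - \<mu> / 2 * (1 - 0) * (norm h)\<^sup>2) (at_right 0)"
    by (intro tendsto_intros)
  moreover have "\<forall>\<^sub>F t in at_right 0. (\<phi> t - \<phi> 0) / t \<le> f (x + h) - f x - \<mu> / 2 * (1 - t) * (norm h)\<^sup>2"
  proof -
    have "(\<phi> t - \<phi> 0) / t \<le> f (x + h) - f x - \<mu> / 2 * (1 - t) * (norm h)\<^sup>2"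
      if t: "0 < t" "t < 1" for t
    proof -
      have "f (t *\<^sub>R (x + h) + (1 - t) *\<^sub>R x)
          \<le> t * f (x + h) + (1 - t) * f x - \<mu> / 2 * t * (1 - t) * (norm (x + h - x))\<^sup>2"
        using sc[unfolded strongly_convex_def, rule_format, of t "x + h" x] t by auto
      moreover have "t *\<^sub>R (x + h) + (1 - t) *\<^sub>R x = x + t *\<^sub>R h"
        by (simp add: algebra_simps)
      ultimately have "\<phi> t - \<phi> 0 \<le> t * (f (x + h) - f x - \<mu> / 2 * (1 - t) * (norm h)\<^sup>2)"
        by (simp add: \<phi>_def algebra_simps)
      then show ?thesis using t by (simp add: divide_le_eq mult.commute)
    qed
    then show ?thesis
      by (auto simp: eventually_at_right_field intro!: exI[of _ 1])
  qed
  ultimately have "grad f x \<bullet> h \<le> f (x + h) - f x - \<mu> / 2 * (1 - 0) * (norm h)\<^sup>2"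
    by (intro tendsto_le[OF trivial_limit_at_right_real])
  then show ?thesis by simp
qed

text \<open>Adding the first-order lower bounds at \<open>x\<close> and at \<open>y\<close> cancels
  the function values, and the two halves of \<open>\<mu>\<close> add up.\<close>

lemma strongly_convex_grad_monotone:
  fixes f :: "'a::euclidean_space \<Rightarrow> real"
  assumes sc: "strongly_convex \<mu> f" and diff: "\<And>x. f differentiable (at x)"
  shows "\<mu> * (norm (x - y))\<^sup>2 \<le> (grad f x - grad f y) \<bullet> (x - y)"
proof -
  have "f x + grad f x \<bullet> (y - x) + \<mu> / 2 * (norm (y - x))\<^sup>2 \<le> f y"
    using strongly_convex_grad[OF sc diff, of x "y - x"] by simp
  moreover have "f y + grad f y \<bullet> (x - y) + \<mu> / 2 * (norm (x - y))\<^sup>2 \<le> f x"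
    using strongly_convex_grad[OF sc diff, of y "x - y"] by simp
  ultimately show ?thesis
    by (simp add: norm_minus_commute[of y x] inner_diff_left inner_diff_right)
qed

text \<open>The description operator in \<open>stationary_point\<close> needs existence and
  uniqueness. Existence comes from a minimizer on a compact ball that is large enough to be global,
  uniqueness from strong monotonicity.\<close>

lemma strongly_convex_stationary_point:
  fixes f :: "'a::euclidean_space \<Rightarrow> real"
  assumes sc: "strongly_convex \<mu> f" and mu: "\<mu> > 0" and diff: "\<And>x. f differentiable (at x)"
  shows "grad f (stationary_point f) = 0"
proof -
  \<comment> \<open>Beyond this radius the quadratic growth
    \<open>\<mu> / 2 * (norm y)\<^sup>2\<close> outweighs the linear term of the lower bound at
    \<open>0\<close>, so no value there is below \<open>f 0\<close>.\<close>
  define r where "r = 2 * norm (grad f 0) / \<mu>"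
  have "continuous_on (cball 0 r) f"
    by (meson diff differentiable_imp_continuous_within continuous_at_imp_continuous_on)
  moreover have "cball (0::'a) r \<noteq> {}" using mu by (simp add: r_def not_less)
  ultimately obtain z where z: "z \<in> cball 0 r" "\<And>y. y \<in> cball 0 r \<Longrightarrow> f z \<le> f y"
    using continuous_attains_inf[of "cball 0 r" f] by auto
  have "f z \<le> f y" for y
  proof (cases "y \<in> cball 0 r")
    case False
    then have "2 * norm (grad f 0) < \<mu> * norm y"
      using mu by (simp add: r_def not_le pos_divide_less_eq mult.commute)
    then have "norm (grad f 0) * norm y \<le> \<mu> / 2 * norm y * norm y"
      by (intro mult_right_mono) auto
    moreover have "f 0 + grad f 0 \<bullet> y + \<mu> / 2 * (norm y)\<^sup>2 \<le> f y"
      using strongly_convex_grad[OF sc diff, of 0 y] by simp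
    moreover have "\<bar>grad f 0 \<bullet> y\<bar> \<le> norm (grad f 0) * norm y"
      by (rule Cauchy_Schwarz_ineq2)
    ultimately have "f 0 \<le> f y" by (simp add: power2_eq_square)
    moreover have "f z \<le> f 0" using mu by (intro z) (simp add: r_def)
    ultimately show ?thesis by simp
  qed (simp add: z)
  then have "(\<lambda>h. h \<bullet> grad f z) = (\<lambda>h. 0)"
    using differential_zero_maxmin[of z UNIV f "\<lambda>h. h \<bullet> grad f z"] GDERIV_grad[OF diff, of z]
    by (auto simp: gderiv_def)
  then have z0: "grad f z = 0"
    by (metis inner_eq_zero_iff)
  moreover have "y = z" if "grad f y = 0" for y
  proof -
    have "\<mu> * (norm (y - z))\<^sup>2 \<le> 0"
      using strongly_convex_grad_monotone[OF sc diff, of y z] that z0 by simp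
    then show ?thesis using mu by (simp add: mult_le_0_iff)
  qed
  ultimately show ?thesis
    unfolding stationary_point_def by (metis (mono_tags, lifting) theI)
qed

text \<open>The defect term is kept exactly because \<open>momentum_average\<close> uses the
  identity twice: once with this term dropped, as convexity, and once in full, to update a
  variance.\<close>

lemma norm_convex_combination_sq:
  fixes p q :: "'a::real_inner"
  shows "(norm ((1 - t) *\<^sub>R p + t *\<^sub>R q))\<^sup>2
    = (1 - t) * (norm p)\<^sup>2 + t * (norm q)\<^sup>2 - t * (1 - t) * (norm (p - q))\<^sup>2"
  by (simp add: power2_norm_eq_inner inner_add_left inner_add_right inner_diff_left
      inner_diff_right inner_commute[of q p] algebra_simps)

lemma norm_diff_scaleR_sq:
  fixes p q :: "'a::real_inner"
  shows "(norm (p - t *\<^sub>R q))\<^sup>2 = (norm p)\<^sup>2 - 2 * t * (p \<bullet> q) + t\<^sup>2 * (norm q)\<^sup>2"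
  unfolding power2_norm_eq_inner
  by (simp add: inner_diff_left inner_diff_right inner_commute[of q p] power2_eq_square algebra_simps)

lemma inner_young:
  fixes p q :: "'a::real_inner"
  assumes "c > 0"
  shows "2 * \<bar>p \<bullet> q\<bar> \<le> c * (norm p)\<^sup>2 + (1 / c) * (norm q)\<^sup>2"
proof -
  have "0 \<le> (c * norm p - norm q)\<^sup>2" by simp
  then have "c * (2 * (norm p * norm q)) \<le> c * (c * (norm p)\<^sup>2 + (1 / c) * (norm q)\<^sup>2)"
    using assms by (simp add: power2_eq_square algebra_simps)
  then have "2 * (norm p * norm q) \<le> c * (norm p)\<^sup>2 + (1 / c) * (norm q)\<^sup>2"
    using assms by (simp only: mult_le_cancel_left_pos)
  then show ?thesis using Cauchy_Schwarz_ineq2[of p q] by linarith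
qed

lemma norm_add_sq_le:
  fixes u v :: "'a::real_inner"
  shows "(norm (u + v))\<^sup>2 \<le> 2 * (norm u)\<^sup>2 + 2 * (norm v)\<^sup>2"
  using inner_ge_zero[of "u - v"]
  by (simp add: power2_norm_eq_inner inner_add_left inner_add_right inner_diff_left inner_diff_right
      inner_commute[of v u])

text \<open>Cauchy-Schwarz against the constant vector. It applies to node averages whatever the
  dependence between the nodes, at the price of no variance reduction in \<open>N\<close>.\<close>

lemma norm_mean_sq_le:
  fixes v :: "nat \<Rightarrow> 'a::real_normed_vector"
  assumes "N \<ge> 1"
  shows "(norm ((1 / real N) *\<^sub>R (\<Sum>n=1..N. v n)))\<^sup>2 \<le> (\<Sum>n=1..N. (norm (v n))\<^sup>2) / real N"
proof -
  have "(norm (\<Sum>n=1..N. v n))\<^sup>2 \<le> (\<Sum>n=1..N. 1 * norm (v n))\<^sup>2"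
    by (intro power_mono) (auto intro: norm_sum)
  also have "\<dots> \<le> (\<Sum>n=1..N. 1\<^sup>2) * (\<Sum>n=1..N. (norm (v n))\<^sup>2)"
    by (rule Cauchy_Schwarz_ineq_sum)
  finally show ?thesis
    using assms by (simp add: power_mult_distrib power_divide divide_simps power2_eq_square mult.commute)
qed

lemma integrable_sum_divide:
  fixes h :: "'i \<Rightarrow> 'a \<Rightarrow> real"
  assumes "\<And>n. n \<in> I \<Longrightarrow> integrable M (h n)"
  shows "integrable M (\<lambda>w. (\<Sum>n\<in>I. h n w) / c)"
    and "(LINT w|M. (\<Sum>n\<in>I. h n w) / c) = (\<Sum>n\<in>I. LINT w|M. h n w) / c"
  using assms by simp_all

text \<open>The value \<open>e / \<tau>\<close> is the fixed point of the affine map, so adding it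
  to the geometric term gives a bound that the recursion reproduces.\<close>

lemma affine_contraction:
  fixes L :: "nat \<Rightarrow> real"
  assumes step: "\<And>k. k < K \<Longrightarrow> L (Suc k) \<le> (1 - \<tau>) * L k + e" and \<tau>: "0 < \<tau>" "\<tau> \<le> 1" and e: "0 \<le> e"
  shows "L K \<le> (1 - \<tau>) ^ K * L 0 + e / \<tau>"
proof -
  have "L k \<le> (1 - \<tau>) ^ k * L 0 + e / \<tau>" if "k \<le> K" for k
    using that
  proof (induction k)
    case 0
    then show ?case using \<tau> e by simp
  next
    case (Suc k)
    then have "L (Suc k) \<le> (1 - \<tau>) * L k + e" using step by simp
    also have "\<dots> \<le> (1 - \<tau>) * ((1 - \<tau>) ^ k * L 0 + e / \<tau>) + e"
      using Suc \<tau> by (intro add_right_mono mult_left_mono) auto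
    also have "\<dots> = (1 - \<tau>) ^ Suc k * L 0 + e / \<tau>"
      using \<tau> by (simp add: field_simps)
    finally show ?case .
  qed
  then show ?thesis by simp
qed

text \<open>Condenses the hidden constants of all nodes into one lower constant \<open>c1\<close>
  and one upper constant \<open>B\<close>. Since \<open>h\<close> tends to \<open>0\<close>, every
  smallness requirement on the steps can be delegated to \<open>\<epsilon>\<close>.\<close>

lemma step_sizes_eventually:
  assumes ss: "step_sizes N h \<alpha> \<beta>" and ac: "admissible_constants N c \<rho> h \<alpha> \<beta>"
    and h: "h \<longlonglongrightarrow> 0" "\<And>K. 0 \<le> h K" and \<epsilon>: "\<epsilon> > 0"
  obtains c1 B :: real where "c1 > 0" "B > 0"
    "\<forall>\<^sub>F K in sequentially. B * h K \<le> \<epsilon> \<and> (\<forall>k<K. 0 < \<alpha> K k \<and> c1 * h K \<le> \<alpha> K k \<and> c * h K \<le> \<alpha> K k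
      \<and> \<alpha> K k \<le> B * h K \<and> (\<forall>n\<in>{1..N}. \<rho> * \<alpha> K k \<le> \<beta> K n k \<and> \<beta> K n k \<le> B * h K))"
proof -
  have pos: "\<And>K k. k < K \<Longrightarrow> 0 < \<alpha> K k" using ss by (simp add: step_sizes_def)
  obtain c1 c2 where c1: "c1 > 0" and
    a: "\<forall>\<^sub>F K in sequentially. \<forall>k<K. c1 * h K \<le> \<alpha> K k \<and> \<alpha> K k \<le> c2 * h K"
    using ss unfolding step_sizes_def step_theta_def by blast
  have "\<forall>n\<in>{1..N}. \<exists>c3. \<forall>\<^sub>F K in sequentially. \<forall>k<K. \<beta> K n k \<le> c3 * h K"
  proof
    fix n assume "n \<in> {1..N}"
    then have "step_theta (\<lambda>K k. \<beta> K n k) h" using ss by (simp add: step_sizes_def)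
    then obtain d c3 where "\<forall>\<^sub>F K in sequentially. \<forall>k<K. d * h K \<le> \<beta> K n k \<and> \<beta> K n k \<le> c3 * h K"
      unfolding step_theta_def by blast
    then have "\<forall>\<^sub>F K in sequentially. \<forall>k<K. \<beta> K n k \<le> c3 * h K"
      by (rule eventually_mono) blast
    then show "\<exists>c3. \<forall>\<^sub>F K in sequentially. \<forall>k<K. \<beta> K n k \<le> c3 * h K" by blast
  qed
  from bchoice[OF this]
  obtain c3 where "\<forall>n\<in>{1..N}. \<forall>\<^sub>F K in sequentially. \<forall>k<K. \<beta> K n k \<le> c3 n * h K" ..
  then have b: "\<forall>\<^sub>F K in sequentially. \<forall>n\<in>{1..N}. \<forall>k<K. \<beta> K n k \<le> c3 n * h K"
    by (intro eventually_ball_finite) auto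
  \<comment> \<open>A sum instead of a maximum: positive through the summand 1, and above
    \<open>c2\<close> and every \<open>c3 n\<close>.\<close>
  define B where "B = 1 + \<bar>c2\<bar> + (\<Sum>n=1..N. \<bar>c3 n\<bar>)"
  have B: "B > 0" "c2 \<le> B"
  proof -
    have "0 \<le> (\<Sum>n=1..N. \<bar>c3 n\<bar>)" by (intro sum_nonneg) auto
    then show "B > 0" "c2 \<le> B" unfolding B_def by linarith+
  qed
  have B3: "c3 n \<le> B" if "n \<in> {1..N}" for n
  proof -
    have "\<bar>c3 n\<bar> \<le> (\<Sum>n=1..N. \<bar>c3 n\<bar>)" using that by (intro member_le_sum) auto
    then show ?thesis unfolding B_def by linarith
  qed
  have "(\<lambda>K. B * h K) \<longlonglongrightarrow> B * 0" by (intro tendsto_intros h)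
  then have "\<forall>\<^sub>F K in sequentially. B * h K < \<epsilon>" using \<epsilon> by (intro order_tendstoD) auto
  with a b ac[unfolded admissible_constants_def]
  have "\<forall>\<^sub>F K in sequentially. B * h K \<le> \<epsilon> \<and> (\<forall>k<K. 0 < \<alpha> K k \<and> c1 * h K \<le> \<alpha> K k \<and> c * h K \<le> \<alpha> K k
      \<and> \<alpha> K k \<le> B * h K \<and> (\<forall>n\<in>{1..N}. \<rho> * \<alpha> K k \<le> \<beta> K n k \<and> \<beta> K n k \<le> B * h K))"
  proof eventually_elim
    case (elim K)
    show ?case
    proof (intro conjI allI impI ballI)
      fix k assume k: "k < K"
      show "\<alpha> K k \<le> B * h K"
        by (rule order_trans[OF _ mult_right_mono[OF B(2) h(2)[of K]]]) (use elim(1) k in blast)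
      fix n assume n: "n \<in> {1..N}"
      show "\<beta> K n k \<le> B * h K"
        by (rule order_trans[OF _ mult_right_mono[OF B3[OF n] h(2)[of K]]]) (use elim(2) k n in blast)
    qed (use elim pos in auto)
  qed
  with c1 B(1) show ?thesis by (rule that)
qed

section \<open>Square-integrable vectors and independent draws\<close>

context prob_space
begin

text \<open>Measurability refers to \<open>H\<close>, integrability to \<open>M\<close>. For a
  history \<open>H\<close> this means adapted to the past with finite second moment.\<close>

definition sq_integrable :: "'a measure \<Rightarrow> ('a \<Rightarrow> 'b::euclidean_space) \<Rightarrow> bool" where
  "sq_integrable H X \<longleftrightarrow> X \<in> borel_measurable H \<and> integrable M (\<lambda>w. (norm (X w))\<^sup>2)"

definition subalg :: "'a measure \<Rightarrow> bool" where
  "subalg H \<longleftrightarrow> space H = space M \<and> sets H \<subseteq> sets M"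

lemma subalg_measurable: "subalg H \<Longrightarrow> X \<in> measurable H N \<Longrightarrow> X \<in> measurable M N"
  unfolding subalg_def measurable_def by auto

lemma sq_integrable_measurable: "subalg H \<Longrightarrow> sq_integrable H X \<Longrightarrow> X \<in> borel_measurable M"
  unfolding sq_integrable_def by (blast intro: subalg_measurable)

lemma sq_integrableD: "sq_integrable H X \<Longrightarrow> integrable M (\<lambda>w. (norm (X w))\<^sup>2)"
  by (simp add: sq_integrable_def)

lemma sq_integrable_bound:
  assumes H: "subalg H" and X: "X \<in> borel_measurable H"
    and b: "integrable M g" "\<And>w. w \<in> space M \<Longrightarrow> (norm (X w))\<^sup>2 \<le> g w"
  shows "sq_integrable H X"
  unfolding sq_integrable_def
proof
  have "X \<in> borel_measurable M" using subalg_measurable[OF H X] .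
  then show "integrable M (\<lambda>w. (norm (X w))\<^sup>2)"
    using b by (intro Bochner_Integration.integrable_bound[OF b(1)])
      (auto intro!: AE_I2 order_trans[OF _ abs_ge_self])
qed (fact X)

lemma sq_integrable_const: "sq_integrable H (\<lambda>w. c)"
  unfolding sq_integrable_def by simp

lemma sq_integrable_scaleR: "sq_integrable H X \<Longrightarrow> sq_integrable H (\<lambda>w. c *\<^sub>R X w)"
  unfolding sq_integrable_def by (auto simp: power_mult_distrib)

lemma sq_integrable_add:
  assumes H: "subalg H" and "sq_integrable H X" "sq_integrable H Y"
  shows "sq_integrable H (\<lambda>w. X w + Y w)"
proof (rule sq_integrable_bound[OF H])
  show "integrable M (\<lambda>w. 2 * (norm (X w))\<^sup>2 + 2 * (norm (Y w))\<^sup>2)"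
    using assms unfolding sq_integrable_def by auto
qed (use assms in \<open>auto simp: sq_integrable_def norm_add_sq_le\<close>)

lemma sq_integrable_diff:
  assumes "subalg H" "sq_integrable H X" "sq_integrable H Y"
  shows "sq_integrable H (\<lambda>w. X w - Y w)"
  using sq_integrable_add[OF assms(1,2) sq_integrable_scaleR[OF assms(3), of "-1"]] by simp

lemma sq_integrable_sum:
  assumes "subalg H" "\<And>i. i \<in> I \<Longrightarrow> sq_integrable H (X i)"
  shows "sq_integrable H (\<lambda>w. \<Sum>i\<in>I. X i w)"
  using assms(2)
  by (induction I rule: infinite_finite_induct)
    (auto intro: sq_integrable_const sq_integrable_add[OF assms(1)])

lemma sq_integrable_lipschitz:
  fixes g :: "'b::euclidean_space \<Rightarrow> 'c::euclidean_space"
  assumes H: "subalg H" and X: "sq_integrable H X"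
    and g: "\<And>u v. norm (g u - g v) \<le> L * norm (u - v)"
  shows "sq_integrable H (\<lambda>w. g (X w))"
proof -
  have [measurable]: "g \<in> borel_measurable borel"
  proof (rule borel_measurable_continuous_onI)
    \<comment> \<open>A basis vector has norm 1, so the Lipschitz bound between it and
      \<open>0\<close> has right-hand side \<open>L\<close>.\<close>
    have "0 \<le> L"
      using order_trans[OF norm_ge_zero g[of "SOME i. i \<in> Basis" 0]] norm_Basis[OF SOME_Basis] by simp
    then have "L-lipschitz_on UNIV g"
      using g by (auto simp: lipschitz_on_def dist_norm)
    then show "continuous_on UNIV g" by (rule lipschitz_on_continuous_on)
  qed
  have [measurable]: "X \<in> borel_measurable H" using X by (simp add: sq_integrable_def)
  show ?thesis
  proof (rule sq_integrable_bound[OF H])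
    show "integrable M (\<lambda>w. 2 * L\<^sup>2 * (norm (X w))\<^sup>2 + 2 * (norm (g 0))\<^sup>2)"
      using X by (auto simp: sq_integrable_def)
    show "(norm (g (X w)))\<^sup>2 \<le> 2 * L\<^sup>2 * (norm (X w))\<^sup>2 + 2 * (norm (g 0))\<^sup>2" for w
    proof -
      have "(norm (g (X w) - g 0))\<^sup>2 \<le> (L * norm (X w))\<^sup>2"
        using g[of "X w" 0] by (intro power_mono) auto
      then show ?thesis
        using norm_add_sq_le[of "g (X w) - g 0" "g 0"] by (simp add: power_mult_distrib)
    qed
  qed measurable
qed

lemma integrable_inner_sq:
  assumes H: "subalg H" and "sq_integrable H X" "sq_integrable H Y"
  shows "integrable M (\<lambda>w. X w \<bullet> Y w)"
proof -
  have "integrable M (\<lambda>w. (norm (X w))\<^sup>2 + (norm (Y w))\<^sup>2)"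
    using assms by (simp add: sq_integrable_def)
  moreover have "(\<lambda>w. X w \<bullet> Y w) \<in> borel_measurable M"
    using assms by (intro borel_measurable_inner) (auto intro: sq_integrable_measurable)
  moreover have "norm (X w \<bullet> Y w) \<le> norm ((norm (X w))\<^sup>2 + (norm (Y w))\<^sup>2)" for w
  proof -
    have "\<bar>X w \<bullet> Y w\<bar> \<le> norm (X w) * norm (Y w)" by (rule Cauchy_Schwarz_ineq2)
    also have "\<dots> \<le> (norm (X w))\<^sup>2 + (norm (Y w))\<^sup>2"
      using sum_squares_bound[of "norm (X w)" "norm (Y w)"]
        mult_nonneg_nonneg[OF norm_ge_zero[of "X w"] norm_ge_zero[of "Y w"]] by linarith
    finally show ?thesis by simp
  qed
  ultimately show ?thesis
    by (rule Bochner_Integration.integrable_bound[OF _ _ AE_I2])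
qed

text \<open>Only the sigma-algebra of \<open>H\<close> matters. The product formula is independence
  of \<open>Z\<close> from it, written on the rectangles that determine a joint law.\<close>

definition fresh_draw :: "'a measure \<Rightarrow> 'z measure \<Rightarrow> ('a \<Rightarrow> 'z) \<Rightarrow> bool" where
  "fresh_draw H Q Z \<longleftrightarrow> subalg H \<and> Z \<in> measurable M Q \<and> distr M Q Z = Q \<and>
     (\<forall>A\<in>sets H. \<forall>B\<in>sets Q. prob (A \<inter> (Z -` B \<inter> space M)) = prob A * prob (Z -` B \<inter> space M))"

text \<open>The sets of the pullback algebra of \<open>X\<close> are exactly the generated family in
  the library's notion of independence, and an event of \<open>g (Y w)\<close> is an event of
  \<open>Y\<close>.\<close>

lemma fresh_draw_indep_var:
  assumes i: "indep_var S X T Y" and g: "g \<in> measurable T Q"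
    and d: "distr M Q (\<lambda>w. g (Y w)) = Q"
  shows "fresh_draw (vimage_algebra (space M) X S) Q (\<lambda>w. g (Y w))"
proof -
  have rv: "random_variable S X" "random_variable T Y"
    and ind: "indep_set (sigma_sets (space M) {X -` A \<inter> space M |A. A \<in> sets S})
      (sigma_sets (space M) {Y -` A \<inter> space M |A. A \<in> sets T})"
    using i by (auto simp: indep_var_eq)
  have X: "X \<in> space M \<rightarrow> space S" using measurable_space[OF rv(1)] by auto
  have "sets (vimage_algebra (space M) X S) \<subseteq> sets M"
    using rv by (auto simp: sets_vimage_algebra2[OF X])
  moreover have "prob (A \<inter> ((\<lambda>w. g (Y w)) -` B \<inter> space M))
      = prob A * prob ((\<lambda>w. g (Y w)) -` B \<inter> space M)"
    if A: "A \<in> sets (vimage_algebra (space M) X S)" and B: "B \<in> sets Q" for A B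
  proof -
    have "(\<lambda>w. g (Y w)) -` B \<inter> space M = Y -` (g -` B \<inter> space T) \<inter> space M"
      using measurable_space[OF rv(2)] by auto
    moreover have "g -` B \<inter> space T \<in> sets T" using g B by (rule measurable_sets)
    ultimately have "(\<lambda>w. g (Y w)) -` B \<inter> space M \<in> sigma_sets (space M) {Y -` A \<inter> space M |A. A \<in> sets T}"
      by (intro sigma_sets.Basic) blast
    moreover have "A \<in> sigma_sets (space M) {X -` A \<inter> space M |A. A \<in> sets S}"
      using A by (simp add: sets_vimage_algebra)
    ultimately show ?thesis
      using indep_setD[OF ind] by blast
  qed
  moreover have "(\<lambda>w. g (Y w)) \<in> measurable M Q" using measurable_compose[OF rv(2) g] .
  ultimately show ?thesis
    using d by (auto simp: fresh_draw_def subalg_def)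
qed

text \<open>The past is represented by the sample point itself, read with the coarser algebra
  \<open>H\<close>, so every \<open>H\<close>-measurable quantity becomes a function of the first
  coordinate. Agreement with the product measure on rectangles is the independence formula.\<close>

lemma fresh_draw_distr:
  assumes "fresh_draw H Q Z"
  shows "distr M (H \<Otimes>\<^sub>M Q) (\<lambda>w. (w, Z w)) = distr M H (\<lambda>w. w) \<Otimes>\<^sub>M Q"
    and "prob_space (distr M H (\<lambda>w. w))" "prob_space Q"
    and "(\<lambda>w. (w, Z w)) \<in> measurable M (H \<Otimes>\<^sub>M Q)" "(\<lambda>w. w) \<in> measurable M H"
proof -
  have H: "subalg H" and Z[measurable]: "Z \<in> measurable M Q" and d: "distr M Q Z = Q"
    and p: "\<And>A B. A \<in> sets H \<Longrightarrow> B \<in> sets Q \<Longrightarrow>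
      prob (A \<inter> (Z -` B \<inter> space M)) = prob A * prob (Z -` B \<inter> space M)"
    using assms by (auto simp: fresh_draw_def)
  show id[measurable]: "(\<lambda>w. w) \<in> measurable M H"
    using H by (auto simp: subalg_def measurable_def)
  show pair[measurable]: "(\<lambda>w. (w, Z w)) \<in> measurable M (H \<Otimes>\<^sub>M Q)" by measurable
  show "prob_space (distr M H (\<lambda>w. w))" "prob_space Q"
    using prob_space_distr[OF id] prob_space_distr[OF Z] d by auto
  then interpret H: prob_space "distr M H (\<lambda>w. w)" + Q: prob_space Q .
  show "distr M (H \<Otimes>\<^sub>M Q) (\<lambda>w. (w, Z w)) = distr M H (\<lambda>w. w) \<Otimes>\<^sub>M Q"
  proof (rule pair_measure_eqI[symmetric])
    fix A B assume A: "A \<in> sets (distr M H (\<lambda>w. w))" and B: "B \<in> sets Q"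
    have "A \<subseteq> space M" "A \<in> events" using A H sets.sets_into_space[of A H] by (auto simp: subalg_def)
    have eq: "(\<lambda>w. (w, Z w)) -` (A \<times> B) \<inter> space M = A \<inter> (Z -` B \<inter> space M)" by auto
    have "emeasure (distr M (H \<Otimes>\<^sub>M Q) (\<lambda>w. (w, Z w))) (A \<times> B) = prob (A \<inter> (Z -` B \<inter> space M))"
      using A B by (subst emeasure_distr) (auto simp: eq emeasure_eq_measure)
    also have "\<dots> = ennreal (prob A) * ennreal (prob (Z -` B \<inter> space M))"
      using A B by (simp add: p ennreal_mult)
    also have "ennreal (prob (Z -` B \<inter> space M)) = emeasure (distr M Q Z) B"
      using B by (subst emeasure_distr) (auto simp: emeasure_eq_measure)
    also have "ennreal (prob A) = emeasure (distr M H (\<lambda>w. w)) A"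
      using A \<open>A \<subseteq> space M\<close> by (subst emeasure_distr) (auto simp: emeasure_eq_measure Int_absorb2)
    finally show "emeasure (distr M H (\<lambda>w. w)) A * emeasure Q B
        = emeasure (distr M (H \<Otimes>\<^sub>M Q) (\<lambda>w. (w, Z w))) (A \<times> B)"
      by (simp add: d)
  next
    show "sets (distr M H (\<lambda>w. w) \<Otimes>\<^sub>M Q) = sets (distr M (H \<Otimes>\<^sub>M Q) (\<lambda>w. (w, Z w)))"
      by (simp cong: sets_pair_measure_cong)
  next
    show "sigma_finite_measure (distr M H (\<lambda>w. w))" ..
    show "sigma_finite_measure Q" ..
  qed
qed

text \<open>This Tonelli formula and its signed version, which follows, take the place of
  conditional expectation: the past is frozen and the draw is integrated out under its own
  law.\<close>

lemma fresh_draw_nn_integral: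
  assumes f: "fresh_draw H Q Z" and h[measurable]: "h \<in> borel_measurable (H \<Otimes>\<^sub>M Q)"
  shows "(\<integral>\<^sup>+w. h (w, Z w) \<partial>M) = (\<integral>\<^sup>+w. \<integral>\<^sup>+z. h (w, z) \<partial>Q \<partial>M)"
proof -
  note d = fresh_draw_distr[OF f]
  interpret Q: prob_space Q by (rule d)
  have "(\<integral>\<^sup>+w. h (w, Z w) \<partial>M) = integral\<^sup>N (distr M (H \<Otimes>\<^sub>M Q) (\<lambda>w. (w, Z w))) h"
    using d(4) by (subst nn_integral_distr) auto
  also have "\<dots> = (\<integral>\<^sup>+w. \<integral>\<^sup>+z. h (w, z) \<partial>Q \<partial>distr M H (\<lambda>w. w))"
    unfolding d(1)
    by (rule Q.nn_integral_fst[symmetric]) (simp cong: measurable_cong_sets sets_pair_measure_cong)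
  also have "\<dots> = (\<integral>\<^sup>+w. \<integral>\<^sup>+z. h (w, z) \<partial>Q \<partial>M)"
    using d(5) by (subst nn_integral_distr) auto
  finally show ?thesis .
qed

lemma fresh_draw_integral:
  fixes h :: "'a \<times> 'z \<Rightarrow> real"
  assumes f: "fresh_draw H Q Z" and h[measurable]: "h \<in> borel_measurable (H \<Otimes>\<^sub>M Q)"
    and i: "integrable M (\<lambda>w. h (w, Z w))"
  shows "(LINT w|M. h (w, Z w)) = (LINT w|M. LINT z|Q. h (w, z))"
proof -
  note d = fresh_draw_distr[OF f]
  interpret Q: prob_space Q by (rule d)
  interpret H: prob_space "distr M H (\<lambda>w. w)" by (rule d)
  interpret P: pair_sigma_finite "distr M H (\<lambda>w. w)" Q ..
  have "(LINT w|M. h (w, Z w)) = integral\<^sup>L (distr M (H \<Otimes>\<^sub>M Q) (\<lambda>w. (w, Z w))) h"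
    using d(4) by (subst integral_distr) auto
  also have "\<dots> = (LINT w|distr M H (\<lambda>w. w). LINT z|Q. h (w, z))"
    unfolding d(1)
  proof (rule P.integral_fst'[symmetric])
    have "integrable (distr M (H \<Otimes>\<^sub>M Q) (\<lambda>w. (w, Z w))) h"
      using i d(4) by (subst integrable_distr_eq) auto
    then show "integrable (distr M H (\<lambda>w. w) \<Otimes>\<^sub>M Q) h" unfolding d(1) .
  qed
  also have "\<dots> = (LINT w|M. LINT z|Q. h (w, z))"
    using d(5) by (subst integral_distr) auto
  finally show ?thesis .
qed

text \<open>Serves both sources of randomness: \<open>\<Phi>\<close> is the sample gradient or the
  compressor, at an argument \<open>V\<close> determined by the past. With \<open>V\<close> frozen,
  the assumptions for fixed vectors yield the variance bound and orthogonality to the past.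
  \<open>H'\<close> is an algebra that also knows the draw, in use a later history.\<close>

lemma fresh_draw_noise:
  fixes \<Phi> :: "real^'d \<Rightarrow> 'z \<Rightarrow> real^'d" and \<phi> :: "real^'d \<Rightarrow> real^'d" and s :: "real^'d \<Rightarrow> real"
  assumes f: "fresh_draw H Q Z"
    and \<Phi>: "(\<lambda>(v, z). \<Phi> v z) \<in> borel_measurable (borel \<Otimes>\<^sub>M Q)"
    and ub: "\<And>v. unbiased_bounded_variance Q (\<Phi> v) (\<phi> v) (s v)"
    and V: "V \<in> borel_measurable H" and s: "integrable M (\<lambda>w. s (V w))"
    and \<phi>: "\<phi> \<in> borel_measurable borel"
    and H': "subalg H'" "V \<in> borel_measurable H'" "Z \<in> measurable H' Q"
  shows "sq_integrable H' (\<lambda>w. \<Phi> (V w) (Z w) - \<phi> (V w))" (is ?A)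
    and "(LINT w|M. (norm (\<Phi> (V w) (Z w) - \<phi> (V w)))\<^sup>2) \<le> (LINT w|M. s (V w))" (is ?B)
    and "sq_integrable H U \<Longrightarrow> (LINT w|M. U w \<bullet> (\<Phi> (V w) (Z w) - \<phi> (V w))) = 0" (is "_ \<Longrightarrow> ?C")
proof -
  note d = fresh_draw_distr[OF f]
  interpret Q: prob_space Q by (rule d)
  note [measurable] = \<Phi> \<phi> V H'(2,3)
  have Hs: "subalg H" using f by (simp add: fresh_draw_def)
  have Zm[measurable]: "Z \<in> measurable M Q" using subalg_measurable[OF H'(1,3)] .
  have Vm[measurable]: "V \<in> borel_measurable M" using subalg_measurable[OF H'(1,2)] .
  have s0: "0 \<le> s v" for v
  proof -
    have "0 \<le> (LINT z|Q. (norm (\<Phi> v z - \<phi> v))\<^sup>2)" by simp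
    then show ?thesis using ub[of v] unfolding unbiased_bounded_variance_def by linarith
  qed
  have m1: "(\<lambda>w. \<Phi> (V w) (Z w)) \<in> borel_measurable H'"
    using measurable_compose[OF measurable_Pair[OF H'(2,3)] \<Phi>] by simp
  have m1M: "(\<lambda>w. \<Phi> (V w) (Z w)) \<in> borel_measurable M"
    using subalg_measurable[OF H'(1) m1] .
  have m2[measurable]: "(\<lambda>(w, z). \<Phi> (V w) z) \<in> borel_measurable (H \<Otimes>\<^sub>M Q)"
  proof -
    have "(\<lambda>p. (V (fst p), snd p)) \<in> measurable (H \<Otimes>\<^sub>M Q) (borel \<Otimes>\<^sub>M Q)" by measurable
    from measurable_compose[OF this \<Phi>] show ?thesis by (simp add: case_prod_beta')
  qed
  \<comment> \<open>Square integrability is not known in advance. The second moment is therefore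
    computed as a nonnegative integral first, and its finiteness gives integrability.\<close>
  let ?h = "\<lambda>(w, z). ennreal ((norm (\<Phi> (V w) z - \<phi> (V w)))\<^sup>2)"
  have hm: "?h \<in> borel_measurable (H \<Otimes>\<^sub>M Q)"
    using m2 by (simp add: case_prod_beta')
  have "(\<integral>\<^sup>+w. ennreal ((norm (\<Phi> (V w) (Z w) - \<phi> (V w)))\<^sup>2) \<partial>M)
      = (\<integral>\<^sup>+w. \<integral>\<^sup>+z. ennreal ((norm (\<Phi> (V w) z - \<phi> (V w)))\<^sup>2) \<partial>Q \<partial>M)"
    using fresh_draw_nn_integral[OF f hm] by simp
  also have "\<dots> \<le> (\<integral>\<^sup>+w. ennreal (s (V w)) \<partial>M)"
  proof (rule nn_integral_mono)
    fix w
    show "(\<integral>\<^sup>+z. ennreal ((norm (\<Phi> (V w) z - \<phi> (V w)))\<^sup>2) \<partial>Q) \<le> ennreal (s (V w))"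
      using ub[of "V w"] unfolding unbiased_bounded_variance_def
      by (subst nn_integral_eq_integral) (auto simp: ennreal_leI)
  qed
  also have "\<dots> = ennreal (LINT w|M. s (V w))"
    using s s0 by (intro nn_integral_eq_integral) auto
  finally have le: "(\<integral>\<^sup>+w. ennreal ((norm (\<Phi> (V w) (Z w) - \<phi> (V w)))\<^sup>2) \<partial>M) \<le> ennreal (LINT w|M. s (V w))" .
  have int: "integrable M (\<lambda>w. (norm (\<Phi> (V w) (Z w) - \<phi> (V w)))\<^sup>2)"
  proof (rule integrableI_nonneg)
    show "(\<integral>\<^sup>+w. ennreal ((norm (\<Phi> (V w) (Z w) - \<phi> (V w)))\<^sup>2) \<partial>M) < \<infinity>"
      using le by (rule order_le_less_trans) simp
  qed (use m1M in auto)
  show A: ?A using int m1 by (auto simp: sq_integrable_def)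
  show ?B
  proof -
    have "ennreal (LINT w|M. (norm (\<Phi> (V w) (Z w) - \<phi> (V w)))\<^sup>2) \<le> ennreal (LINT w|M. s (V w))"
      using le by (subst (asm) nn_integral_eq_integral[OF int]) auto
    then show ?thesis by (subst (asm) ennreal_le_iff) (auto intro!: Bochner_Integration.integral_nonneg s0)
  qed
  assume U: "sq_integrable H U"
  have [measurable]: "U \<in> borel_measurable H" using U by (simp add: sq_integrable_def)
  let ?g = "\<lambda>(w, z). U w \<bullet> (\<Phi> (V w) z - \<phi> (V w))"
  have gm: "?g \<in> borel_measurable (H \<Otimes>\<^sub>M Q)"
    using m2 by (simp add: case_prod_beta')
  have sM: "subalg M" by (simp add: subalg_def)
  have "sq_integrable M U" "sq_integrable M (\<lambda>w. \<Phi> (V w) (Z w) - \<phi> (V w))"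
    using U A sq_integrable_measurable[OF Hs U] sq_integrable_measurable[OF H'(1) A]
    by (auto simp: sq_integrable_def)
  from integrable_inner_sq[OF sM this]
  have "(LINT w|M. U w \<bullet> (\<Phi> (V w) (Z w) - \<phi> (V w)))
      = (LINT w|M. LINT z|Q. U w \<bullet> (\<Phi> (V w) z - \<phi> (V w)))"
    using fresh_draw_integral[OF f gm] by simp
  also have "\<dots> = (LINT w|M. 0)"
  proof (rule Bochner_Integration.integral_cong[OF refl])
    fix w
    have "integrable Q (\<Phi> (V w))" "(LINT z|Q. \<Phi> (V w) z) = \<phi> (V w)"
      using ub[of "V w"] by (auto simp: unbiased_bounded_variance_def)
    then show "(LINT z|Q. U w \<bullet> (\<Phi> (V w) z - \<phi> (V w))) = 0"
      by (subst integral_inner_right) (auto simp: Q.prob_space)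
  qed
  finally show ?C by simp
qed

end

section \<open>The algorithm\<close>

locale distributed_learning =
  fixes N :: nat
    and D :: "nat \<Rightarrow> 'z measure"
    and loss :: "nat \<Rightarrow> real^'d \<Rightarrow> 'z \<Rightarrow> real"
    and R :: "nat \<Rightarrow> 'r measure"
    and C :: "nat \<Rightarrow> real^'d \<Rightarrow> 'r \<Rightarrow> real^'d"
    and \<ll> \<sigma> a b \<omega> :: real
  assumes problem: "learning_problem N D loss R C"
    and smooth: "smooth_losses N D loss \<ll>"
    and stoch: "stochastic_gradients N D loss \<sigma>"
    and a_pos: "a > 0"
    and het: "bounded_heterogeneity N D loss a b"
    and compr: "unbiased_compressors N R C \<omega>"
begin

abbreviation g where "g n \<equiv> grad (local_loss D loss n)"
abbreviation F where "F \<equiv> global_loss N D loss"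

lemma N_ge_1: "N \<ge> 1"
  using problem by (simp add: learning_problem_def)

lemma lipschitz_nonneg: "0 \<le> \<ll>"
  using smooth N_ge_1 unfolding smooth_losses_def by (auto dest!: bspec[of _ _ 1] lipschitz_on_nonneg)

lemma g_lipschitz: "n \<in> {1..N} \<Longrightarrow> norm (g n u - g n v) \<le> \<ll> * norm (u - v)"
  using smooth unfolding smooth_losses_def by (auto simp: lipschitz_on_def dist_norm)

lemma grad_F_aux: "GDERIV F u :> (1 / real N) *\<^sub>R (\<Sum>n=1..N. g n u)"
proof -
  have "(local_loss D loss n has_derivative (\<lambda>h. h \<bullet> g n u)) (at u)" if "n \<in> {1..N}" for n
    using that smooth GDERIV_grad[of "local_loss D loss n" u]
    by (auto simp: smooth_losses_def gderiv_def)
  then have "((\<lambda>u. \<Sum>n=1..N. local_loss D loss n u) has_derivative (\<lambda>h. \<Sum>n=1..N. h \<bullet> g n u)) (at u)"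
    by (rule has_derivative_sum)
  then have "((\<lambda>u. (1 / real N) * (\<Sum>n=1..N. local_loss D loss n u)) has_derivative
      (\<lambda>h. (1 / real N) * (\<Sum>n=1..N. h \<bullet> g n u))) (at u)"
    by (rule has_derivative_mult_right)
  then show ?thesis
    by (simp add: gderiv_def global_loss_def[abs_def] inner_sum_right)
qed

lemma grad_F: "grad F u = (1 / real N) *\<^sub>R (\<Sum>n=1..N. g n u)"
  using grad_F_aux by (rule grad_eqI)

lemma F_differentiable: "F differentiable (at u)"
  using grad_F_aux by (auto simp: gderiv_def differentiable_def)

lemma grad_F_lipschitz: "norm (grad F u - grad F v) \<le> \<ll> * norm (u - v)"
proof -
  have "grad F u - grad F v = (1 / real N) *\<^sub>R (\<Sum>n=1..N. g n u - g n v)"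
    by (simp add: grad_F sum_subtractf scaleR_diff_right)
  also have "norm \<dots> \<le> (1 / real N) * (\<Sum>n=1..N. norm (g n u - g n v))"
    by (simp add: norm_sum divide_right_mono)
  also have "\<dots> \<le> (1 / real N) * (\<Sum>n=1..N. \<ll> * norm (u - v))"
    by (intro mult_left_mono sum_mono g_lipschitz) auto
  also have "\<dots> = \<ll> * norm (u - v)" using N_ge_1 by simp
  finally show ?thesis .
qed

lemma F_descent: "F (u + h) \<le> F u + grad F u \<bullet> h + \<ll> * (norm h)\<^sup>2"
  by (rule lipschitz_grad_descent[OF F_differentiable grad_F_lipschitz])

text \<open>For a unit vector as input the variance bound places a nonnegative integral below
  \<open>\<omega>\<close>.\<close>

lemma omega_nonneg: "0 \<le> \<omega>"
proof -
  obtain i :: 'd where True by simp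
  have "unbiased_bounded_variance (R 1) (C 1 (axis i 1)) (axis i 1) (\<omega> * (norm (axis i 1 :: real^'d))\<^sup>2)"
    using compr[unfolded unbiased_compressors_def, rule_format, of 1 "axis i 1"] N_ge_1 by simp
  then have "(LINT r|R 1. (norm (C 1 (axis i 1) r - axis i 1))\<^sup>2) \<le> \<omega>"
    by (simp add: unbiased_bounded_variance_def norm_axis_1)
  moreover have "0 \<le> (LINT r|R 1. (norm (C 1 (axis i 1) r - axis i 1))\<^sup>2)" by simp
  ultimately show ?thesis by linarith
qed

lemma mean_g_sq: "(\<Sum>n=1..N. (norm (g n u))\<^sup>2) / real N \<le> a * (norm (grad F u))\<^sup>2 + b\<^sup>2"
  using het by (simp add: bounded_heterogeneity_def)

text \<open>The factor 4 stems from splitting a squared norm twice, into momentum and compression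
  noise and then into error and local gradient. The factor \<open>1 + \<omega>\<close> is the
  compressor variance, and \<open>1 + a + b\<^sup>2\<close> dominates the coefficients of error,
  gradient and constant at once.\<close>

definition dir_const :: real where
  "dir_const = 4 * (1 + \<omega>) * (1 + a + b\<^sup>2)"

lemma dir_const_nonneg: "0 \<le> dir_const"
  using omega_nonneg a_pos by (simp add: dir_const_def)

end

locale compressed_momentum_run = distributed_learning N D loss R C \<ll> \<sigma> a b \<omega>
  for N :: nat
    and D :: "nat \<Rightarrow> 'z measure"
    and loss :: "nat \<Rightarrow> real^'d \<Rightarrow> 'z \<Rightarrow> real"
    and R :: "nat \<Rightarrow> 'r measure"
    and C :: "nat \<Rightarrow> real^'d \<Rightarrow> 'r \<Rightarrow> real^'d"
    and \<ll> \<sigma> a b \<omega> :: real +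
  fixes K :: nat and \<alpha> :: "nat \<Rightarrow> real" and \<beta> :: "nat \<Rightarrow> nat \<Rightarrow> real" and x0 :: "real^'d"
    and y0 :: "nat \<Rightarrow> real^'d" and M :: "'w measure"
    and \<zeta> :: "nat \<Rightarrow> nat \<Rightarrow> 'w \<Rightarrow> 'z" and \<xi> :: "nat \<Rightarrow> nat \<Rightarrow> 'w \<Rightarrow> 'r"
    and x :: "nat \<Rightarrow> 'w \<Rightarrow> real^'d" and y :: "nat \<Rightarrow> nat \<Rightarrow> 'w \<Rightarrow> real^'d"
  assumes run: "algorithm_run N D loss R C K \<alpha> \<beta> x0 y0 M \<zeta> \<xi> x y"
begin

sublocale prob_space M
  using run by (simp add: algorithm_run_def)

section \<open>Draws, their history, and the centred noise terms\<close>

definition draws :: "nat \<Rightarrow> 'w \<Rightarrow> nat \<Rightarrow> 'z \<times> 'r" where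
  "draws k w = (\<lambda>n\<in>{1..N}. (\<zeta> n k w, \<xi> n k w))"

abbreviation draw_space where "draw_space \<equiv> \<Pi>\<^sub>M n\<in>{1..N}. D n \<Otimes>\<^sub>M R n"

text \<open>The natural filtration: what the draws of the iterations before \<open>k\<close> reveal.
  The starting points are deterministic and add nothing. Whole tuples generate it because
  independence is assumed between iterations only.\<close>

definition hist :: "nat \<Rightarrow> 'w measure" where
  "hist k = vimage_algebra (space M) (\<lambda>w. \<lambda>j\<in>{..<k}. draws j w) (\<Pi>\<^sub>M j\<in>{..<k}. draw_space)"

definition noise :: "nat \<Rightarrow> nat \<Rightarrow> 'w \<Rightarrow> real^'d" where
  "noise n k w = sample_grad loss n (x k w) (\<zeta> n k w) - g n (x k w)"

definition compr_noise :: "nat \<Rightarrow> nat \<Rightarrow> 'w \<Rightarrow> real^'d" where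
  "compr_noise n k w = C n (y n k w) (\<xi> n k w) - y n k w"

definition ybar :: "nat \<Rightarrow> 'w \<Rightarrow> real^'d" where
  "ybar k w = (1 / real N) *\<^sub>R (\<Sum>n=1..N. y n k w)"

definition dir :: "nat \<Rightarrow> 'w \<Rightarrow> real^'d" where
  "dir k w = (1 / real N) *\<^sub>R (\<Sum>n=1..N. C n (y n k w) (\<xi> n k w))"

lemma draws_indep: "indep_vars (\<lambda>_. draw_space) draws {..<K}"
  using run unfolding algorithm_run_def draws_def[abs_def] by simp

lemma draws_measurable: "k < K \<Longrightarrow> draws k \<in> measurable M draw_space"
  using draws_indep by (auto simp: indep_vars_def)

lemma x_0: "w \<in> space M \<Longrightarrow> x 0 w = x0"
  and y_0: "w \<in> space M \<Longrightarrow> n \<in> {1..N} \<Longrightarrow> y n 0 w = y0 n"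
  and x_Suc: "w \<in> space M \<Longrightarrow> k < K \<Longrightarrow> x (Suc k) w = x k w - \<alpha> k *\<^sub>R dir k w"
  and y_Suc: "w \<in> space M \<Longrightarrow> k < K \<Longrightarrow> n \<in> {1..N} \<Longrightarrow>
    y n (Suc k) w = y n k w - \<beta> n k *\<^sub>R (y n k w - g n (x k w)) + \<beta> n k *\<^sub>R noise n k w"
  using run by (auto simp: algorithm_run_def dir_def noise_def scaleR_diff_right)

lemma past_measurable:
  assumes "k \<le> K"
  shows "(\<lambda>w. \<lambda>j\<in>{..<k}. draws j w) \<in> measurable M (\<Pi>\<^sub>M j\<in>{..<k}. draw_space)"
  using assms by (intro measurable_restrict draws_measurable) auto

lemma hist_subalg:
  assumes "k \<le> K"
  shows "subalg (hist k)"
proof -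
  have "(\<lambda>w. \<lambda>j\<in>{..<k}. draws j w) \<in> space M \<rightarrow> space (\<Pi>\<^sub>M j\<in>{..<k}. draw_space)"
    using measurable_space[OF past_measurable[OF assms]] by auto
  from sets_vimage_algebra2[OF this] show ?thesis
    using measurable_sets[OF past_measurable[OF assms]] by (auto simp: subalg_def hist_def)
qed

lemma draws_hist:
  assumes "k \<le> K" "j < k"
  shows "draws j \<in> measurable (hist k) draw_space"
proof -
  have "(\<lambda>w. \<lambda>j\<in>{..<k}. draws j w) \<in> space M \<rightarrow> space (\<Pi>\<^sub>M j\<in>{..<k}. draw_space)"
    using measurable_space[OF past_measurable[OF assms(1)]] by auto
  from measurable_vimage_algebra1[OF this]
  have "(\<lambda>w. \<lambda>j\<in>{..<k}. draws j w) \<in> measurable (hist k) (\<Pi>\<^sub>M j\<in>{..<k}. draw_space)"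
    unfolding hist_def .
  from measurable_compose[OF this measurable_component_singleton[of j]]
  show ?thesis using assms by simp
qed

lemma draws_fst: "n \<in> {1..N} \<Longrightarrow> fst (draws k w n) = \<zeta> n k w"
  and draws_snd: "n \<in> {1..N} \<Longrightarrow> snd (draws k w n) = \<xi> n k w"
  by (auto simp: draws_def)

lemma draw_measurable_fst: "n \<in> {1..N} \<Longrightarrow> (\<lambda>t. fst (t n)) \<in> measurable draw_space (D n)"
  and draw_measurable_snd: "n \<in> {1..N} \<Longrightarrow> (\<lambda>t. snd (t n)) \<in> measurable draw_space (R n)"
  using measurable_compose[OF measurable_component_singleton[of n "{1..N}" "\<lambda>n. D n \<Otimes>\<^sub>M R n"] measurable_fst]
    measurable_compose[OF measurable_component_singleton[of n "{1..N}" "\<lambda>n. D n \<Otimes>\<^sub>M R n"] measurable_snd]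
  by auto

lemma sample_hist: "k \<le> K \<Longrightarrow> j < k \<Longrightarrow> n \<in> {1..N} \<Longrightarrow> \<zeta> n j \<in> measurable (hist k) (D n)"
  and seed_hist: "k \<le> K \<Longrightarrow> j < k \<Longrightarrow> n \<in> {1..N} \<Longrightarrow> \<xi> n j \<in> measurable (hist k) (R n)"
  using measurable_compose[OF draws_hist draw_measurable_fst, of k j n]
    measurable_compose[OF draws_hist draw_measurable_snd, of k j n]
  by (simp_all add: draws_fst draws_snd)

text \<open>Disjoint blocks of an independent family are independent, here the iterations before
  \<open>k\<close> and iteration \<open>k\<close> alone. The map \<open>h\<close> then reads off one
  sample or one seed, which is thus fresh relative to the past though perhaps not relative to the
  rest of its tuple.\<close>

lemma fresh_component:
  assumes k: "k < K" and h: "h \<in> measurable draw_space Q" and d: "distr M Q (\<lambda>w. h (draws k w)) = Q"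
  shows "fresh_draw (hist k) Q (\<lambda>w. h (draws k w))"
proof -
  have "indep_var (\<Pi>\<^sub>M j\<in>{..<k}. draw_space) (\<lambda>w. \<lambda>j\<in>{..<k}. draws j w)
      (\<Pi>\<^sub>M j\<in>{k}. draw_space) (\<lambda>w. \<lambda>j\<in>{k}. draws j w)"
    using k by (intro indep_var_restrict[OF draws_indep]) auto
  from fresh_draw_indep_var[OF this, of "\<lambda>p. h (p k)" Q] d
  show ?thesis
    using measurable_compose[OF measurable_component_singleton[of k "{k}" "\<lambda>_. draw_space"] h]
    by (simp add: hist_def)
qed

lemma fresh_sample: "k < K \<Longrightarrow> n \<in> {1..N} \<Longrightarrow> fresh_draw (hist k) (D n) (\<zeta> n k)"
  and fresh_seed: "k < K \<Longrightarrow> n \<in> {1..N} \<Longrightarrow> fresh_draw (hist k) (R n) (\<xi> n k)"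
  using fresh_component[OF _ draw_measurable_fst, of k n] fresh_component[OF _ draw_measurable_snd, of k n] run
  by (simp_all add: draws_fst draws_snd algorithm_run_def)

text \<open>The recursion of a run is imposed only on \<open>space M\<close>, so the iterates may be
  replaced by their formulas only there.\<close>

lemma sq_integrable_cong:
  assumes "k \<le> K" "sq_integrable (hist k) X" "\<And>w. w \<in> space M \<Longrightarrow> Y w = X w"
  shows "sq_integrable (hist k) Y"
proof -
  have s: "space (hist k) = space M" using hist_subalg[OF assms(1)] by (simp add: subalg_def)
  have "X \<in> borel_measurable (hist k) \<longleftrightarrow> Y \<in> borel_measurable (hist k)"
    by (rule measurable_cong) (simp add: s assms(3))
  moreover have "integrable M (\<lambda>w. (norm (X w))\<^sup>2) \<longleftrightarrow> integrable M (\<lambda>w. (norm (Y w))\<^sup>2)"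
    by (rule Bochner_Integration.integrable_cong) (simp_all add: assms(3))
  ultimately show ?thesis using assms(2) by (simp add: sq_integrable_def)
qed

lemma g_measurable: "n \<in> {1..N} \<Longrightarrow> g n \<in> borel_measurable borel"
  using smooth unfolding smooth_losses_def
  by (intro borel_measurable_continuous_onI) (auto intro: lipschitz_on_continuous_on)

text \<open>The draw is made at time \<open>k\<close> and counts as known from time \<open>i\<close>
  on. Measurability of \<open>x k\<close> is a hypothesis because the lemma is used within the
  induction that proves it.\<close>

lemma noise_facts:
  assumes k: "k < i" "i \<le> K" and n: "n \<in> {1..N}"
    and x: "x k \<in> borel_measurable (hist k)" "x k \<in> borel_measurable (hist i)"
  shows "sq_integrable (hist i) (noise n k)"
    and "(LINT w|M. (norm (noise n k w))\<^sup>2) \<le> \<sigma>\<^sup>2"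
    and "sq_integrable (hist k) U \<Longrightarrow> (LINT w|M. U w \<bullet> noise n k w) = 0"
proof -
  have m: "(\<lambda>(x, z). sample_grad loss n x z) \<in> borel_measurable (borel \<Otimes>\<^sub>M D n)"
    using problem n by (auto simp: learning_problem_def)
  have u: "unbiased_bounded_variance (D n) (sample_grad loss n v) (g n v) (\<sigma>\<^sup>2)" for v
    using stoch n by (auto simp: stochastic_gradients_def)
  have "k < K" using k by simp
  note * = fresh_draw_noise[OF fresh_sample[OF \<open>k < K\<close> n] m u x(1) _ g_measurable[OF n]
      hist_subalg[OF k(2)] x(2) sample_hist[OF k(2,1) n], folded noise_def]
  show "sq_integrable (hist i) (noise n k)" using *(1) by simp
  show "(LINT w|M. (norm (noise n k w))\<^sup>2) \<le> \<sigma>\<^sup>2" using *(2) by (simp add: prob_space)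
  show "sq_integrable (hist k) U \<Longrightarrow> (LINT w|M. U w \<bullet> noise n k w) = 0" using *(3) by simp
qed

text \<open>The compressor variance is relative to the squared norm of its input, so here the
  momentum must already have a finite second moment.\<close>

lemma compr_noise_facts:
  assumes k: "k < i" "i \<le> K" and n: "n \<in> {1..N}"
    and y: "sq_integrable (hist k) (y n k)" "y n k \<in> borel_measurable (hist i)"
  shows "sq_integrable (hist i) (compr_noise n k)"
    and "(LINT w|M. (norm (compr_noise n k w))\<^sup>2) \<le> \<omega> * (LINT w|M. (norm (y n k w))\<^sup>2)"
    and "sq_integrable (hist k) U \<Longrightarrow> (LINT w|M. U w \<bullet> compr_noise n k w) = 0"
proof -
  have m: "(\<lambda>(v, r). C n v r) \<in> borel_measurable (borel \<Otimes>\<^sub>M R n)"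
    using problem n by (auto simp: learning_problem_def)
  have u: "unbiased_bounded_variance (R n) (C n v) v (\<omega> * (norm v)\<^sup>2)" for v
    using compr n by (auto simp: unbiased_compressors_def)
  have "k < K" using k by simp
  have y': "y n k \<in> borel_measurable (hist k)" "integrable M (\<lambda>w. \<omega> * (norm (y n k w))\<^sup>2)"
    using y by (auto simp: sq_integrable_def)
  note * = fresh_draw_noise[OF fresh_seed[OF \<open>k < K\<close> n] m u y' measurable_ident_sets[OF refl]
      hist_subalg[OF k(2)] y(2) seed_hist[OF k(2,1) n], folded compr_noise_def]
  show "sq_integrable (hist i) (compr_noise n k)" using *(1) by simp
  show "(LINT w|M. (norm (compr_noise n k w))\<^sup>2) \<le> \<omega> * (LINT w|M. (norm (y n k w))\<^sup>2)"
    using *(2) by simp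
  show "sq_integrable (hist k) U \<Longrightarrow> (LINT w|M. U w \<bullet> compr_noise n k w) = 0" using *(3) by simp
qed

lemma dir_eq: "dir k w = (1 / real N) *\<^sub>R (\<Sum>n=1..N. y n k w + compr_noise n k w)"
  by (simp add: dir_def compr_noise_def)

text \<open>The index \<open>i\<close> is general because the induction step needs the previous
  iterates twice: in \<open>hist k\<close>, where the draws of iteration \<open>k\<close> are fresh,
  and in \<open>hist i\<close>, where they are already known.\<close>

lemma iterates_sq_integrable:
  assumes "k \<le> i" "i \<le> K"
  shows "sq_integrable (hist i) (x k) \<and> (\<forall>n\<in>{1..N}. sq_integrable (hist i) (y n k))"
  using assms
proof (induction k arbitrary: i)
  case 0
  then show ?case
    using sq_integrable_cong[OF 0(2) sq_integrable_const x_0] sq_integrable_cong[OF 0(2) sq_integrable_const y_0]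
    by auto
next
  case (Suc k)
  then have k: "k < i" "k < K" "i \<le> K" by auto
  note H = hist_subalg[OF k(3)]
  have IHi: "sq_integrable (hist i) (x k)" "n \<in> {1..N} \<Longrightarrow> sq_integrable (hist i) (y n k)"
    and IHk: "sq_integrable (hist k) (x k)" "n \<in> {1..N} \<Longrightarrow> sq_integrable (hist k) (y n k)" for n
    using Suc.IH[of i] Suc.IH[of k] k by auto
  have cn: "sq_integrable (hist i) (compr_noise n k)" if "n \<in> {1..N}" for n
    using compr_noise_facts(1)[OF k(1,3) that IHk(2)] IHi(2) that by (auto simp: sq_integrable_def)
  have d: "sq_integrable (hist i) (dir k)"
    unfolding dir_eq[abs_def] using IHi(2) cn
    by (intro sq_integrable_scaleR sq_integrable_sum sq_integrable_add H) auto
  have "sq_integrable (hist i) (x (Suc k))"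
    by (rule sq_integrable_cong[OF k(3) sq_integrable_diff[OF H IHi(1) sq_integrable_scaleR[OF d, of "\<alpha> k"]]])
      (simp add: x_Suc k)
  moreover have "sq_integrable (hist i) (y n (Suc k))" if n: "n \<in> {1..N}" for n
  proof -
    have "sq_integrable (hist i) (noise n k)"
      using noise_facts(1)[OF k(1,3) n] IHi(1) IHk(1) by (auto simp: sq_integrable_def)
    moreover have "sq_integrable (hist i) (\<lambda>w. g n (x k w))"
      by (rule sq_integrable_lipschitz[OF H IHi(1) g_lipschitz[OF n]])
    ultimately have *: "sq_integrable (hist i) (\<lambda>w. y n k w - \<beta> n k *\<^sub>R (y n k w - g n (x k w)) + \<beta> n k *\<^sub>R noise n k w)"
      using IHi(2)[OF n] by (intro sq_integrable_add sq_integrable_diff sq_integrable_scaleR H)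
    show ?thesis by (rule sq_integrable_cong[OF k(3) *]) (rule y_Suc[OF _ k(2) n])
  qed
  ultimately show ?case by blast
qed

lemma x_sq: "k \<le> i \<Longrightarrow> i \<le> K \<Longrightarrow> sq_integrable (hist i) (x k)"
  and y_sq: "k \<le> i \<Longrightarrow> i \<le> K \<Longrightarrow> n \<in> {1..N} \<Longrightarrow> sq_integrable (hist i) (y n k)"
  using iterates_sq_integrable by auto

subsection \<open>Momentum as an average of past gradients\<close>

text \<open>With respect to the weights with which the momentum \<open>y n k\<close> averages the past gradients,
  \<open>avg_x n k\<close> is the mean and \<open>var_x n k\<close> the variance of the past iterates, so \<open>spread n k\<close> is
  the mean squared distance of \<open>x k\<close> to them.\<close>

primrec acc_noise :: "nat \<Rightarrow> nat \<Rightarrow> 'w \<Rightarrow> real^'d" where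
  "acc_noise n 0 = (\<lambda>w. y0 n - g n x0)"
| "acc_noise n (Suc k) = (\<lambda>w. (1 - \<beta> n k) *\<^sub>R acc_noise n k w + \<beta> n k *\<^sub>R noise n k w)"

primrec avg_x :: "nat \<Rightarrow> nat \<Rightarrow> 'w \<Rightarrow> real^'d" where
  "avg_x n 0 = (\<lambda>w. x0)"
| "avg_x n (Suc k) = (\<lambda>w. (1 - \<beta> n k) *\<^sub>R avg_x n k w + \<beta> n k *\<^sub>R x k w)"

primrec var_x :: "nat \<Rightarrow> nat \<Rightarrow> 'w \<Rightarrow> real" where
  "var_x n 0 = (\<lambda>w. 0)"
| "var_x n (Suc k) = (\<lambda>w. (1 - \<beta> n k) * var_x n k w
     + \<beta> n k * (1 - \<beta> n k) * (norm (x k w - avg_x n k w))\<^sup>2)"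

definition spread :: "nat \<Rightarrow> nat \<Rightarrow> 'w \<Rightarrow> real" where
  "spread n k w = (norm (x k w - avg_x n k w))\<^sup>2 + var_x n k w"

text \<open>The estimate is claimed for every reference point \<open>u\<close>: the point of
  interest \<open>x k\<close> moves with \<open>k\<close>, and a bound at a moving point would not
  reproduce itself in the induction.\<close>

lemma momentum_average:
  assumes \<beta>: "\<And>j. j < k \<Longrightarrow> 0 \<le> \<beta> n j \<and> \<beta> n j \<le> 1" and k: "k \<le> K" and n: "n \<in> {1..N}"
    and w: "w \<in> space M"
  shows "0 \<le> var_x n k w \<and>
    (\<forall>u. (norm (y n k w - acc_noise n k w - g n u))\<^sup>2 \<le> \<ll>\<^sup>2 * ((norm (u - avg_x n k w))\<^sup>2 + var_x n k w))"
  using \<beta> k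
proof (induction k)
  \<comment> \<open>\<open>acc_noise\<close> starts at the initial momentum error, so the remainder
    starts as exactly the gradient at \<open>x0\<close>, where \<open>avg_x\<close> starts too, with
    variance \<open>0\<close>.\<close>
  case 0
  have "(norm (g n x0 - g n u))\<^sup>2 \<le> (\<ll> * norm (x0 - u))\<^sup>2" for u
    using g_lipschitz[OF n] by (intro power_mono) auto
  then show ?case by (simp add: y_0[OF w n] power_mult_distrib norm_minus_commute)
next
  case (Suc k)
  then have k: "k < K" and b: "0 \<le> \<beta> n k" "\<beta> n k \<le> 1" and IH: "0 \<le> var_x n k w"
    "(norm (y n k w - acc_noise n k w - g n u))\<^sup>2 \<le> \<ll>\<^sup>2 * ((norm (u - avg_x n k w))\<^sup>2 + var_x n k w)" for u
    by auto
  define t where "t = \<beta> n k"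
  note b = b[folded t_def]
  have "(norm (y n (Suc k) w - acc_noise n (Suc k) w - g n u))\<^sup>2
      \<le> \<ll>\<^sup>2 * ((norm (u - avg_x n (Suc k) w))\<^sup>2 + var_x n (Suc k) w)" for u
  proof -
    let ?p = "y n k w - acc_noise n k w - g n u" and ?q = "g n (x k w) - g n u"
    have "y n (Suc k) w - acc_noise n (Suc k) w - g n u = (1 - t) *\<^sub>R ?p + t *\<^sub>R ?q"
      by (simp add: y_Suc[OF w k n] t_def algebra_simps)
    then have "(norm (y n (Suc k) w - acc_noise n (Suc k) w - g n u))\<^sup>2
        = (1 - t) * (norm ?p)\<^sup>2 + t * (norm ?q)\<^sup>2 - t * (1 - t) * (norm (?p - ?q))\<^sup>2"
      by (simp only: norm_convex_combination_sq)
    \<comment> \<open>Convexity of the squared norm: the defect term is dropped.\<close>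
    also have "\<dots> \<le> (1 - t) * (norm ?p)\<^sup>2 + t * (norm ?q)\<^sup>2" using b by simp
    also have "\<dots> \<le> (1 - t) * (\<ll>\<^sup>2 * ((norm (u - avg_x n k w))\<^sup>2 + var_x n k w)) + t * (\<ll> * norm (u - x k w))\<^sup>2"
      using b IH(2)[of u] g_lipschitz[OF n, of "x k w" u]
      by (intro add_mono mult_left_mono power_mono) (auto simp: norm_minus_commute)
    also have "\<dots> = \<ll>\<^sup>2 * ((1 - t) * (norm (u - avg_x n k w))\<^sup>2 + t * (norm (u - x k w))\<^sup>2 + (1 - t) * var_x n k w)"
      by (simp add: algebra_simps)
    \<comment> \<open>The same identity read backwards is the decomposition into squared bias and
      variance; its defect term is what \<open>var_x\<close> gains in this iteration.\<close>
    also have "(1 - t) * (norm (u - avg_x n k w))\<^sup>2 + t * (norm (u - x k w))\<^sup>2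
        = (norm ((1 - t) *\<^sub>R (u - avg_x n k w) + t *\<^sub>R (u - x k w)))\<^sup>2
          + t * (1 - t) * (norm ((u - avg_x n k w) - (u - x k w)))\<^sup>2"
      by (simp add: norm_convex_combination_sq)
    also have "(1 - t) *\<^sub>R (u - avg_x n k w) + t *\<^sub>R (u - x k w) = u - avg_x n (Suc k) w"
      by (simp add: t_def algebra_simps)
    also have "(u - avg_x n k w) - (u - x k w) = x k w - avg_x n k w" by simp
    finally show ?thesis by (simp add: t_def algebra_simps)
  qed
  moreover have "0 \<le> var_x n (Suc k) w" using b IH(1) by (simp add: t_def)
  ultimately show ?case by blast
qed

lemma momentum_error:
  assumes "\<And>j. j < k \<Longrightarrow> 0 \<le> \<beta> n j \<and> \<beta> n j \<le> 1" "k \<le> K" "n \<in> {1..N}" "w \<in> space M"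
  shows "(norm (y n k w - g n (x k w)))\<^sup>2 \<le> 2 * (norm (acc_noise n k w))\<^sup>2 + 2 * \<ll>\<^sup>2 * spread n k w"
    and "0 \<le> var_x n k w"
proof -
  note * = momentum_average[OF assms]
  show "0 \<le> var_x n k w" using * by simp
  have "(norm (y n k w - g n (x k w)))\<^sup>2
      \<le> 2 * (norm (acc_noise n k w))\<^sup>2 + 2 * (norm (y n k w - acc_noise n k w - g n (x k w)))\<^sup>2"
    using norm_add_sq_le[of "acc_noise n k w" "y n k w - acc_noise n k w - g n (x k w)"] by simp
  then show "(norm (y n k w - g n (x k w)))\<^sup>2 \<le> 2 * (norm (acc_noise n k w))\<^sup>2 + 2 * \<ll>\<^sup>2 * spread n k w"
    using *[THEN conjunct2, rule_format, of "x k w"] by (simp add: spread_def)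
qed

text \<open>The squared deviation shrinks by \<open>(1 - \<beta> n k)\<^sup>2\<close>, and the new
  variance term refills this to \<open>1 - \<beta> n k\<close>, the factor that \<open>var_x\<close>
  has as well. To first order the direction meets only a deviation known from the past, so
  compression noise averages out there.\<close>

lemma spread_Suc:
  assumes "k < K" "w \<in> space M"
  shows "spread n (Suc k) w = (1 - \<beta> n k) * spread n k w
    - 2 * \<alpha> k * (1 - \<beta> n k) * ((x k w - avg_x n k w) \<bullet> dir k w) + (\<alpha> k)\<^sup>2 * (norm (dir k w))\<^sup>2"
proof -
  have "x (Suc k) w - avg_x n (Suc k) w = (1 - \<beta> n k) *\<^sub>R (x k w - avg_x n k w) - \<alpha> k *\<^sub>R dir k w"
    by (simp add: x_Suc assms algebra_simps)
  then have "(norm (x (Suc k) w - avg_x n (Suc k) w))\<^sup>2 = (1 - \<beta> n k)\<^sup>2 * (norm (x k w - avg_x n k w))\<^sup>2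
      - 2 * \<alpha> k * (1 - \<beta> n k) * ((x k w - avg_x n k w) \<bullet> dir k w) + (\<alpha> k)\<^sup>2 * (norm (dir k w))\<^sup>2"
    by (simp only: norm_diff_scaleR_sq norm_scaleR power_mult_distrib power2_abs inner_scaleR_left mult.assoc)
  then show ?thesis
    by (simp add: spread_def power2_eq_square[of "1 - \<beta> n k"] algebra_simps del: avg_x.simps)
qed

section \<open>Square integrability of the derived quantities\<close>

lemma g_sq: "k \<le> i \<Longrightarrow> i \<le> K \<Longrightarrow> n \<in> {1..N} \<Longrightarrow> sq_integrable (hist i) (\<lambda>w. g n (x k w))"
  by (rule sq_integrable_lipschitz[OF hist_subalg x_sq g_lipschitz])

lemma grad_F_sq: "k \<le> i \<Longrightarrow> i \<le> K \<Longrightarrow> sq_integrable (hist i) (\<lambda>w. grad F (x k w))"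
  by (rule sq_integrable_lipschitz[OF hist_subalg x_sq grad_F_lipschitz])

lemma noise_sq: "k < i \<Longrightarrow> i \<le> K \<Longrightarrow> n \<in> {1..N} \<Longrightarrow> sq_integrable (hist i) (noise n k)"
  by (rule noise_facts(1)) (use x_sq[of k k] x_sq[of k i] in \<open>auto simp: sq_integrable_def\<close>)

lemma compr_noise_sq: "k < i \<Longrightarrow> i \<le> K \<Longrightarrow> n \<in> {1..N} \<Longrightarrow> sq_integrable (hist i) (compr_noise n k)"
  by (rule compr_noise_facts(1)[OF _ _ _ y_sq]) (use y_sq[of k i n] in \<open>auto simp: sq_integrable_def\<close>)

lemma ybar_sq: "k \<le> i \<Longrightarrow> i \<le> K \<Longrightarrow> sq_integrable (hist i) (ybar k)"
  unfolding ybar_def[abs_def] by (intro sq_integrable_scaleR sq_integrable_sum hist_subalg y_sq) auto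

lemma dir_sq: "k < i \<Longrightarrow> i \<le> K \<Longrightarrow> sq_integrable (hist i) (dir k)"
  unfolding dir_eq[abs_def]
  by (intro sq_integrable_scaleR sq_integrable_sum sq_integrable_add hist_subalg y_sq compr_noise_sq) auto

lemma acc_noise_sq: "k \<le> i \<Longrightarrow> i \<le> K \<Longrightarrow> n \<in> {1..N} \<Longrightarrow> sq_integrable (hist i) (acc_noise n k)"
proof (induction k)
  case (Suc k)
  then show ?case by (auto intro!: sq_integrable_add sq_integrable_scaleR hist_subalg noise_sq)
qed (simp add: sq_integrable_const)

lemma avg_x_sq: "k \<le> i \<Longrightarrow> i \<le> K \<Longrightarrow> sq_integrable (hist i) (avg_x n k)"
proof (induction k)
  case (Suc k)
  then show ?case by (auto intro!: sq_integrable_add sq_integrable_scaleR hist_subalg x_sq)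
qed (simp add: sq_integrable_const)

lemma deviation_sq: "k \<le> i \<Longrightarrow> i \<le> K \<Longrightarrow> sq_integrable (hist i) (\<lambda>w. x k w - avg_x n k w)"
  by (intro sq_integrable_diff hist_subalg x_sq avg_x_sq)

lemma var_x_integrable: "k \<le> K \<Longrightarrow> integrable M (var_x n k)"
proof (induction k)
  case (Suc k)
  then show ?case using sq_integrableD[OF deviation_sq[of k k n]] by simp
qed simp

lemma spread_integrable: "k \<le> K \<Longrightarrow> integrable M (spread n k)"
  unfolding spread_def[abs_def]
  by (intro Bochner_Integration.integrable_add var_x_integrable sq_integrableD[OF deviation_sq[of k k n]]) auto

lemma error_sq: "k \<le> K \<Longrightarrow> n \<in> {1..N} \<Longrightarrow> sq_integrable (hist k) (\<lambda>w. y n k w - g n (x k w))"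
  by (intro sq_integrable_diff hist_subalg y_sq g_sq) auto

section \<open>Expectations and their one-step recursions\<close>

definition E_grad :: "nat \<Rightarrow> real" where
  "E_grad k = (LINT w|M. (norm (grad F (x k w)))\<^sup>2)"

definition E_err :: "nat \<Rightarrow> nat \<Rightarrow> real" where
  "E_err n k = (LINT w|M. (norm (y n k w - g n (x k w)))\<^sup>2)"

definition E_noise :: "nat \<Rightarrow> nat \<Rightarrow> real" where
  "E_noise n k = (LINT w|M. (norm (acc_noise n k w))\<^sup>2)"

definition E_spread :: "nat \<Rightarrow> nat \<Rightarrow> real" where
  "E_spread n k = (LINT w|M. spread n k w)"

definition mean_err :: "nat \<Rightarrow> real" where
  "mean_err k = (\<Sum>n=1..N. E_err n k) / real N"

text \<open>The direction is the mean momentum plus averaged compression noise, and each such noise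
  is orthogonal to everything in \<open>hist k\<close>. This is where unbiasedness of the
  compressors acts.\<close>

lemma E_inner_dir:
  assumes k: "k < K" and U: "sq_integrable (hist k) U"
  shows "(LINT w|M. U w \<bullet> dir k w) = (LINT w|M. U w \<bullet> ybar k w)"
proof -
  have ki: "k \<le> K" using k by simp
  have UM: "sq_integrable M U"
    using U sq_integrable_measurable[OF hist_subalg[OF ki] U] by (simp add: sq_integrable_def)
  have sM: "subalg M" by (simp add: subalg_def)
  \<comment> \<open>Passing to \<open>M\<close> itself as the algebra allows products of a quantity
    of \<open>hist k\<close> with one of \<open>hist (Suc k)\<close>.\<close>
  have toM: "sq_integrable M X" if "j \<le> K" "sq_integrable (hist j) X" for X :: "'w \<Rightarrow> real^'d" and j
    using that sq_integrable_measurable[OF hist_subalg] by (auto simp: sq_integrable_def)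
  have iy: "integrable M (\<lambda>w. U w \<bullet> ybar k w)"
    by (rule integrable_inner_sq[OF sM UM toM[OF ki ybar_sq]]) (use ki in auto)
  have ic: "integrable M (\<lambda>w. U w \<bullet> compr_noise n k w)" if "n \<in> {1..N}" for n
    by (rule integrable_inner_sq[OF sM UM toM[OF _ compr_noise_sq, of "Suc k"]]) (use k that in auto)
  have eq: "U w \<bullet> dir k w = U w \<bullet> ybar k w + (\<Sum>n=1..N. U w \<bullet> compr_noise n k w) / real N" for w
    by (simp add: dir_eq ybar_def sum.distrib inner_sum_right inner_add_right scaleR_add_right)
  have "(LINT w|M. U w \<bullet> dir k w)
      = (LINT w|M. U w \<bullet> ybar k w) + (\<Sum>n=1..N. (LINT w|M. U w \<bullet> compr_noise n k w)) / real N"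
  proof -
    have "integrable M (\<lambda>w. (\<Sum>n=1..N. U w \<bullet> compr_noise n k w) / real N)"
      by (rule integrable_sum_divide(1)) (rule ic)
    moreover have "(LINT w|M. (\<Sum>n=1..N. U w \<bullet> compr_noise n k w) / real N)
        = (\<Sum>n=1..N. (LINT w|M. U w \<bullet> compr_noise n k w)) / real N"
      by (rule integrable_sum_divide(2)) (rule ic)
    ultimately show ?thesis
      using eq iy by (simp only: Bochner_Integration.integral_add)
  qed
  also have "(\<Sum>n=1..N. (LINT w|M. U w \<bullet> compr_noise n k w)) = 0"
  proof (rule sum.neutral, rule ballI)
    fix n assume n: "n \<in> {1..N}"
    show "(LINT w|M. U w \<bullet> compr_noise n k w) = 0"
      by (rule compr_noise_facts(3)[OF _ _ n y_sq _ U, of "Suc k"])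
        (use k n y_sq[of k "Suc k" n] in \<open>auto simp: sq_integrable_def\<close>)
  qed
  finally show ?thesis by simp
qed

lemma E_grad_nonneg: "0 \<le> E_grad k" and E_err_nonneg: "0 \<le> E_err n k"
  and E_noise_nonneg: "0 \<le> E_noise n k" and mean_err_nonneg: "0 \<le> mean_err k"
  by (auto simp: E_grad_def E_err_def E_noise_def mean_err_def intro!: sum_nonneg divide_nonneg_nonneg)

text \<open>The iterates have no uniform moment bound, so the direction is measured by quantities
  that the Lyapunov function controls. Bounded heterogeneity replaces the local gradients by the
  gradient of \<open>F\<close>.\<close>

lemma E_dir_le:
  assumes k: "k < K"
  shows "(LINT w|M. (norm (dir k w))\<^sup>2) \<le> dir_const * (mean_err k + E_grad k + 1)"
proof -
  have kK: "k \<le> K" "Suc k \<le> K" using k by auto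
  have Iy: "integrable M (\<lambda>w. (norm (y n k w))\<^sup>2)" and Ig: "integrable M (\<lambda>w. (norm (g n (x k w)))\<^sup>2)"
    and Ic: "integrable M (\<lambda>w. (norm (compr_noise n k w))\<^sup>2)"
    and Ie: "integrable M (\<lambda>w. (norm (y n k w - g n (x k w)))\<^sup>2)" if "n \<in> {1..N}" for n
    using sq_integrableD[OF y_sq[of k k n]] sq_integrableD[OF g_sq[of k k n]]
      sq_integrableD[OF compr_noise_sq[of k "Suc k" n]] sq_integrableD[OF error_sq[of k n]] that kK by auto
  have Id: "integrable M (\<lambda>w. (norm (dir k w))\<^sup>2)"
    using sq_integrableD[OF dir_sq[of k "Suc k"]] kK by auto
  have IG: "integrable M (\<lambda>w. (norm (grad F (x k w)))\<^sup>2)"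
    using sq_integrableD[OF grad_F_sq[of k k]] kK by auto
  have "(norm (dir k w))\<^sup>2 \<le> (\<Sum>n=1..N. 2 * (norm (y n k w))\<^sup>2 + 2 * (norm (compr_noise n k w))\<^sup>2) / real N" for w
  proof -
    have "(norm (dir k w))\<^sup>2 \<le> (\<Sum>n=1..N. (norm (y n k w + compr_noise n k w))\<^sup>2) / real N"
      unfolding dir_eq by (rule norm_mean_sq_le[OF N_ge_1])
    also have "\<dots> \<le> (\<Sum>n=1..N. 2 * (norm (y n k w))\<^sup>2 + 2 * (norm (compr_noise n k w))\<^sup>2) / real N"
      by (intro divide_right_mono sum_mono norm_add_sq_le) simp
    finally show ?thesis .
  qed
  then have "(LINT w|M. (norm (dir k w))\<^sup>2)
      \<le> (LINT w|M. (\<Sum>n=1..N. 2 * (norm (y n k w))\<^sup>2 + 2 * (norm (compr_noise n k w))\<^sup>2) / real N)"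
    by (intro integral_mono Id integrable_sum_divide(1) Bochner_Integration.integrable_add
        integrable_mult_right Iy Ic)
  also have "\<dots> = (\<Sum>n=1..N. 2 * (LINT w|M. (norm (y n k w))\<^sup>2) + 2 * (LINT w|M. (norm (compr_noise n k w))\<^sup>2)) / real N"
    using Iy Ic by (subst integrable_sum_divide(2)) (auto intro!: sum.cong)
  also have "\<dots> \<le> (\<Sum>n=1..N. (2 + 2 * \<omega>) * (2 * E_err n k + 2 * (LINT w|M. (norm (g n (x k w)))\<^sup>2))) / real N"
  proof (intro divide_right_mono sum_mono)
    fix n assume n: "n \<in> {1..N}"
    have "(LINT w|M. (norm (compr_noise n k w))\<^sup>2) \<le> \<omega> * (LINT w|M. (norm (y n k w))\<^sup>2)"
      by (rule compr_noise_facts(2)[OF _ kK(2) n y_sq])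
        (use k n y_sq[of k "Suc k" n] in \<open>auto simp: sq_integrable_def\<close>)
    then have "2 * (LINT w|M. (norm (y n k w))\<^sup>2) + 2 * (LINT w|M. (norm (compr_noise n k w))\<^sup>2)
        \<le> (2 + 2 * \<omega>) * (LINT w|M. (norm (y n k w))\<^sup>2)"
      by (simp add: algebra_simps)
    also have "\<dots> \<le> (2 + 2 * \<omega>) * (LINT w|M. 2 * (norm (y n k w - g n (x k w)))\<^sup>2 + 2 * (norm (g n (x k w)))\<^sup>2)"
      using omega_nonneg norm_add_sq_le[of "y n k w - g n (x k w)" "g n (x k w)" for w]
      by (intro mult_left_mono integral_mono Iy[OF n])
        (auto intro!: Bochner_Integration.integrable_add integrable_mult_right Ie[OF n] Ig[OF n])
    also have "(LINT w|M. 2 * (norm (y n k w - g n (x k w)))\<^sup>2 + 2 * (norm (g n (x k w)))\<^sup>2)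
        = 2 * E_err n k + 2 * (LINT w|M. (norm (g n (x k w)))\<^sup>2)"
      using Ie[OF n] Ig[OF n] by (simp add: E_err_def)
    finally show "2 * (LINT w|M. (norm (y n k w))\<^sup>2) + 2 * (LINT w|M. (norm (compr_noise n k w))\<^sup>2)
      \<le> (2 + 2 * \<omega>) * (2 * E_err n k + 2 * (LINT w|M. (norm (g n (x k w)))\<^sup>2))" .
  qed simp
  also have "\<dots> = (2 + 2 * \<omega>) * (2 * mean_err k + 2 * ((\<Sum>n=1..N. LINT w|M. (norm (g n (x k w)))\<^sup>2) / real N))"
    unfolding mean_err_def sum_distrib_left[symmetric] sum.distrib
    by (simp only: add_divide_distrib distrib_left times_divide_eq_right)
  also have "(\<Sum>n=1..N. LINT w|M. (norm (g n (x k w)))\<^sup>2) / real N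
      = (LINT w|M. (\<Sum>n=1..N. (norm (g n (x k w)))\<^sup>2) / real N)"
    by (rule integrable_sum_divide(2)[symmetric]) (rule Ig)
  also have "(2 + 2 * \<omega>) * (2 * mean_err k + 2 * (LINT w|M. (\<Sum>n=1..N. (norm (g n (x k w)))\<^sup>2) / real N))
      \<le> (2 + 2 * \<omega>) * (2 * mean_err k + 2 * (LINT w|M. a * (norm (grad F (x k w)))\<^sup>2 + b\<^sup>2))"
  proof (intro mult_left_mono add_left_mono integral_mono)
    show "integrable M (\<lambda>w. (\<Sum>n=1..N. (norm (g n (x k w)))\<^sup>2) / real N)"
      by (rule integrable_sum_divide(1)) (rule Ig)
  qed (use omega_nonneg mean_g_sq IG in auto)
  also have "\<dots> = 4 * (1 + \<omega>) * (mean_err k + a * E_grad k + b\<^sup>2)"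
    using IG by (simp add: E_grad_def prob_space algebra_simps)
  also have "\<dots> \<le> 4 * (1 + \<omega>) * ((1 + a + b\<^sup>2) * (mean_err k + E_grad k + 1))"
  proof (intro mult_left_mono)
    have "0 \<le> a * mean_err k" "0 \<le> b\<^sup>2 * mean_err k" "0 \<le> b\<^sup>2 * E_grad k"
      using a_pos mean_err_nonneg E_grad_nonneg by auto
    then show "mean_err k + a * E_grad k + b\<^sup>2 \<le> (1 + a + b\<^sup>2) * (mean_err k + E_grad k + 1)"
      using a_pos E_grad_nonneg[of k] by (simp add: algebra_simps)
  qed (use omega_nonneg in simp)
  finally show ?thesis by (simp add: dir_const_def mult.assoc)
qed

lemma ybar_grad_F: "(norm (ybar k w - grad F (x k w)))\<^sup>2 \<le> (\<Sum>n=1..N. (norm (y n k w - g n (x k w)))\<^sup>2) / real N"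
proof -
  have "ybar k w - grad F (x k w) = (1 / real N) *\<^sub>R (\<Sum>n=1..N. y n k w - g n (x k w))"
    by (simp add: ybar_def grad_F sum_subtractf scaleR_diff_right)
  then show ?thesis by (simp only: norm_mean_sq_le[OF N_ge_1])
qed

lemma E_ybar_grad_F:
  assumes k: "k \<le> K"
  shows "integrable M (\<lambda>w. (norm (ybar k w - grad F (x k w)))\<^sup>2)"
    and "(LINT w|M. (norm (ybar k w - grad F (x k w)))\<^sup>2) \<le> mean_err k"
proof -
  have Ie: "integrable M (\<lambda>w. (norm (y n k w - g n (x k w)))\<^sup>2)" if "n \<in> {1..N}" for n
    using sq_integrableD[OF error_sq[of k n]] that k by auto
  show I: "integrable M (\<lambda>w. (norm (ybar k w - grad F (x k w)))\<^sup>2)"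
    using k by (intro sq_integrableD[OF sq_integrable_diff[OF hist_subalg[OF k]]] ybar_sq grad_F_sq) auto
  have "(LINT w|M. (norm (ybar k w - grad F (x k w)))\<^sup>2)
      \<le> (LINT w|M. (\<Sum>n=1..N. (norm (y n k w - g n (x k w)))\<^sup>2) / real N)"
    by (intro integral_mono I ybar_grad_F integrable_sum_divide(1) Ie)
  also have "\<dots> = mean_err k"
    unfolding mean_err_def E_err_def by (rule integrable_sum_divide(2)) (rule Ie)
  finally show "(LINT w|M. (norm (ybar k w - grad F (x k w)))\<^sup>2) \<le> mean_err k" .
qed

text \<open>Fresh sampling noise is orthogonal to the noise accumulated so far. The mixed term
  vanishes, and the new noise enters with the square of the momentum step, one order below the
  contraction.\<close>

lemma E_noise_Suc:
  assumes k: "k < K" and n: "n \<in> {1..N}" and \<beta>: "0 \<le> \<beta> n k" "\<beta> n k \<le> 1"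
  shows "E_noise n (Suc k) \<le> (1 - \<beta> n k) * E_noise n k + (\<beta> n k)\<^sup>2 * \<sigma>\<^sup>2"
proof -
  have kK: "k \<le> K" "Suc k \<le> K" using k by auto
  define t where "t = \<beta> n k"
  have x: "x k \<in> borel_measurable (hist k)" "x k \<in> borel_measurable (hist (Suc k))"
    using x_sq[of k k] x_sq[of k "Suc k"] kK by (auto simp: sq_integrable_def)
  note nf = noise_facts[OF lessI kK(2) n x]
  have S: "sq_integrable (hist k) (acc_noise n k)" "sq_integrable (hist (Suc k)) (acc_noise n k)"
    using acc_noise_sq[of k k n] acc_noise_sq[of k "Suc k" n] kK n by auto
  have In: "integrable M (\<lambda>w. (norm (noise n k w))\<^sup>2)" and Is: "integrable M (\<lambda>w. (norm (acc_noise n k w))\<^sup>2)"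
    using sq_integrableD[OF nf(1)] sq_integrableD[OF S(1)] by auto
  have Ii: "integrable M (\<lambda>w. acc_noise n k w \<bullet> noise n k w)"
    by (rule integrable_inner_sq[OF hist_subalg[OF kK(2)] S(2) nf(1)])
  have eq: "(norm (acc_noise n (Suc k) w))\<^sup>2 = (1 - t)\<^sup>2 * (norm (acc_noise n k w))\<^sup>2
      + 2 * t * (1 - t) * (acc_noise n k w \<bullet> noise n k w) + t\<^sup>2 * (norm (noise n k w))\<^sup>2" for w
    using norm_diff_scaleR_sq[of "(1 - t) *\<^sub>R acc_noise n k w" "- t" "noise n k w"]
    by (simp add: t_def[symmetric] power_mult_distrib)
  have "E_noise n (Suc k) = (1 - t)\<^sup>2 * E_noise n k
      + 2 * t * (1 - t) * (LINT w|M. acc_noise n k w \<bullet> noise n k w) + t\<^sup>2 * (LINT w|M. (norm (noise n k w))\<^sup>2)"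
    unfolding E_noise_def eq using In Is Ii by simp
  also have "\<dots> \<le> (1 - t) * E_noise n k + t\<^sup>2 * \<sigma>\<^sup>2"
  proof -
    have "(1 - t)\<^sup>2 \<le> 1 - t" using \<beta> by (simp add: power2_eq_square t_def mult_left_le)
    then have "(1 - t)\<^sup>2 * E_noise n k \<le> (1 - t) * E_noise n k"
      by (intro mult_right_mono E_noise_nonneg)
    moreover have "t\<^sup>2 * (LINT w|M. (norm (noise n k w))\<^sup>2) \<le> t\<^sup>2 * \<sigma>\<^sup>2"
      by (intro mult_left_mono nf(2)) simp
    ultimately show ?thesis using nf(3)[OF S(1)] by simp
  qed
  finally show ?thesis by (simp add: t_def)
qed

text \<open>Once the direction is replaced by the mean momentum, Young's inequality trades half of
  the contraction for a term in \<open>(\<alpha> k)\<^sup>2 / \<beta> n k\<close>. For comparable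
  step sizes this is of first order, hence the later demand on their ratio.\<close>

lemma E_spread_Suc:
  assumes k: "k < K" and n: "n \<in> {1..N}" and \<beta>: "\<And>j. j \<le> k \<Longrightarrow> 0 < \<beta> n j \<and> \<beta> n j \<le> 1"
    and \<alpha>: "0 \<le> \<alpha> k"
  shows "E_spread n (Suc k) \<le> (1 - \<beta> n k / 2) * E_spread n k
    + 4 * (\<alpha> k)\<^sup>2 / \<beta> n k * (E_grad k + mean_err k)
    + (\<alpha> k)\<^sup>2 * (dir_const * (mean_err k + E_grad k + 1))"
proof -
  have kK: "k \<le> K" "Suc k \<le> K" using k by auto
  define t where "t = \<beta> n k"
  have t: "0 < t" "t \<le> 1" using \<beta> by (auto simp: t_def)
  let ?d = "\<lambda>w. x k w - avg_x n k w"
  have dk: "sq_integrable (hist k) ?d" "sq_integrable (hist (Suc k)) ?d"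
    using deviation_sq[of k k n] deviation_sq[of k "Suc k" n] kK by auto
  have dr: "sq_integrable (hist (Suc k)) (dir k)" using dir_sq kK by auto
  have yb: "sq_integrable (hist k) (ybar k)" using ybar_sq kK by auto
  have Id: "integrable M (\<lambda>w. (norm (dir k w))\<^sup>2)" by (rule sq_integrableD[OF dr])
  have Ii: "integrable M (\<lambda>w. ?d w \<bullet> dir k w)" "integrable M (\<lambda>w. ?d w \<bullet> ybar k w)"
    using integrable_inner_sq[OF hist_subalg[OF kK(2)] dk(2) dr]
      integrable_inner_sq[OF hist_subalg[OF kK(1)] dk(1) yb] by auto
  note IS = spread_integrable[OF kK(1), of n]
  have var_nonneg: "0 \<le> var_x n k w" if "w \<in> space M" for w
    by (rule momentum_error(2)[OF _ kK(1) n that]) (simp add: \<beta> less_imp_le)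
  have "E_spread n (Suc k) = (LINT w|M. (1 - t) * spread n k w
      - 2 * \<alpha> k * (1 - t) * (?d w \<bullet> dir k w) + (\<alpha> k)\<^sup>2 * (norm (dir k w))\<^sup>2)"
    unfolding E_spread_def t_def by (rule Bochner_Integration.integral_cong) (auto simp: spread_Suc[OF k])
  also have "\<dots> = (1 - t) * E_spread n k + - 2 * \<alpha> k * (1 - t) * (LINT w|M. ?d w \<bullet> ybar k w)
      + (\<alpha> k)\<^sup>2 * (LINT w|M. (norm (dir k w))\<^sup>2)"
    using IS Ii Id by (simp add: E_spread_def E_inner_dir[OF k dk(1)])
  finally have eq: "E_spread n (Suc k) = (1 - t) * E_spread n k
      + - 2 * \<alpha> k * (1 - t) * (LINT w|M. ?d w \<bullet> ybar k w) + (\<alpha> k)\<^sup>2 * (LINT w|M. (norm (dir k w))\<^sup>2)" .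
  have "- 2 * \<alpha> k * (1 - t) * (LINT w|M. ?d w \<bullet> ybar k w)
      \<le> t / 2 * E_spread n k + 4 * (\<alpha> k)\<^sup>2 / t * (E_grad k + mean_err k)"
  \<comment> \<open>The weight in Young's inequality divides by \<open>\<alpha> k\<close>.\<close>
  proof (cases "\<alpha> k = 0")
    case True
    have "0 \<le> E_spread n k"
      unfolding E_spread_def spread_def using var_nonneg
      by (intro Bochner_Integration.integral_nonneg_AE AE_I2) simp
    then show ?thesis using True t by simp
  next
    case False
    then have al: "\<alpha> k > 0" using \<alpha> by simp
    have "- 2 * \<alpha> k * (1 - t) * (LINT w|M. ?d w \<bullet> ybar k w)
        = (LINT w|M. - 2 * \<alpha> k * (1 - t) * (?d w \<bullet> ybar k w))" by simp
    also have "\<dots> \<le> (LINT w|M. t / 2 * spread n k w + 4 * (\<alpha> k)\<^sup>2 / t *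
        ((norm (grad F (x k w)))\<^sup>2 + (norm (ybar k w - grad F (x k w)))\<^sup>2))"
    proof (rule integral_mono)
      fix w assume w: "w \<in> space M"
      have "- 2 * \<alpha> k * (1 - t) * (?d w \<bullet> ybar k w) \<le> \<alpha> k * (2 * \<bar>?d w \<bullet> ybar k w\<bar>)"
      proof -
        have "- (1 - t) * (?d w \<bullet> ybar k w) \<le> (1 - t) * \<bar>?d w \<bullet> ybar k w\<bar>"
          using mult_left_mono[of "- (?d w \<bullet> ybar k w)" "\<bar>?d w \<bullet> ybar k w\<bar>" "1 - t"] t
          by (simp add: algebra_simps)
        also have "\<dots> \<le> 1 * \<bar>?d w \<bullet> ybar k w\<bar>" using t by (intro mult_right_mono) auto
        finally have "\<alpha> k * (2 * (- (1 - t) * (?d w \<bullet> ybar k w))) \<le> \<alpha> k * (2 * \<bar>?d w \<bullet> ybar k w\<bar>)"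
          using \<alpha> by (intro mult_left_mono) auto
        then show ?thesis by (simp add: algebra_simps)
      qed
      \<comment> \<open>The weight \<open>t / (2 * \<alpha> k)\<close> is chosen so that, multiplied
        by \<open>\<alpha> k\<close>, it costs exactly half of the contraction
        \<open>t\<close>.\<close>
      also have "\<dots> \<le> \<alpha> k * (t / (2 * \<alpha> k) * (norm (?d w))\<^sup>2 + 1 / (t / (2 * \<alpha> k)) * (norm (ybar k w))\<^sup>2)"
        using t al by (intro mult_left_mono inner_young) auto
      also have "\<dots> = t / 2 * (norm (?d w))\<^sup>2 + 2 * (\<alpha> k)\<^sup>2 / t * (norm (ybar k w))\<^sup>2"
        using t al by (simp add: field_simps power2_eq_square)
      also have "\<dots> \<le> t / 2 * spread n k w + 2 * (\<alpha> k)\<^sup>2 / t *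
          (2 * (norm (grad F (x k w)))\<^sup>2 + 2 * (norm (ybar k w - grad F (x k w)))\<^sup>2)"
        using t var_nonneg[OF w]
          norm_add_sq_le[of "grad F (x k w)" "ybar k w - grad F (x k w)"]
        by (intro add_mono mult_left_mono) (auto simp: spread_def less_imp_le)
      also have "\<dots> = t / 2 * spread n k w + 4 * (\<alpha> k)\<^sup>2 / t *
          ((norm (grad F (x k w)))\<^sup>2 + (norm (ybar k w - grad F (x k w)))\<^sup>2)"
        by (simp add: algebra_simps)
      finally show "- 2 * \<alpha> k * (1 - t) * (?d w \<bullet> ybar k w) \<le> \<dots>" .
    qed (use IS Ii E_ybar_grad_F(1)[OF kK(1)] sq_integrableD[OF grad_F_sq[of k k]] kK in auto)
    also have "\<dots> = t / 2 * E_spread n k + 4 * (\<alpha> k)\<^sup>2 / t *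
        (E_grad k + (LINT w|M. (norm (ybar k w - grad F (x k w)))\<^sup>2))"
      using IS E_ybar_grad_F(1)[OF kK(1)] sq_integrableD[OF grad_F_sq[of k k]] kK
      by (simp add: E_spread_def E_grad_def)
    also have "\<dots> \<le> t / 2 * E_spread n k + 4 * (\<alpha> k)\<^sup>2 / t * (E_grad k + mean_err k)"
      using E_ybar_grad_F(2)[OF kK(1)] t by (intro add_left_mono mult_left_mono) auto
    finally show ?thesis .
  qed
  then have "E_spread n (Suc k) \<le> (1 - t) * E_spread n k
      + (t / 2 * E_spread n k + 4 * (\<alpha> k)\<^sup>2 / t * (E_grad k + mean_err k))
      + (\<alpha> k)\<^sup>2 * (dir_const * (mean_err k + E_grad k + 1))"
    unfolding eq by (intro add_mono order_refl mult_left_mono E_dir_le k) auto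
  also have "(1 - t) * E_spread n k + (t / 2 * E_spread n k + 4 * (\<alpha> k)\<^sup>2 / t * (E_grad k + mean_err k))
      = (1 - t / 2) * E_spread n k + 4 * (\<alpha> k)\<^sup>2 / t * (E_grad k + mean_err k)"
    by (simp add: algebra_simps)
  finally show ?thesis by (simp add: t_def)
qed

subsection \<open>The Lyapunov function\<close>

text \<open>Twice the strong monotonicity provides \<open>2 * \<mu>\<close> times the squared
  distance. One \<open>\<mu>\<close> pays for the momentum error by Young's inequality; half of the
  other is the contraction, and its other half becomes a gradient term, because the gradient is
  Lipschitz and vanishes at the minimizer.\<close>

lemma E_dist_Suc:
  assumes mu: "\<mu> > 0" and sc: "strongly_convex \<mu> F" and k: "k < K" and \<alpha>: "0 \<le> \<alpha> k"
  defines "P \<equiv> \<lambda>k. LINT w|M. (norm (x k w - stationary_point F))\<^sup>2"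
  shows "P (Suc k) \<le> P k - \<alpha> k * (\<mu> / 2 * P k) - \<alpha> k * (\<mu> / (2 * (\<ll>\<^sup>2 + 1)) * E_grad k)
    + \<alpha> k * (1 / \<mu> * mean_err k) + (\<alpha> k)\<^sup>2 * (dir_const * (mean_err k + E_grad k + 1))"
proof -
  have kK: "k \<le> K" "Suc k \<le> K" using k by auto
  define s where "s = stationary_point F"
  have s0: "grad F s = 0"
    unfolding s_def by (rule strongly_convex_stationary_point[OF sc mu F_differentiable])
  let ?d = "\<lambda>w. x k w - s" and ?e = "\<lambda>w. ybar k w - grad F (x k w)"
  have dk: "sq_integrable (hist k) ?d" "sq_integrable (hist (Suc k)) ?d"
    using x_sq[of k k] x_sq[of k "Suc k"] kK
    by (auto intro!: sq_integrable_diff hist_subalg sq_integrable_const)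
  have dr: "sq_integrable (hist (Suc k)) (dir k)" using dir_sq kK by auto
  have yb: "sq_integrable (hist k) (ybar k)" using ybar_sq kK by auto
  have Id: "integrable M (\<lambda>w. (norm (dir k w))\<^sup>2)" by (rule sq_integrableD[OF dr])
  have IP: "integrable M (\<lambda>w. (norm (?d w))\<^sup>2)" by (rule sq_integrableD[OF dk(1)])
  have Ie: "integrable M (\<lambda>w. (norm (?e w))\<^sup>2)" by (rule E_ybar_grad_F(1)[OF kK(1)])
  have IG: "integrable M (\<lambda>w. (norm (grad F (x k w)))\<^sup>2)"
    using sq_integrableD[OF grad_F_sq[of k k]] kK by auto
  have Ii: "integrable M (\<lambda>w. ?d w \<bullet> dir k w)"
    by (rule integrable_inner_sq[OF hist_subalg[OF kK(2)] dk(2) dr])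
  have Iy: "integrable M (\<lambda>w. ?d w \<bullet> ybar k w)"
    by (rule integrable_inner_sq[OF hist_subalg[OF kK(1)] dk(1) yb])
  have "P (Suc k) = (LINT w|M. (norm (?d w))\<^sup>2 - 2 * \<alpha> k * (?d w \<bullet> dir k w) + (\<alpha> k)\<^sup>2 * (norm (dir k w))\<^sup>2)"
    unfolding P_def
  proof (rule Bochner_Integration.integral_cong[OF refl])
    fix w assume w: "w \<in> space M"
    have "x (Suc k) w - s = ?d w - \<alpha> k *\<^sub>R dir k w" by (simp add: x_Suc[OF w k])
    then show "(norm (x (Suc k) w - stationary_point F))\<^sup>2
        = (norm (?d w))\<^sup>2 - 2 * \<alpha> k * (?d w \<bullet> dir k w) + (\<alpha> k)\<^sup>2 * (norm (dir k w))\<^sup>2"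
      unfolding s_def[symmetric] by (simp only: norm_diff_scaleR_sq)
  qed
  also have "\<dots> = P k - \<alpha> k * (2 * (LINT w|M. ?d w \<bullet> ybar k w)) + (\<alpha> k)\<^sup>2 * (LINT w|M. (norm (dir k w))\<^sup>2)"
    using IP Ii Id by (simp add: P_def s_def[symmetric] E_inner_dir[OF k dk(1)])
  finally have eq: "P (Suc k) = P k - \<alpha> k * (2 * (LINT w|M. ?d w \<bullet> ybar k w)) + (\<alpha> k)\<^sup>2 * (LINT w|M. (norm (dir k w))\<^sup>2)" .
  have "(LINT w|M. \<mu> / 2 * (norm (?d w))\<^sup>2 + \<mu> / (2 * (\<ll>\<^sup>2 + 1)) * (norm (grad F (x k w)))\<^sup>2 - 1 / \<mu> * (norm (?e w))\<^sup>2)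
      \<le> (LINT w|M. 2 * (?d w \<bullet> ybar k w))"
  proof (rule integral_mono)
    fix w
    have "2 * \<bar>?d w \<bullet> ?e w\<bar> \<le> \<mu> * (norm (?d w))\<^sup>2 + 1 / \<mu> * (norm (?e w))\<^sup>2"
      by (rule inner_young[OF mu])
    moreover have "?d w \<bullet> ybar k w = ?d w \<bullet> grad F (x k w) + ?d w \<bullet> ?e w"
      by (simp add: inner_diff_right)
    moreover have "\<mu> * (norm (?d w))\<^sup>2 \<le> ?d w \<bullet> grad F (x k w)"
      using strongly_convex_grad_monotone[OF sc F_differentiable, of "x k w" s] s0
      by (simp add: inner_commute)
    \<comment> \<open>\<open>\<ll>\<^sup>2 + 1\<close> instead of \<open>\<ll>\<^sup>2\<close> keeps
      the denominator positive even for constant gradients.\<close>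
    moreover have "\<mu> / (2 * (\<ll>\<^sup>2 + 1)) * (norm (grad F (x k w)))\<^sup>2 \<le> \<mu> / 2 * (norm (?d w))\<^sup>2"
    proof -
      have "(norm (grad F (x k w)))\<^sup>2 \<le> (\<ll> * norm (?d w))\<^sup>2"
        using grad_F_lipschitz[of "x k w" s] s0 by (intro power_mono) auto
      also have "\<dots> \<le> (\<ll>\<^sup>2 + 1) * (norm (?d w))\<^sup>2" by (simp add: power_mult_distrib algebra_simps)
      finally have "\<mu> / (2 * (\<ll>\<^sup>2 + 1)) * (norm (grad F (x k w)))\<^sup>2
          \<le> \<mu> / (2 * (\<ll>\<^sup>2 + 1)) * ((\<ll>\<^sup>2 + 1) * (norm (?d w))\<^sup>2)"
        using mu by (intro mult_left_mono) auto
      also have "\<dots> = \<mu> / 2 * (norm (?d w))\<^sup>2"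
      proof -
        have "\<ll>\<^sup>2 + 1 \<noteq> 0" by (smt (verit) zero_le_power2)
        then show ?thesis by (simp add: field_simps)
      qed
      finally show ?thesis .
    qed
    ultimately show "\<mu> / 2 * (norm (?d w))\<^sup>2 + \<mu> / (2 * (\<ll>\<^sup>2 + 1)) * (norm (grad F (x k w)))\<^sup>2 - 1 / \<mu> * (norm (?e w))\<^sup>2
        \<le> 2 * (?d w \<bullet> ybar k w)"
      by (simp add: field_simps)
  qed (use IP IG Ie Iy in auto)
  also have "(LINT w|M. \<mu> / 2 * (norm (?d w))\<^sup>2 + \<mu> / (2 * (\<ll>\<^sup>2 + 1)) * (norm (grad F (x k w)))\<^sup>2 - 1 / \<mu> * (norm (?e w))\<^sup>2)
      = \<mu> / 2 * P k + \<mu> / (2 * (\<ll>\<^sup>2 + 1)) * E_grad k - 1 / \<mu> * (LINT w|M. (norm (?e w))\<^sup>2)"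
    using IP IG Ie by (simp add: P_def s_def E_grad_def)
  finally have "\<mu> / 2 * P k + \<mu> / (2 * (\<ll>\<^sup>2 + 1)) * E_grad k - 1 / \<mu> * (LINT w|M. (norm (?e w))\<^sup>2)
      \<le> 2 * (LINT w|M. ?d w \<bullet> ybar k w)" by simp
  moreover have "1 / \<mu> * (LINT w|M. (norm (?e w))\<^sup>2) \<le> 1 / \<mu> * mean_err k"
    using E_ybar_grad_F(2)[OF kK(1)] mu by (intro mult_left_mono) auto
  ultimately have "\<mu> / 2 * P k + \<mu> / (2 * (\<ll>\<^sup>2 + 1)) * E_grad k - 1 / \<mu> * mean_err k
      \<le> 2 * (LINT w|M. ?d w \<bullet> ybar k w)" by linarith
  then have "\<alpha> k * (\<mu> / 2 * P k + \<mu> / (2 * (\<ll>\<^sup>2 + 1)) * E_grad k - 1 / \<mu> * mean_err k)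
      \<le> \<alpha> k * (2 * (LINT w|M. ?d w \<bullet> ybar k w))"
    using \<alpha> by (rule mult_left_mono)
  moreover have "(\<alpha> k)\<^sup>2 * (LINT w|M. (norm (dir k w))\<^sup>2) \<le> (\<alpha> k)\<^sup>2 * (dir_const * (mean_err k + E_grad k + 1))"
    by (intro mult_left_mono E_dir_le k) auto
  ultimately show ?thesis unfolding eq by (simp only: distrib_left right_diff_distrib)
qed

text \<open>\<open>F\<close> is bounded below by \<open>c\<close> and above by a quadratic, the
  latter by smoothness at \<open>0\<close>, so second moments of the iterate suffice.\<close>

lemma F_integrable:
  assumes "k \<le> K" and lower: "\<And>u. c \<le> F u"
  shows "integrable M (\<lambda>w. F (x k w))"
proof -
  have X: "sq_integrable (hist k) (x k)" using x_sq assms by auto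
  have "x k \<in> borel_measurable M" using sq_integrable_measurable[OF hist_subalg X] assms by auto
  moreover have "F \<in> borel_measurable borel"
    by (intro borel_measurable_continuous_onI continuous_at_imp_continuous_on ballI)
      (meson F_differentiable differentiable_imp_continuous_within)
  ultimately have m: "(\<lambda>w. F (x k w)) \<in> borel_measurable M" by (rule measurable_compose)
  have "norm (F u) \<le> norm (\<bar>c\<bar> + \<bar>F 0\<bar> + (norm (grad F 0))\<^sup>2 + (1 + \<ll>) * (norm u)\<^sup>2)" for u
  proof -
    have "F u \<le> F 0 + grad F 0 \<bullet> u + \<ll> * (norm u)\<^sup>2" using F_descent[of 0 u] by simp
    moreover have "2 * \<bar>grad F 0 \<bullet> u\<bar> \<le> 1 * (norm (grad F 0))\<^sup>2 + (1 / 1) * (norm u)\<^sup>2"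
      by (rule inner_young) simp
    ultimately have "F u \<le> \<bar>F 0\<bar> + (norm (grad F 0))\<^sup>2 + (1 + \<ll>) * (norm u)\<^sup>2"
      using zero_le_power2[of "norm (grad F 0)"] zero_le_power2[of "norm u"]
      by (unfold distrib_right) linarith
    moreover have "0 \<le> (1 + \<ll>) * (norm u)\<^sup>2" using lipschitz_nonneg by simp
    ultimately show ?thesis using lower[of u] zero_le_power2[of "norm (grad F 0)"]
      unfolding real_norm_def by linarith
  qed
  then show ?thesis
    using sq_integrableD[OF X]
    by (intro Bochner_Integration.integrable_bound[OF _ m AE_I2,
        of "\<lambda>w. \<bar>c\<bar> + \<bar>F 0\<bar> + (norm (grad F 0))\<^sup>2 + (1 + \<ll>) * (norm (x k w))\<^sup>2"]) auto
qed

text \<open>The descent inequality with Young's weight 1 leaves half of the squared gradient.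
  Without convexity the gap itself does not contract, so this recursion can only be summed.\<close>

lemma E_gap_Suc:
  assumes lower: "\<And>u. c \<le> F u" and k: "k < K" and \<alpha>: "0 \<le> \<alpha> k"
  defines "P \<equiv> \<lambda>k. LINT w|M. F (x k w) - c"
  shows "P (Suc k) \<le> P k - \<alpha> k * (1 / 2 * E_grad k)
    + \<alpha> k * (1 / 2 * mean_err k) + (\<alpha> k)\<^sup>2 * (\<ll> * dir_const * (mean_err k + E_grad k + 1))"
proof -
  have kK: "k \<le> K" "Suc k \<le> K" using k by auto
  let ?e = "\<lambda>w. ybar k w - grad F (x k w)"
  have gk: "sq_integrable (hist k) (\<lambda>w. grad F (x k w))" "sq_integrable (hist (Suc k)) (\<lambda>w. grad F (x k w))"
    using grad_F_sq[of k k] grad_F_sq[of k "Suc k"] kK by auto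
  have dr: "sq_integrable (hist (Suc k)) (dir k)" using dir_sq kK by auto
  have yb: "sq_integrable (hist k) (ybar k)" using ybar_sq kK by auto
  have Id: "integrable M (\<lambda>w. (norm (dir k w))\<^sup>2)" by (rule sq_integrableD[OF dr])
  have IG: "integrable M (\<lambda>w. (norm (grad F (x k w)))\<^sup>2)" by (rule sq_integrableD[OF gk(1)])
  have Ie: "integrable M (\<lambda>w. (norm (?e w))\<^sup>2)" by (rule E_ybar_grad_F(1)[OF kK(1)])
  have Ii: "integrable M (\<lambda>w. grad F (x k w) \<bullet> dir k w)"
    by (rule integrable_inner_sq[OF hist_subalg[OF kK(2)] gk(2) dr])
  have Iy: "integrable M (\<lambda>w. grad F (x k w) \<bullet> ybar k w)"
    by (rule integrable_inner_sq[OF hist_subalg[OF kK(1)] gk(1) yb])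
  note IF = F_integrable[OF kK(1) lower] F_integrable[OF kK(2) lower]
  have "P (Suc k) \<le> (LINT w|M. F (x k w) - c - \<alpha> k * (grad F (x k w) \<bullet> dir k w)
      + \<ll> * (\<alpha> k)\<^sup>2 * (norm (dir k w))\<^sup>2)"
    unfolding P_def
  proof (rule integral_mono)
    fix w assume w: "w \<in> space M"
    show "F (x (Suc k) w) - c \<le> F (x k w) - c - \<alpha> k * (grad F (x k w) \<bullet> dir k w)
      + \<ll> * (\<alpha> k)\<^sup>2 * (norm (dir k w))\<^sup>2"
      using F_descent[of "x k w" "- (\<alpha> k *\<^sub>R dir k w)"]
      by (simp add: x_Suc[OF w k] power_mult_distrib)
  qed (use IF IG Id Ii in auto)
  also have "\<dots> = P k - \<alpha> k * (LINT w|M. grad F (x k w) \<bullet> ybar k w)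
      + (\<alpha> k)\<^sup>2 * (\<ll> * (LINT w|M. (norm (dir k w))\<^sup>2))"
    using IF Ii Id by (simp add: P_def E_inner_dir[OF k gk(1)] prob_space)
  finally have 1: "P (Suc k) \<le> P k - \<alpha> k * (LINT w|M. grad F (x k w) \<bullet> ybar k w)
      + (\<alpha> k)\<^sup>2 * (\<ll> * (LINT w|M. (norm (dir k w))\<^sup>2))" .
  have "(LINT w|M. 1 / 2 * (norm (grad F (x k w)))\<^sup>2 - 1 / 2 * (norm (?e w))\<^sup>2)
      \<le> (LINT w|M. grad F (x k w) \<bullet> ybar k w)"
  proof (rule integral_mono)
    fix w
    have "2 * \<bar>grad F (x k w) \<bullet> ?e w\<bar> \<le> 1 * (norm (grad F (x k w)))\<^sup>2 + 1 / 1 * (norm (?e w))\<^sup>2"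
      by (rule inner_young) simp
    moreover have "grad F (x k w) \<bullet> ybar k w = (norm (grad F (x k w)))\<^sup>2 + grad F (x k w) \<bullet> ?e w"
      by (simp add: inner_diff_right power2_norm_eq_inner)
    ultimately show "1 / 2 * (norm (grad F (x k w)))\<^sup>2 - 1 / 2 * (norm (?e w))\<^sup>2 \<le> grad F (x k w) \<bullet> ybar k w"
      by linarith
  qed (use IG Ie Iy in auto)
  also have "(LINT w|M. 1 / 2 * (norm (grad F (x k w)))\<^sup>2 - 1 / 2 * (norm (?e w))\<^sup>2)
      = 1 / 2 * E_grad k - 1 / 2 * (LINT w|M. (norm (?e w))\<^sup>2)"
    using IG Ie by (simp add: E_grad_def)
  finally have "1 / 2 * E_grad k - 1 / 2 * mean_err k \<le> (LINT w|M. grad F (x k w) \<bullet> ybar k w)"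
    using E_ybar_grad_F(2)[OF kK(1)] by linarith
  then have "\<alpha> k * (1 / 2 * E_grad k - 1 / 2 * mean_err k) \<le> \<alpha> k * (LINT w|M. grad F (x k w) \<bullet> ybar k w)"
    using \<alpha> by (rule mult_left_mono)
  moreover have "(\<alpha> k)\<^sup>2 * (\<ll> * (LINT w|M. (norm (dir k w))\<^sup>2)) \<le> (\<alpha> k)\<^sup>2 * (\<ll> * (dir_const * (mean_err k + E_grad k + 1)))"
    by (intro mult_left_mono E_dir_le k lipschitz_nonneg) auto
  ultimately show ?thesis using 1 by (simp add: mult.assoc right_diff_distrib)
qed

section \<open>Averages over the nodes and the combined one-step inequality\<close>

definition mean_spread :: "nat \<Rightarrow> real" where
  "mean_spread k = (\<Sum>n=1..N. E_spread n k) / real N"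

definition mean_noise :: "nat \<Rightarrow> real" where
  "mean_noise k = (\<Sum>n=1..N. E_noise n k) / real N"

lemma mean_noise_nonneg: "0 \<le> mean_noise k"
  unfolding mean_noise_def by (intro divide_nonneg_nonneg sum_nonneg E_noise_nonneg) simp

context
  assumes \<beta>: "\<And>n j. n \<in> {1..N} \<Longrightarrow> j < K \<Longrightarrow> 0 < \<beta> n j \<and> \<beta> n j \<le> 1"
begin

lemma \<beta>_unit: "n \<in> {1..N} \<Longrightarrow> j < K \<Longrightarrow> 0 \<le> \<beta> n j \<and> \<beta> n j \<le> 1"
  using \<beta>[of n j] by linarith

lemma E_spread_nonneg:
  assumes "k \<le> K" "n \<in> {1..N}"
  shows "0 \<le> E_spread n k"
proof -
  have "0 \<le> var_x n k w" if "w \<in> space M" for w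
    by (rule momentum_error(2)[OF _ assms that], rule \<beta>_unit[OF assms(2)]) (use assms(1) in simp)
  then show ?thesis
    unfolding E_spread_def spread_def by (intro Bochner_Integration.integral_nonneg_AE AE_I2) simp
qed

lemma mean_spread_nonneg: "k \<le> K \<Longrightarrow> 0 \<le> mean_spread k"
  unfolding mean_spread_def by (intro divide_nonneg_nonneg sum_nonneg E_spread_nonneg) auto

lemma mean_err_le:
  assumes k: "k \<le> K"
  shows "mean_err k \<le> 2 * mean_noise k + 2 * \<ll>\<^sup>2 * mean_spread k"
proof -
  have "E_err n k \<le> 2 * E_noise n k + 2 * \<ll>\<^sup>2 * E_spread n k" if n: "n \<in> {1..N}" for n
  proof -
    have In: "integrable M (\<lambda>w. (norm (acc_noise n k w))\<^sup>2)"
      using sq_integrableD[OF acc_noise_sq[of k k n]] k n by auto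
    note IS = spread_integrable[OF k, of n]
    have "E_err n k \<le> (LINT w|M. 2 * (norm (acc_noise n k w))\<^sup>2 + 2 * \<ll>\<^sup>2 * spread n k w)"
      unfolding E_err_def
    proof (rule integral_mono[OF sq_integrableD[OF error_sq[OF k n]]])
      fix w assume "w \<in> space M"
      then show "(norm (y n k w - g n (x k w)))\<^sup>2 \<le> 2 * (norm (acc_noise n k w))\<^sup>2 + 2 * \<ll>\<^sup>2 * spread n k w"
        by (intro momentum_error(1) k n \<beta>_unit) (use k in simp)
    qed (use In IS in auto)
    also have "\<dots> = 2 * E_noise n k + 2 * \<ll>\<^sup>2 * E_spread n k"
      using In IS by (simp add: E_noise_def E_spread_def)
    finally show ?thesis .
  qed
  then have "mean_err k \<le> (\<Sum>n=1..N. 2 * E_noise n k + 2 * \<ll>\<^sup>2 * E_spread n k) / real N"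
    unfolding mean_err_def by (intro divide_right_mono sum_mono) auto
  also have "\<dots> = 2 * mean_noise k + 2 * \<ll>\<^sup>2 * mean_spread k"
    unfolding mean_noise_def mean_spread_def sum.distrib sum_distrib_left[symmetric]
    by (simp only: add_divide_distrib times_divide_eq_right)
  finally show ?thesis .
qed

lemma mean_noise_Suc:
  assumes k: "k < K" and lo: "\<And>n. n \<in> {1..N} \<Longrightarrow> r \<le> \<beta> n k" and up: "\<And>n. n \<in> {1..N} \<Longrightarrow> \<beta> n k \<le> B"
  shows "mean_noise (Suc k) \<le> (1 - r) * mean_noise k + B\<^sup>2 * \<sigma>\<^sup>2"
proof -
  have "E_noise n (Suc k) \<le> (1 - r) * E_noise n k + B\<^sup>2 * \<sigma>\<^sup>2" if n: "n \<in> {1..N}" for n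
  proof -
    have b: "0 < \<beta> n k" "\<beta> n k \<le> 1" using \<beta> n k by auto
    have "E_noise n (Suc k) \<le> (1 - \<beta> n k) * E_noise n k + (\<beta> n k)\<^sup>2 * \<sigma>\<^sup>2"
      using b by (intro E_noise_Suc k n) auto
    also have "\<dots> \<le> (1 - r) * E_noise n k + B\<^sup>2 * \<sigma>\<^sup>2"
      using lo[OF n] up[OF n] b
      by (intro add_mono mult_right_mono power_mono E_noise_nonneg) auto
    finally show ?thesis .
  qed
  then have "mean_noise (Suc k) \<le> (\<Sum>n=1..N. (1 - r) * E_noise n k + B\<^sup>2 * \<sigma>\<^sup>2) / real N"
    unfolding mean_noise_def by (intro divide_right_mono sum_mono) auto
  also have "\<dots> = (1 - r) * mean_noise k + B\<^sup>2 * \<sigma>\<^sup>2"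
    using N_ge_1 unfolding mean_noise_def sum.distrib sum_distrib_left[symmetric]
    by (simp add: add_divide_distrib)
  finally show ?thesis .
qed

text \<open>The lower bound on \<open>\<beta> n k\<close> turns
  \<open>(\<alpha> k)\<^sup>2 / \<beta> n k\<close> into \<open>\<alpha> k / \<rho>\<close>:
  feedback into the spread is of first order, but with a coefficient that a large
  \<open>\<rho>\<close> makes small.\<close>

lemma mean_spread_Suc:
  assumes k: "k < K" and \<alpha>: "0 < \<alpha> k" and \<rho>: "0 < \<rho>" and lo: "\<And>n. n \<in> {1..N} \<Longrightarrow> \<rho> * \<alpha> k \<le> \<beta> n k"
  shows "mean_spread (Suc k) \<le> (1 - \<rho> * \<alpha> k / 2) * mean_spread k
    + 4 * \<alpha> k / \<rho> * (E_grad k + mean_err k) + (\<alpha> k)\<^sup>2 * (dir_const * (mean_err k + E_grad k + 1))"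
proof -
  define q where "q = 4 * \<alpha> k / \<rho> * (E_grad k + mean_err k)
    + (\<alpha> k)\<^sup>2 * (dir_const * (mean_err k + E_grad k + 1))"
  have "E_spread n (Suc k) \<le> (1 - \<rho> * \<alpha> k / 2) * E_spread n k + q" if n: "n \<in> {1..N}" for n
  proof -
    have b: "0 < \<beta> n k" using \<beta> n k by auto
    have "E_spread n (Suc k) \<le> (1 - \<beta> n k / 2) * E_spread n k
      + 4 * (\<alpha> k)\<^sup>2 / \<beta> n k * (E_grad k + mean_err k)
      + (\<alpha> k)\<^sup>2 * (dir_const * (mean_err k + E_grad k + 1))"
      using \<beta> n k \<alpha> by (intro E_spread_Suc) auto
    also have "\<dots> \<le> (1 - \<rho> * \<alpha> k / 2) * E_spread n k + 4 * \<alpha> k / \<rho> * (E_grad k + mean_err k)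
      + (\<alpha> k)\<^sup>2 * (dir_const * (mean_err k + E_grad k + 1))"
    proof (rule add_mono[OF _ order_refl], intro add_mono mult_right_mono)
      show "1 - \<beta> n k / 2 \<le> 1 - \<rho> * \<alpha> k / 2" using lo[OF n] by simp
      show "0 \<le> E_spread n k" using E_spread_nonneg k n by simp
      have "4 * (\<alpha> k)\<^sup>2 / \<beta> n k \<le> 4 * (\<alpha> k)\<^sup>2 / (\<rho> * \<alpha> k)"
        using lo[OF n] b \<alpha> \<rho> by (intro divide_left_mono) auto
      also have "\<dots> = 4 * \<alpha> k / \<rho>" using \<alpha> by (simp add: power2_eq_square)
      finally show "4 * (\<alpha> k)\<^sup>2 / \<beta> n k \<le> 4 * \<alpha> k / \<rho>" .
      show "0 \<le> E_grad k + mean_err k" using E_grad_nonneg mean_err_nonneg by simp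
    qed
    finally show ?thesis by (simp add: q_def)
  qed
  then have "mean_spread (Suc k) \<le> (\<Sum>n=1..N. (1 - \<rho> * \<alpha> k / 2) * E_spread n k + q) / real N"
    unfolding mean_spread_def by (intro divide_right_mono sum_mono) auto
  also have "\<dots> = (1 - \<rho> * \<alpha> k / 2) * mean_spread k + q"
    using N_ge_1 unfolding mean_spread_def sum.distrib sum_distrib_left[symmetric]
    by (simp add: add_divide_distrib)
  finally show ?thesis by (simp add: q_def)
qed

text \<open>\<open>P\<close> is abstract to cover both regimes: the squared distance with
  \<open>m = \<mu> / 2\<close> and the optimality gap with \<open>m = 0\<close>.
  \<open>\<kappa>\<close> is the gradient decrease that \<open>P\<close> offers and
  \<open>\<theta>\<close> the momentum error that it suffers.\<close>

lemma lyapunov_step: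
  fixes P :: "nat \<Rightarrow> real"
  assumes k: "k < K" and \<alpha>: "0 < \<alpha> k" and lo: "\<And>n. n \<in> {1..N} \<Longrightarrow> \<rho> * \<alpha> k \<le> \<beta> n k"
    and up: "\<And>n. n \<in> {1..N} \<Longrightarrow> \<beta> n k \<le> B"
    and P: "P (Suc k) \<le> P k - \<alpha> k * (m * P k) - \<alpha> k * (\<kappa> * E_grad k) + \<alpha> k * (\<theta> * mean_err k)
      + (\<alpha> k)\<^sup>2 * (c * (mean_err k + E_grad k + 1))"
    and c: "dir_const \<le> c" and \<kappa>: "0 < \<kappa>" and \<theta>: "0 \<le> \<theta>"
    and small: "2 * c * \<alpha> k \<le> \<kappa> / 4" "2 * c * \<alpha> k \<le> 1"
    and \<rho>: "4 \<le> \<rho>" "16 / \<kappa> \<le> \<rho>" "2 * ((\<theta> + 2) * (2 + 2 * \<ll>\<^sup>2) + 1) \<le> \<rho>"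
  shows "P (Suc k) + mean_spread (Suc k) + mean_noise (Suc k)
    \<le> P k + mean_spread k + mean_noise k
      - \<alpha> k * (m * P k + \<kappa> / 2 * E_grad k + mean_spread k + mean_noise k)
      + (2 * c * (\<alpha> k)\<^sup>2 + B\<^sup>2 * \<sigma>\<^sup>2)"
proof -
  define G e W S A where "G = E_grad k" and "e = mean_err k" and "W = mean_spread k"
    and "S = mean_noise k" and "A = \<alpha> k"
  have nn: "0 \<le> G" "0 \<le> e" "0 \<le> W" "0 \<le> S" "0 < A" "0 < \<rho>"
    using E_grad_nonneg mean_err_nonneg mean_spread_nonneg mean_noise_nonneg k \<alpha> \<rho>(1)
    by (auto simp: G_def e_def W_def S_def A_def)
  have e: "e \<le> 2 * S + 2 * \<ll>\<^sup>2 * W"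
    using mean_err_le k by (simp add: e_def S_def W_def)
  have W': "mean_spread (Suc k) \<le> W - A * (\<rho> / 2 * W) + A * (4 / \<rho> * (G + e)) + A\<^sup>2 * (c * (e + G + 1))"
  proof -
    have "A\<^sup>2 * (dir_const * (e + G + 1)) \<le> A\<^sup>2 * (c * (e + G + 1))"
      using nn c by (intro mult_left_mono mult_right_mono) auto
    then show ?thesis
      using mean_spread_Suc[OF k \<alpha> nn(6) lo]
      by (simp add: G_def[symmetric] e_def[symmetric] W_def[symmetric] A_def[symmetric] algebra_simps)
  qed
  have S': "mean_noise (Suc k) \<le> S - A * (\<rho> * S) + B\<^sup>2 * \<sigma>\<^sup>2"
    using mean_noise_Suc[OF k lo up] by (simp add: S_def A_def algebra_simps)
  have P': "P (Suc k) \<le> P k - A * (m * P k) - A * (\<kappa> * G) + A * (\<theta> * e) + A\<^sup>2 * (c * (e + G + 1))"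
    using P by (simp add: G_def e_def A_def)
  \<comment> \<open>The feedback of the spread may use up a quarter of the gradient decrease; this
    is the origin of \<open>16 / \<kappa>\<close>.\<close>
  have "4 / \<rho> \<le> \<kappa> / 4" "4 / \<rho> \<le> 1"
    using \<rho>(1,2) \<kappa> nn(6) by (simp_all add: field_simps)
  then have "4 / \<rho> * G \<le> \<kappa> / 4 * G" "4 / \<rho> * e \<le> 1 * e"
    using nn by (metis mult_right_mono)+
  then have r: "4 / \<rho> * (G + e) \<le> \<kappa> / 4 * G + e" by (unfold distrib_left) linarith
  \<comment> \<open>The second-order terms use up another quarter, so that
    \<open>\<kappa> / 2\<close> survives.\<close>
  have "2 * c * A * G \<le> \<kappa> / 4 * G" "2 * c * A * e \<le> 1 * e"
    using nn small unfolding A_def by (metis mult_right_mono)+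
  then have cc: "2 * c * A * (e + G) \<le> e + \<kappa> / 4 * G" by (unfold distrib_left) linarith
  \<comment> \<open>The momentum error arises three times: \<open>\<theta>\<close> from
    \<open>P\<close>, 1 from the spread, 1 from the second-order terms. The summand 1 in the third
    condition on \<open>\<rho>\<close> leaves a full \<open>W + S\<close> as decrease.\<close>
  have "(\<theta> + 2) * e \<le> (\<theta> + 2) * ((2 + 2 * \<ll>\<^sup>2) * (W + S))"
  proof (intro mult_left_mono order_trans[OF e])
    show "2 * S + 2 * \<ll>\<^sup>2 * W \<le> (2 + 2 * \<ll>\<^sup>2) * (W + S)"
      using nn by (simp add: algebra_simps)
  qed (use \<theta> in simp)
  also have "\<dots> = ((\<theta> + 2) * (2 + 2 * \<ll>\<^sup>2)) * (W + S)" by simp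
  also have "\<dots> \<le> (\<rho> / 2 - 1) * (W + S)"
    using \<rho>(3) nn by (intro mult_right_mono) auto
  also have "\<dots> = \<rho> / 2 * W + \<rho> * S - W - S - (\<rho> * S) / 2" by (simp add: algebra_simps)
  also have "\<dots> \<le> \<rho> / 2 * W + \<rho> * S - W - S" using nn by simp
  finally have key: "(\<theta> + 2) * e \<le> \<rho> / 2 * W + \<rho> * S - W - S" .
  have "- (\<kappa> * G) + \<theta> * e + 4 / \<rho> * (G + e) + 2 * c * A * (e + G) - \<rho> / 2 * W - \<rho> * S
      \<le> - (\<kappa> / 2 * G) - W - S"
    using r cc key by (simp add: algebra_simps)
  from mult_left_mono[OF this less_imp_le[OF nn(5)]]
  have "A * (- (\<kappa> * G) + \<theta> * e + 4 / \<rho> * (G + e) + 2 * c * A * (e + G) - \<rho> / 2 * W - \<rho> * S)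
      \<le> A * (- (\<kappa> / 2 * G) - W - S)" .
  \<comment> \<open>The factor 2 appears because the quadratic term occurs in the recursion of
    \<open>P\<close> and in that of the spread.\<close>
  moreover have "A * (2 * c * A * (e + G)) + 2 * c * A\<^sup>2 = 2 * (A\<^sup>2 * (c * (e + G + 1)))"
    by (simp add: power2_eq_square algebra_simps)
  ultimately have "P (Suc k) + mean_spread (Suc k) + mean_noise (Suc k)
    \<le> P k + W + S - A * (m * P k + \<kappa> / 2 * G + W + S) + (2 * c * A\<^sup>2 + B\<^sup>2 * \<sigma>\<^sup>2)"
    using P' W' S' by (unfold distrib_left right_diff_distrib mult_minus_right) linarith
  then show ?thesis by (simp add: G_def W_def S_def A_def)
qed

end

text \<open>Average and iterate start at the same point, so the whole initial momentum error sits in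
  \<open>acc_noise\<close>.\<close>

lemma mean_spread_0: "mean_spread 0 = 0"
proof -
  have "E_spread n 0 = 0" for n
    unfolding E_spread_def spread_def
    by (rule trans[OF Bochner_Integration.integral_cong[OF refl, of M _ "\<lambda>_. 0"]]) (auto simp: x_0)
  then show ?thesis by (simp add: mean_spread_def)
qed

lemma mean_noise_0: "mean_noise 0 = (\<Sum>n=1..N. (norm (y0 n - g n x0))\<^sup>2) / real N"
  by (simp add: mean_noise_def E_noise_def prob_space)

definition init_err :: real where
  "init_err = (\<Sum>n=1..N. (norm (y0 n - g n x0))\<^sup>2) / real N"

text \<open>Nonnegativity of the summands bounds a single node by the mean at the price of a factor
  \<open>N\<close>, which asymptotic constants absorb.\<close>

lemma E_err_le_mean_err: "n \<in> {1..N} \<Longrightarrow> E_err n k \<le> real N * mean_err k"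
  using member_le_sum[of n "{1..N}" "\<lambda>n. E_err n k"] E_err_nonneg N_ge_1
  by (simp add: mean_err_def)

section \<open>Bounds for a complete run with steps between fixed limits\<close>

context
  fixes r B \<rho> :: real
  assumes steps: "\<And>k. k < K \<Longrightarrow> 0 < \<alpha> k \<and> r \<le> \<alpha> k \<and> \<alpha> k \<le> B"
      "\<And>k n. k < K \<Longrightarrow> n \<in> {1..N} \<Longrightarrow> \<rho> * \<alpha> k \<le> \<beta> n k \<and> \<beta> n k \<le> B"
    and r: "0 < r" and B: "B \<le> 1" and \<rho>: "4 \<le> \<rho>"
begin

lemma \<beta>_pos_le_1: "n \<in> {1..N} \<Longrightarrow> k < K \<Longrightarrow> 0 < \<beta> n k \<and> \<beta> n k \<le> 1"
proof -
  assume n: "n \<in> {1..N}" and k: "k < K"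
  have "0 < \<rho> * \<alpha> k" using steps(1)[OF k] \<rho> by simp
  then show ?thesis using steps(2)[OF k n] B by linarith
qed

lemma E_err_le:
  assumes n: "n \<in> {1..N}" and k: "k \<le> K"
  shows "E_err n k \<le> real N * (2 + 2 * \<ll>\<^sup>2) * (mean_spread k + mean_noise k)"
proof -
  have "mean_err k \<le> 2 * mean_noise k + 2 * \<ll>\<^sup>2 * mean_spread k"
    by (rule mean_err_le[OF \<beta>_pos_le_1 k])
  also have "\<dots> \<le> (2 + 2 * \<ll>\<^sup>2) * (mean_spread k + mean_noise k)"
    using mean_spread_nonneg[OF \<beta>_pos_le_1 k] mean_noise_nonneg[of k] by (simp add: algebra_simps)
  finally have "real N * mean_err k \<le> real N * ((2 + 2 * \<ll>\<^sup>2) * (mean_spread k + mean_noise k))"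
    by (intro mult_left_mono) auto
  then show ?thesis using E_err_le_mean_err[OF n, of k] by (simp add: mult.assoc)
qed

text \<open>Relative to the step size, \<open>P\<close> decreases at rate \<open>\<mu> / 2\<close>,
  spread and noise at rate 1, so \<open>m\<close> is the rate common to all three and the sum
  contracts by \<open>1 - m * r\<close>.\<close>

lemma strongly_convex_bound:
  assumes mu: "\<mu> > 0" and sc: "strongly_convex \<mu> F"
    and small: "2 * dir_const * B \<le> \<mu> / (2 * (\<ll>\<^sup>2 + 1)) / 4" "2 * dir_const * B \<le> 1"
    and rho: "16 / (\<mu> / (2 * (\<ll>\<^sup>2 + 1))) \<le> \<rho>" "2 * ((1 / \<mu> + 2) * (2 + 2 * \<ll>\<^sup>2) + 1) \<le> \<rho>"
    and m: "m = min 1 (\<mu> / 2)" and mr: "m * r \<le> 1"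
  defines "P \<equiv> \<lambda>k. LINT w|M. (norm (x k w - stationary_point F))\<^sup>2"
  shows "P K + mean_spread K + mean_noise K
    \<le> (1 - m * r) ^ K * ((norm (x0 - stationary_point F))\<^sup>2 + init_err)
      + (2 * dir_const + \<sigma>\<^sup>2) * B\<^sup>2 / (m * r)"
proof -
  define L where "L k = P k + mean_spread k + mean_noise k" for k
  have m': "0 < m" "m \<le> 1" "m \<le> \<mu> / 2" using m mu by auto
  have P0: "0 \<le> P k" for k by (simp add: P_def)
  have \<kappa>: "0 < \<mu> / (2 * (\<ll>\<^sup>2 + 1))"
    using mu add_nonneg_pos[OF zero_le_power2[of \<ll>] zero_less_one] by simp
  have "L (Suc k) \<le> (1 - m * r) * L k + (2 * dir_const + \<sigma>\<^sup>2) * B\<^sup>2" if k: "k < K" for k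
  proof -
    have ak: "0 < \<alpha> k" "r \<le> \<alpha> k" "\<alpha> k \<le> B" using steps(1)[OF k] by auto
    have dB: "2 * dir_const * \<alpha> k \<le> 2 * dir_const * B"
      using ak dir_const_nonneg by (intro mult_left_mono) auto
    have "L (Suc k) \<le> L k
      - \<alpha> k * (\<mu> / 2 * P k + \<mu> / (2 * (\<ll>\<^sup>2 + 1)) / 2 * E_grad k + mean_spread k + mean_noise k)
      + (2 * dir_const * (\<alpha> k)\<^sup>2 + B\<^sup>2 * \<sigma>\<^sup>2)"
      unfolding L_def
    proof (rule lyapunov_step[OF \<beta>_pos_le_1 k ak(1)])
      show "P (Suc k) \<le> P k - \<alpha> k * (\<mu> / 2 * P k) - \<alpha> k * (\<mu> / (2 * (\<ll>\<^sup>2 + 1)) * E_grad k)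
        + \<alpha> k * (1 / \<mu> * mean_err k) + (\<alpha> k)\<^sup>2 * (dir_const * (mean_err k + E_grad k + 1))"
        unfolding P_def using ak by (intro E_dist_Suc mu sc k) simp
      show "2 * dir_const * \<alpha> k \<le> \<mu> / (2 * (\<ll>\<^sup>2 + 1)) / 4" "2 * dir_const * \<alpha> k \<le> 1"
        using small dB by linarith+
    qed (use steps(2) k rho \<rho> mu \<kappa> in auto)
    \<comment> \<open>The gradient term has done its work and is discarded. The decrease is weakened
      to the smallest step \<open>r\<close>, the error enlarged to the largest step
      \<open>B\<close>.\<close>
    also have "\<dots> \<le> L k - r * (m * L k) + (2 * dir_const * B\<^sup>2 + B\<^sup>2 * \<sigma>\<^sup>2)"
    proof -
      have nn: "0 \<le> mean_spread k" "0 \<le> mean_noise k"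
        using mean_spread_nonneg[OF \<beta>_pos_le_1, of k] k mean_noise_nonneg by auto
      have "0 \<le> \<mu> / (2 * (\<ll>\<^sup>2 + 1)) / 2 * E_grad k"
        by (rule mult_nonneg_nonneg[OF less_imp_le[OF half_gt_zero[OF \<kappa>]] E_grad_nonneg])
      moreover have "m * P k \<le> \<mu> / 2 * P k" "m * mean_spread k \<le> 1 * mean_spread k"
        "m * mean_noise k \<le> 1 * mean_noise k"
        using m' P0 nn by (metis mult_right_mono)+
      ultimately have le: "m * L k \<le> \<mu> / 2 * P k + \<mu> / (2 * (\<ll>\<^sup>2 + 1)) / 2 * E_grad k + mean_spread k + mean_noise k"
        unfolding L_def distrib_left by linarith
      have "0 \<le> m * L k" unfolding L_def using m' P0 nn by simp
      then have "r * (m * L k) \<le> \<alpha> k * (\<mu> / 2 * P k + \<mu> / (2 * (\<ll>\<^sup>2 + 1)) / 2 * E_grad k + mean_spread k + mean_noise k)"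
        using le ak r by (intro mult_mono) auto
      moreover have "2 * dir_const * (\<alpha> k)\<^sup>2 \<le> 2 * dir_const * B\<^sup>2"
        using ak dir_const_nonneg by (intro mult_left_mono power_mono) auto
      ultimately show ?thesis by linarith
    qed
    also have "\<dots> = (1 - m * r) * L k + (2 * dir_const + \<sigma>\<^sup>2) * B\<^sup>2"
      by (simp add: algebra_simps)
    finally show ?thesis .
  qed
  then have "L K \<le> (1 - m * r) ^ K * L 0 + (2 * dir_const + \<sigma>\<^sup>2) * B\<^sup>2 / (m * r)"
    by (rule affine_contraction) (use m' r mr dir_const_nonneg in auto)
  moreover have "P 0 = (norm (x0 - stationary_point F))\<^sup>2"
    unfolding P_def
    by (rule trans[OF Bochner_Integration.integral_cong[OF refl, of M _ "\<lambda>_. (norm (x0 - stationary_point F))\<^sup>2"]])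
      (auto simp: x_0 prob_space)
  ultimately show ?thesis
    by (simp add: L_def mean_spread_0 mean_noise_0 init_err_def)
qed

text \<open>The Lyapunov inequality with \<open>m = 0\<close> telescopes. The optimality gap has
  \<open>\<kappa> = 1 / 2\<close> and \<open>\<theta> = 1 / 2\<close>, which explains
  \<open>32 = 16 / \<kappa>\<close>, \<open>1 / 8 = \<kappa> / 4\<close> and the coefficient
  \<open>1 / 4\<close> left for the gradient.\<close>

lemma nonconvex_bound:
  assumes lower: "\<And>u. C\<^sub>F \<le> F u"
    and small: "2 * ((1 + \<ll>) * dir_const) * B \<le> 1 / 8"
    and rho: "32 \<le> \<rho>" "2 * ((1 / 2 + 2) * (2 + 2 * \<ll>\<^sup>2) + 1) \<le> \<rho>"
  shows "r * (\<Sum>k<K. 1 / 4 * E_grad k + mean_spread k + mean_noise k)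
    \<le> F x0 - C\<^sub>F + init_err + real K * ((2 * ((1 + \<ll>) * dir_const) + \<sigma>\<^sup>2) * B\<^sup>2)"
proof -
  define P where "P k = (LINT w|M. F (x k w) - C\<^sub>F)" for k
  define L where "L k = P k + mean_spread k + mean_noise k" for k
  define q where "q k = 1 / 4 * E_grad k + mean_spread k + mean_noise k" for k
  \<comment> \<open>Dominates both \<open>dir_const\<close>, needed for the spread, and
    \<open>\<ll> * dir_const\<close>, needed for the gap.\<close>
  define c where "c = (1 + \<ll>) * dir_const"
  have P0: "0 \<le> P k" for k
    unfolding P_def using lower by (intro Bochner_Integration.integral_nonneg_AE AE_I2) simp
  have c0: "0 \<le> c" using dir_const_nonneg lipschitz_nonneg by (simp add: c_def)
  have step: "r * q k \<le> L k - L (Suc k) + (2 * c + \<sigma>\<^sup>2) * B\<^sup>2" if k: "k < K" for k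
  proof -
    have ak: "0 < \<alpha> k" "r \<le> \<alpha> k" "\<alpha> k \<le> B" using steps(1)[OF k] by auto
    have dB: "2 * c * \<alpha> k \<le> 2 * c * B"
      using ak c0 by (intro mult_left_mono) auto
    have nn: "0 \<le> mean_spread k" "0 \<le> mean_noise k" "0 \<le> mean_err k" "0 \<le> E_grad k"
      using mean_spread_nonneg[OF \<beta>_pos_le_1, of k] k mean_noise_nonneg mean_err_nonneg E_grad_nonneg by auto
    have "L (Suc k) \<le> L k
      - \<alpha> k * (0 * P k + 1 / 2 / 2 * E_grad k + mean_spread k + mean_noise k)
      + (2 * c * (\<alpha> k)\<^sup>2 + B\<^sup>2 * \<sigma>\<^sup>2)"
      unfolding L_def
    proof (rule lyapunov_step[OF \<beta>_pos_le_1 k ak(1), where \<theta> = "1 / 2"])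
      have "P (Suc k) \<le> P k - \<alpha> k * (1 / 2 * E_grad k)
        + \<alpha> k * (1 / 2 * mean_err k) + (\<alpha> k)\<^sup>2 * (\<ll> * dir_const * (mean_err k + E_grad k + 1))"
        unfolding P_def using ak by (intro E_gap_Suc lower k) simp
      also have "\<dots> \<le> P k - \<alpha> k * (1 / 2 * E_grad k)
        + \<alpha> k * (1 / 2 * mean_err k) + (\<alpha> k)\<^sup>2 * (c * (mean_err k + E_grad k + 1))"
        using nn dir_const_nonneg
        by (intro add_left_mono mult_left_mono mult_right_mono) (auto simp: c_def distrib_right)
      finally show "P (Suc k) \<le> P k - \<alpha> k * (0 * P k) - \<alpha> k * (1 / 2 * E_grad k)
        + \<alpha> k * (1 / 2 * mean_err k) + (\<alpha> k)\<^sup>2 * (c * (mean_err k + E_grad k + 1))" by simp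
      show "2 * c * \<alpha> k \<le> 1 / 2 / 4" "2 * c * \<alpha> k \<le> 1"
        using small dB by (simp_all add: c_def)
      show "dir_const \<le> c"
        using dir_const_nonneg lipschitz_nonneg by (simp add: c_def distrib_right)
    qed (use steps(2) k rho \<rho> in auto)
    moreover have "0 * P k + 1 / 2 / 2 * E_grad k + mean_spread k + mean_noise k = q k"
      by (simp add: q_def)
    ultimately have "\<alpha> k * q k \<le> L k - L (Suc k) + (2 * c * (\<alpha> k)\<^sup>2 + B\<^sup>2 * \<sigma>\<^sup>2)" by simp
    moreover have "r * q k \<le> \<alpha> k * q k"
      using ak nn by (intro mult_right_mono) (auto simp: q_def)
    moreover have "2 * c * (\<alpha> k)\<^sup>2 \<le> 2 * c * B\<^sup>2"
      using ak c0 by (intro mult_left_mono power_mono) auto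
    moreover have "(2 * c + \<sigma>\<^sup>2) * B\<^sup>2 = 2 * c * B\<^sup>2 + B\<^sup>2 * \<sigma>\<^sup>2" by (simp add: algebra_simps)
    ultimately show ?thesis by linarith
  qed
  have "r * (\<Sum>k<K. q k) \<le> (\<Sum>k<K. L k - L (Suc k) + (2 * c + \<sigma>\<^sup>2) * B\<^sup>2)"
    unfolding sum_distrib_left by (intro sum_mono step) simp
  also have "\<dots> = L 0 - L K + real K * ((2 * c + \<sigma>\<^sup>2) * B\<^sup>2)"
    by (simp only: sum.distrib sum_lessThan_telescope') simp
  also have "\<dots> \<le> L 0 + real K * ((2 * c + \<sigma>\<^sup>2) * B\<^sup>2)"
    unfolding L_def using P0[of K] mean_spread_nonneg[OF \<beta>_pos_le_1, of K] mean_noise_nonneg[of K] by simp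
  also have "P 0 = F x0 - C\<^sub>F"
    unfolding P_def
    by (rule trans[OF Bochner_Integration.integral_cong[OF refl, of M _ "\<lambda>_. F x0 - C\<^sub>F"]])
      (auto simp: x_0 prob_space)
  then have "L 0 = F x0 - C\<^sub>F + init_err"
    by (simp add: L_def mean_spread_0 mean_noise_0 init_err_def)
  finally show ?thesis by (simp add: q_def c_def)
qed

end

lemma integrable_dist: "integrable M (\<lambda>w. (norm (x K w - u))\<^sup>2)"
  by (rule sq_integrableD[OF sq_integrable_diff[OF hist_subalg x_sq sq_integrable_const, of K]]) simp_all

lemma integrable_grad: "k \<le> K \<Longrightarrow> integrable M (\<lambda>w. (norm (grad F (x k w)))\<^sup>2)"
  by (rule sq_integrableD[OF grad_F_sq[of k k]]) simp_all

lemma integrable_err: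
  "k \<le> K \<Longrightarrow> n \<in> {1..N} \<Longrightarrow> integrable M (\<lambda>w. (norm (y n k w - g n (x k w)))\<^sup>2)"
  by (rule sq_integrableD[OF error_sq])

end

section \<open>Convergence rates\<close>

context distributed_learning
begin

text \<open>With \<open>1 / m * h K\<close> as lower limit of the steps the contraction factor is
  exactly \<open>1 - h K\<close>, whose power is at most \<open>1 / K\<close>. The accumulated error
  is of order \<open>(h K)\<^sup>2 / h K\<close>, so both parts are of order
  \<open>ln K / K\<close>.\<close>

lemma strongly_convex_rates:
  assumes mu: "\<mu> > 0" and sc: "strongly_convex \<mu> F"
  defines "h \<equiv> \<lambda>K. ln (real K) / real K" and "m \<equiv> min 1 (\<mu> / 2)"
    and "\<rho> \<equiv> Max {4, 16 / (\<mu> / (2 * (\<ll>\<^sup>2 + 1))), 2 * ((1 / \<mu> + 2) * (2 + 2 * \<ll>\<^sup>2) + 1)}"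
  assumes ss: "step_sizes N h \<alpha> \<beta>" and ac: "admissible_constants N (1 / m) \<rho> h \<alpha> \<beta>"
    and runs: "\<And>K. algorithm_run N D loss R C K (\<alpha> K) (\<beta> K) x0 y0 (M K) (\<zeta> K) (\<xi> K) (x K) (y K)"
  shows "(\<lambda>K. LINT w|M K. (norm (x K K w - stationary_point F))\<^sup>2) \<in> soft_bigo (\<lambda>K. 1 / real K)"
    and "n \<in> {1..N} \<Longrightarrow> (\<lambda>K. LINT w|M K. (norm (y K n K w - g n (x K K w)))\<^sup>2) \<in> soft_bigo (\<lambda>K. 1 / real K)"
proof -
  interpret r: compressed_momentum_run N D loss R C \<ll> \<sigma> a b \<omega> K "\<alpha> K" "\<beta> K" x0 y0 "M K" "\<zeta> K" "\<xi> K" "x K" "y K" for K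
    by unfold_locales (rule runs)
  define \<kappa> where "\<kappa> = \<mu> / (2 * (\<ll>\<^sup>2 + 1))"
  have \<kappa>: "0 < \<kappa>"
    using mu add_nonneg_pos[OF zero_le_power2[of \<ll>] zero_less_one] by (simp add: \<kappa>_def)
  have m: "0 < m" using mu by (simp add: m_def)
  have \<rho>: "4 \<le> \<rho>" "16 / \<kappa> \<le> \<rho>" "2 * ((1 / \<mu> + 2) * (2 + 2 * \<ll>\<^sup>2) + 1) \<le> \<rho>"
    unfolding \<rho>_def \<kappa>_def by (rule Max_ge; simp)+
  define d where "d = 2 * dir_const + 1"
  have d: "d > 0" using dir_const_nonneg by (simp add: d_def)
  \<comment> \<open>Collects the smallness requirements: steps at most 1, so that momentum updates
    are convex combinations, and the two bounds on \<open>2 * dir_const * B\<close>. The summand 1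
    makes \<open>d\<close> evidently positive for the division.\<close>
  define \<epsilon> where "\<epsilon> = min 1 (min (\<kappa> / 4 / d) (1 / d))"
  have \<epsilon>: "\<epsilon> > 0" using \<kappa> d by (simp add: \<epsilon>_def)
  have h0: "h \<longlonglongrightarrow> 0" unfolding h_def by (rule lim_ln_over_n)
  have h_nonneg: "0 \<le> h K" for K by (cases "K = 0") (auto simp: h_def)
  have h_le: "h K \<le> 1" for K
    using ln_le_minus_one[of "real K"] by (cases "K = 0") (auto simp: h_def)
  obtain c1 B where "c1 > 0" and B: "B > 0" and ev: "\<forall>\<^sub>F K in sequentially. B * h K \<le> \<epsilon> \<and>
      (\<forall>k<K. 0 < \<alpha> K k \<and> c1 * h K \<le> \<alpha> K k \<and> 1 / m * h K \<le> \<alpha> K k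
      \<and> \<alpha> K k \<le> B * h K \<and> (\<forall>n\<in>{1..N}. \<rho> * \<alpha> K k \<le> \<beta> K n k \<and> \<beta> K n k \<le> B * h K))"
    by (rule step_sizes_eventually[OF ss ac h0 h_nonneg \<epsilon>], rule that)
  define L where "L K = (LINT w|M K. (norm (x K K w - stationary_point F))\<^sup>2) + r.mean_spread K K + r.mean_noise K K" for K
  define L0 where "L0 = (norm (x0 - stationary_point F))\<^sup>2 + (\<Sum>n=1..N. (norm (y0 n - g n x0))\<^sup>2) / real N"
  define q where "q = (2 * dir_const + \<sigma>\<^sup>2) * B\<^sup>2"
  define c where "c = real N * (2 + 2 * \<ll>\<^sup>2)"
  have L0: "0 \<le> L0" unfolding L0_def by (intro add_nonneg_nonneg divide_nonneg_nonneg sum_nonneg) auto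
  have q: "0 \<le> q" using dir_const_nonneg by (simp add: q_def)
  have main: "\<forall>\<^sub>F K in sequentially. L K \<le> (L0 + q) * h K
      \<and> (LINT w|M K. (norm (x K K w - stationary_point F))\<^sup>2) \<le> L K
      \<and> (\<forall>n\<in>{1..N}. r.E_err K n K \<le> c * L K)"
    using ev eventually_ge_at_top[of 3]
  proof eventually_elim
    case (elim K)
    have hK: "0 < h K" using elim(2) by (simp add: h_def)
    \<comment> \<open>From \<open>K = 3\<close> on, \<open>exp 1\<close> is below \<open>K\<close>;
      then \<open>1 / K\<close> is below \<open>h K\<close>.\<close>
    have lnK: "1 \<le> ln (real K)"
    proof -
      have "exp 1 \<le> real K" using exp_le elim(2) by linarith
      then show ?thesis using elim(2) by (subst ln_ge_iff) auto
    qed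
    have st: "\<And>k. k < K \<Longrightarrow> 0 < \<alpha> K k \<and> 1 / m * h K \<le> \<alpha> K k \<and> \<alpha> K k \<le> B * h K"
      "\<And>k n. k < K \<Longrightarrow> n \<in> {1..N} \<Longrightarrow> \<rho> * \<alpha> K k \<le> \<beta> K n k \<and> \<beta> K n k \<le> B * h K"
      using elim(1) by blast+
    have r0: "0 < 1 / m * h K" using m hK by simp
    have B1: "B * h K \<le> 1" using elim(1) by (simp add: \<epsilon>_def)
    have dd: "2 * dir_const * (B * h K) \<le> d * (B * h K)"
      using B hK by (intro mult_right_mono) (auto simp: d_def)
    have sm: "d * (B * h K) \<le> \<kappa> / 4" "d * (B * h K) \<le> 1"
    proof -
      have "B * h K \<le> \<kappa> / 4 / d" "B * h K \<le> 1 / d" using elim(1) by (auto simp: \<epsilon>_def)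
      then show "d * (B * h K) \<le> \<kappa> / 4" "d * (B * h K) \<le> 1"
        using d by (simp_all add: pos_le_divide_eq mult_ac)
    qed
    have "L K \<le> (1 - m * (1 / m * h K)) ^ K * ((norm (x0 - stationary_point F))\<^sup>2 + r.init_err)
        + (2 * dir_const + \<sigma>\<^sup>2) * (B * h K)\<^sup>2 / (m * (1 / m * h K))"
      unfolding L_def
    proof (rule r.strongly_convex_bound[OF st r0 B1 \<rho>(1) mu sc _ _ \<rho>(2)[unfolded \<kappa>_def] \<rho>(3) m_def[THEN meta_eq_to_obj_eq]])
      show "2 * dir_const * (B * h K) \<le> \<mu> / (2 * (\<ll>\<^sup>2 + 1)) / 4"
        using dd sm unfolding \<kappa>_def by linarith
      show "2 * dir_const * (B * h K) \<le> 1" using dd sm by linarith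
      show "m * (1 / m * h K) \<le> 1" using m h_le[of K] by simp
    qed
    also have "\<dots> = (1 - h K) ^ K * L0 + q * h K"
      using m hK by (simp add: L0_def r.init_err_def q_def power2_eq_square)
    also have "(1 - h K) ^ K * L0 \<le> h K * L0"
    proof (rule mult_right_mono[OF _ L0])
      \<comment> \<open>\<open>h K \<le> 1\<close> keeps the base nonnegative, and
        \<open>K * h K = ln K\<close> turns the power of the exponential into
        \<open>1 / K\<close>.\<close>
      have "(1 - h K) ^ K \<le> exp (- h K) ^ K"
        using h_le[of K] exp_ge_add_one_self[of "- h K"] by (intro power_mono) auto
      also have "\<dots> = exp (- ln (real K))"
        using elim(2) by (simp add: exp_of_nat_mult[symmetric] h_def)
      also have "\<dots> = 1 / real K" using elim(2) by (simp add: exp_minus inverse_eq_divide)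
      also have "\<dots> \<le> h K" using lnK by (simp add: h_def divide_right_mono)
      finally show "(1 - h K) ^ K \<le> h K" .
    qed
    finally have "L K \<le> (L0 + q) * h K" by (simp add: algebra_simps)
    moreover have ms: "0 \<le> r.mean_spread K K"
      by (rule r.mean_spread_nonneg[OF r.\<beta>_pos_le_1[OF st r0 B1 \<rho>(1)]]) auto
    then have "(LINT w|M K. (norm (x K K w - stationary_point F))\<^sup>2) \<le> L K"
      using r.mean_noise_nonneg[of K K] by (simp add: L_def)
    moreover have "r.E_err K n K \<le> c * L K" if n: "n \<in> {1..N}" for n
    proof -
      have "r.E_err K n K \<le> c * (r.mean_spread K K + r.mean_noise K K)"
        unfolding c_def by (rule r.E_err_le[OF st r0 B1 \<rho>(1) n order_refl])
      also have "\<dots> \<le> c * L K" unfolding L_def c_def by (intro mult_left_mono) auto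
      finally show ?thesis .
    qed
    ultimately show ?case by blast
  qed
  \<comment> \<open>The logarithm of the step-size scale is the logarithmic factor that
    \<open>soft_bigo\<close> allows.\<close>
  have soft: "h K \<le> 1 / real K * max 1 \<bar>ln (1 / real K)\<bar>" if "K \<ge> 1" for K
  proof -
    have "ln (real K) \<le> max 1 \<bar>ln (1 / real K)\<bar>" using that by (simp add: ln_div)
    then show ?thesis by (simp add: h_def divide_right_mono)
  qed
  have bigo: "f \<in> soft_bigo (\<lambda>K. 1 / real K)"
    if f: "\<forall>\<^sub>F K in sequentially. 0 \<le> f K \<and> f K \<le> c' * h K" for f c'
    unfolding soft_bigo_def
  proof (rule bigoI)
    show "\<forall>\<^sub>F K in sequentially. norm (f K) \<le> \<bar>c'\<bar> * norm (1 / real K * max 1 \<bar>ln (1 / real K)\<bar>)"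
      using f eventually_ge_at_top[of 1]
    proof eventually_elim
      case (elim K)
      have "norm (f K) \<le> c' * h K" using elim by simp
      also have "\<dots> \<le> \<bar>c'\<bar> * h K" using h_nonneg by (intro mult_right_mono) auto
      also have "\<dots> \<le> \<bar>c'\<bar> * norm (1 / real K * max 1 \<bar>ln (1 / real K)\<bar>)"
        using order_trans[OF soft[OF elim(2)] abs_ge_self] unfolding real_norm_def
        by (rule mult_left_mono) simp
      finally show ?case .
    qed
  qed
  show "(\<lambda>K. LINT w|M K. (norm (x K K w - stationary_point F))\<^sup>2) \<in> soft_bigo (\<lambda>K. 1 / real K)"
  proof (rule bigo)
    show "\<forall>\<^sub>F K in sequentially. 0 \<le> (LINT w|M K. (norm (x K K w - stationary_point F))\<^sup>2) \<and>
        (LINT w|M K. (norm (x K K w - stationary_point F))\<^sup>2) \<le> (L0 + q) * h K"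
      using main by eventually_elim auto
  qed
  assume n: "n \<in> {1..N}"
  show "(\<lambda>K. LINT w|M K. (norm (y K n K w - g n (x K K w)))\<^sup>2) \<in> soft_bigo (\<lambda>K. 1 / real K)"
  proof (rule bigo)
    show "\<forall>\<^sub>F K in sequentially. 0 \<le> (LINT w|M K. (norm (y K n K w - g n (x K K w)))\<^sup>2) \<and>
        (LINT w|M K. (norm (y K n K w - g n (x K K w)))\<^sup>2) \<le> (c * (L0 + q)) * h K"
      using main
    proof eventually_elim
      case (elim K)
      have "r.E_err K n K \<le> c * L K" using elim n by blast
      also have "\<dots> \<le> c * ((L0 + q) * h K)" using elim by (intro mult_left_mono) (auto simp: c_def)
      finally show ?case by (simp add: r.E_err_def mult.assoc)
    qed
  qed
qed

text \<open>Here \<open>K * (h K)\<^sup>2 = 1\<close>, so the errors of all iterations add up to a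
  constant. Dividing by the step and by \<open>K\<close> leaves the order \<open>h K\<close>. No
  geometric decay is involved, so whatever constant \<open>c1\<close> the step sizes have serves as
  lower limit.\<close>

lemma nonconvex_rates:
  assumes lower: "\<And>u. C\<^sub>F \<le> F u"
  defines "h \<equiv> \<lambda>K. 1 / sqrt (real K)"
    and "\<rho> \<equiv> max 32 (2 * ((1 / 2 + 2) * (2 + 2 * \<ll>\<^sup>2) + 1))"
  assumes ss: "step_sizes N h \<alpha> \<beta>" and ac: "admissible_constants N 0 \<rho> h \<alpha> \<beta>"
    and runs: "\<And>K. algorithm_run N D loss R C K (\<alpha> K) (\<beta> K) x0 y0 (M K) (\<zeta> K) (\<xi> K) (x K) (y K)"
  shows "(\<lambda>K. 1 / real K * (\<Sum>k<K. LINT w|M K. (norm (grad F (x K k w)))\<^sup>2)) \<in> O(h)"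
    and "n \<in> {1..N} \<Longrightarrow> (\<lambda>K. 1 / real K * (\<Sum>k<K. LINT w|M K. (norm (y K n k w - g n (x K k w)))\<^sup>2)) \<in> O(h)"
proof -
  interpret r: compressed_momentum_run N D loss R C \<ll> \<sigma> a b \<omega> K "\<alpha> K" "\<beta> K" x0 y0 "M K" "\<zeta> K" "\<xi> K" "x K" "y K" for K
    by unfold_locales (rule runs)
  have \<rho>: "4 \<le> \<rho>" "32 \<le> \<rho>" "2 * ((1 / 2 + 2) * (2 + 2 * \<ll>\<^sup>2) + 1) \<le> \<rho>"
    unfolding \<rho>_def by simp_all
  define d where "d = 2 * ((1 + \<ll>) * dir_const) + 1"
  have d: "d > 0"
    using dir_const_nonneg lipschitz_nonneg unfolding d_def by (intro add_nonneg_pos) auto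
  define \<epsilon> where "\<epsilon> = min 1 (1 / 8 / d)"
  have \<epsilon>: "\<epsilon> > 0" using d by (simp add: \<epsilon>_def)
  have h0: "h \<longlonglongrightarrow> 0"
    using tendsto_real_sqrt[OF lim_1_over_n] by (simp add: h_def real_sqrt_divide)
  have h_nonneg: "0 \<le> h K" for K by (simp add: h_def)
  obtain c1 B where c1: "c1 > 0" and B: "B > 0" and ev: "\<forall>\<^sub>F K in sequentially. B * h K \<le> \<epsilon> \<and>
      (\<forall>k<K. 0 < \<alpha> K k \<and> c1 * h K \<le> \<alpha> K k \<and> 0 * h K \<le> \<alpha> K k
      \<and> \<alpha> K k \<le> B * h K \<and> (\<forall>n\<in>{1..N}. \<rho> * \<alpha> K k \<le> \<beta> K n k \<and> \<beta> K n k \<le> B * h K))"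
    by (rule step_sizes_eventually[OF ss ac h0 h_nonneg \<epsilon>], rule that)
  define Q where "Q K = (\<Sum>k<K. 1 / 4 * r.E_grad K k + r.mean_spread K k + r.mean_noise K k)" for K
  define L0 where "L0 = F x0 - C\<^sub>F + (\<Sum>n=1..N. (norm (y0 n - g n x0))\<^sup>2) / real N"
  define q where "q = (L0 + (2 * ((1 + \<ll>) * dir_const) + \<sigma>\<^sup>2) * B\<^sup>2) / c1"
  define c where "c = real N * (2 + 2 * \<ll>\<^sup>2)"
  have main: "\<forall>\<^sub>F K in sequentially. 1 / real K * Q K \<le> q * h K
      \<and> (\<Sum>k<K. r.E_grad K k) \<le> 4 * Q K
      \<and> (\<forall>n\<in>{1..N}. (\<Sum>k<K. r.E_err K n k) \<le> c * Q K)"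
    using ev eventually_ge_at_top[of 1]
  proof eventually_elim
    case (elim K)
    have hK: "0 < h K" using elim(2) by (simp add: h_def)
    have hh: "real K * (h K)\<^sup>2 = 1" using elim(2) by (simp add: h_def power_divide)
    have st: "\<And>k. k < K \<Longrightarrow> 0 < \<alpha> K k \<and> c1 * h K \<le> \<alpha> K k \<and> \<alpha> K k \<le> B * h K"
      "\<And>k n. k < K \<Longrightarrow> n \<in> {1..N} \<Longrightarrow> \<rho> * \<alpha> K k \<le> \<beta> K n k \<and> \<beta> K n k \<le> B * h K"
      using elim(1) by blast+
    have r0: "0 < c1 * h K" using c1 hK by simp
    have B1: "B * h K \<le> 1" using elim(1) by (simp add: \<epsilon>_def)
    have dd: "2 * ((1 + \<ll>) * dir_const) * (B * h K) \<le> d * (B * h K)"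
      using B hK by (intro mult_right_mono) (auto simp: d_def)
    have "B * h K \<le> 1 / 8 / d" using elim(1) by (auto simp: \<epsilon>_def)
    then have "d * (B * h K) \<le> 1 / 8" using d by (simp add: pos_le_divide_eq mult_ac)
    then have sm: "2 * ((1 + \<ll>) * dir_const) * (B * h K) \<le> 1 / 8" using dd by linarith
    have "c1 * h K * Q K \<le> F x0 - C\<^sub>F + r.init_err
        + real K * ((2 * ((1 + \<ll>) * dir_const) + \<sigma>\<^sup>2) * (B * h K)\<^sup>2)"
      unfolding Q_def by (rule r.nonconvex_bound[OF st r0 B1 \<rho>(1) lower sm \<rho>(2,3)])
    also have "\<dots> = L0 + (real K * (h K)\<^sup>2) * ((2 * ((1 + \<ll>) * dir_const) + \<sigma>\<^sup>2) * B\<^sup>2)"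
      by (simp add: L0_def r.init_err_def power_mult_distrib)
    also have "\<dots> = c1 * q" using c1 by (simp add: hh q_def)
    finally have "c1 * (h K * Q K) \<le> c1 * q" by (simp only: mult.assoc)
    then have "h K * Q K \<le> q" using c1 by (simp only: mult_le_cancel_left_pos)
    \<comment> \<open>Another factor \<open>h K\<close> produces
      \<open>(h K)\<^sup>2 = 1 / K\<close>, the normalisation of the average.\<close>
    then have "h K * (h K * Q K) \<le> h K * q" using hK by (intro mult_left_mono) auto
    moreover have "h K * (h K * Q K) = 1 / real K * Q K"
      using elim(2) by (simp add: h_def)
    ultimately have "1 / real K * Q K \<le> q * h K" by (simp only: mult.commute)
    moreover have nn: "0 \<le> r.mean_spread K k" "0 \<le> r.mean_noise K k" "0 \<le> r.E_grad K k" if "k < K" for k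
      using r.mean_spread_nonneg[OF r.\<beta>_pos_le_1[OF st r0 B1 \<rho>(1)], of k] r.mean_noise_nonneg r.E_grad_nonneg that
      by auto
    have "(\<Sum>k<K. r.E_grad K k) \<le> 4 * Q K"
      unfolding Q_def sum_distrib_left by (intro sum_mono) (use nn in auto)
    moreover have "(\<Sum>k<K. r.E_err K n k) \<le> c * Q K" if n: "n \<in> {1..N}" for n
      unfolding Q_def sum_distrib_left
    proof (rule sum_mono)
      fix k assume "k \<in> {..<K}"
      then have k: "k < K" by simp
      have "r.E_err K n k \<le> c * (r.mean_spread K k + r.mean_noise K k)"
        unfolding c_def by (rule r.E_err_le[OF st r0 B1 \<rho>(1) n]) (use k in auto)
      also have "\<dots> \<le> c * (1 / 4 * r.E_grad K k + r.mean_spread K k + r.mean_noise K k)"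
        unfolding c_def using nn[OF k] by (intro mult_left_mono) auto
      finally show "r.E_err K n k \<le> c * (1 / 4 * r.E_grad K k + r.mean_spread K k + r.mean_noise K k)" .
    qed
    ultimately show ?case by blast
  qed
  have bigo: "(\<lambda>K. 1 / real K * f K) \<in> O(h)"
    if f: "\<forall>\<^sub>F K in sequentially. 0 \<le> f K \<and> f K \<le> c' * Q K" and c': "0 \<le> c'" for f c'
  proof (rule bigoI)
    show "\<forall>\<^sub>F K in sequentially. norm (1 / real K * f K) \<le> (c' * q) * norm (h K)"
      using f main
    proof eventually_elim
      case (elim K)
      have "norm (1 / real K * f K) = 1 / real K * f K" using elim by simp
      also have "\<dots> \<le> 1 / real K * (c' * Q K)" using elim by (intro mult_left_mono) auto
      also have "\<dots> = c' * (1 / real K * Q K)" by simp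
      also have "\<dots> \<le> c' * (q * h K)" using elim c' by (intro mult_left_mono) auto
      also have "\<dots> = (c' * q) * norm (h K)" using h_nonneg by simp
      finally show ?case .
    qed
  qed
  show "(\<lambda>K. 1 / real K * (\<Sum>k<K. LINT w|M K. (norm (grad F (x K k w)))\<^sup>2)) \<in> O(h)"
  proof (rule bigo)
    show "\<forall>\<^sub>F K in sequentially. 0 \<le> (\<Sum>k<K. LINT w|M K. (norm (grad F (x K k w)))\<^sup>2)
        \<and> (\<Sum>k<K. LINT w|M K. (norm (grad F (x K k w)))\<^sup>2) \<le> 4 * Q K"
      using main by eventually_elim (auto simp: r.E_grad_def intro!: sum_nonneg)
  qed simp
  assume n: "n \<in> {1..N}"
  show "(\<lambda>K. 1 / real K * (\<Sum>k<K. LINT w|M K. (norm (y K n k w - g n (x K k w)))\<^sup>2)) \<in> O(h)"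
  proof (rule bigo)
    show "\<forall>\<^sub>F K in sequentially. 0 \<le> (\<Sum>k<K. LINT w|M K. (norm (y K n k w - g n (x K k w)))\<^sup>2)
        \<and> (\<Sum>k<K. LINT w|M K. (norm (y K n k w - g n (x K k w)))\<^sup>2) \<le> c * Q K"
      using main
    proof eventually_elim
      case (elim K)
      then have "(\<Sum>k<K. r.E_err K n k) \<le> c * Q K" using n by blast
      then show ?case by (auto simp: r.E_err_def intro!: sum_nonneg)
    qed
  qed (simp add: c_def)
qed

end

text \<open>The thresholds are fixed before step sizes, starting points and probability spaces are
  chosen. The witnesses depend on \<open>\<mu>\<close> and \<open>\<ll>\<close> in the first part
  and on \<open>\<ll>\<close> alone in the second.\<close>

theorem corollary2:
  fixes N :: nat
    and D :: "nat \<Rightarrow> 'z measure"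
    and loss :: "nat \<Rightarrow> real^'d \<Rightarrow> 'z \<Rightarrow> real"
    and R :: "nat \<Rightarrow> 'r measure"
    and C :: "nat \<Rightarrow> real^'d \<Rightarrow> 'r \<Rightarrow> real^'d"
    and \<ll> \<sigma> a b \<omega> \<mu> C\<^sub>F :: real
  defines "f \<equiv> local_loss D loss"
    and "F \<equiv> global_loss N D loss"
  assumes problem: "learning_problem N D loss R C"
    and cond_a: "smooth_losses N D loss \<ll>"
    and cond_b: "stochastic_gradients N D loss \<sigma>"
    and cond_c: "a > 0" "b > 0" "bounded_heterogeneity N D loss a b"
    and cond_d: "unbiased_compressors N R C \<omega>"
  shows "(\<mu> > 0 \<and> strongly_convex \<mu> F \<longrightarrow>
      (\<exists>c>0. \<exists>\<rho>>0. \<forall>\<alpha> \<beta> x0 y0 (M :: nat \<Rightarrow> 'w measure) \<zeta> \<xi> x y.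
         step_sizes N (\<lambda>K. ln (real K) / real K) \<alpha> \<beta> \<and>
         admissible_constants N c \<rho> (\<lambda>K. ln (real K) / real K) \<alpha> \<beta> \<and>
         (\<forall>K. algorithm_run N D loss R C K (\<alpha> K) (\<beta> K) x0 y0 (M K) (\<zeta> K) (\<xi> K) (x K) (y K))
         \<longrightarrow>
         (\<forall>K. integrable (M K) (\<lambda>w. (norm (x K K w - stationary_point F))\<^sup>2)) \<and>
         (\<lambda>K. LINT w|M K. (norm (x K K w - stationary_point F))\<^sup>2) \<in> soft_bigo (\<lambda>K. 1 / real K) \<and>
         (\<forall>n\<in>{1..N}.
            (\<forall>K. integrable (M K) (\<lambda>w. (norm (y K n K w - grad (f n) (x K K w)))\<^sup>2)) \<and>
            (\<lambda>K. LINT w|M K. (norm (y K n K w - grad (f n) (x K K w)))\<^sup>2)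
              \<in> soft_bigo (\<lambda>K. 1 / real K))))
    \<and> ((\<forall>x. C\<^sub>F \<le> F x) \<longrightarrow>
      (\<exists>\<rho>>0. \<forall>\<alpha> \<beta> x0 y0 (M :: nat \<Rightarrow> 'w measure) \<zeta> \<xi> x y.
         step_sizes N (\<lambda>K. 1 / sqrt (real K)) \<alpha> \<beta> \<and>
         admissible_constants N 0 \<rho> (\<lambda>K. 1 / sqrt (real K)) \<alpha> \<beta> \<and>
         (\<forall>K. algorithm_run N D loss R C K (\<alpha> K) (\<beta> K) x0 y0 (M K) (\<zeta> K) (\<xi> K) (x K) (y K))
         \<longrightarrow>
         (\<forall>K. \<forall>k<K. integrable (M K) (\<lambda>w. (norm (grad F (x K k w)))\<^sup>2)) \<and>
         (\<lambda>K. 1 / real K * (\<Sum>k<K. LINT w|M K. (norm (grad F (x K k w)))\<^sup>2))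
           \<in> O(\<lambda>K. 1 / sqrt (real K)) \<and>
         (\<forall>n\<in>{1..N}.
            (\<forall>K. \<forall>k<K. integrable (M K) (\<lambda>w. (norm (y K n k w - grad (f n) (x K k w)))\<^sup>2)) \<and>
            (\<lambda>K. 1 / real K * (\<Sum>k<K. LINT w|M K. (norm (y K n k w - grad (f n) (x K k w)))\<^sup>2))
              \<in> O(\<lambda>K. 1 / sqrt (real K)))))"
proof -
  interpret distributed_learning N D loss R C \<ll> \<sigma> a b \<omega>
    by unfold_locales (fact problem cond_a cond_b cond_c cond_d)+
  \<comment> \<open>Viewing each \<open>K\<close> as a run of its own gives integrability for every
    \<open>K\<close>, also before the asymptotic regime is reached.\<close>
  have run: "compressed_momentum_run N D loss R C \<ll> \<sigma> a b \<omega> K \<alpha> \<beta> x0 y0 M \<zeta> \<xi> x y"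
    if "algorithm_run N D loss R C K \<alpha> \<beta> x0 y0 M \<zeta> \<xi> x y"
    for K \<alpha> \<beta> x0 y0 and M :: "'w measure" and \<zeta> \<xi> x y
    by unfold_locales (rule that)
  show ?thesis
  proof (intro conjI impI)
    assume sc: "\<mu> > 0 \<and> strongly_convex \<mu> F"
    let ?c = "1 / min 1 (\<mu> / 2)"
    let ?\<rho> = "Max {4, 16 / (\<mu> / (2 * (\<ll>\<^sup>2 + 1))), 2 * ((1 / \<mu> + 2) * (2 + 2 * \<ll>\<^sup>2) + 1)}"
    have pos: "0 < ?c" "0 < ?\<rho>"
      using sc by (auto simp: less_max_iff_disj)
    show "(\<exists>c>0. \<exists>\<rho>>0. \<forall>\<alpha> \<beta> x0 y0 (M :: nat \<Rightarrow> 'w measure) \<zeta> \<xi> x y.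
         step_sizes N (\<lambda>K. ln (real K) / real K) \<alpha> \<beta> \<and>
         admissible_constants N c \<rho> (\<lambda>K. ln (real K) / real K) \<alpha> \<beta> \<and>
         (\<forall>K. algorithm_run N D loss R C K (\<alpha> K) (\<beta> K) x0 y0 (M K) (\<zeta> K) (\<xi> K) (x K) (y K))
         \<longrightarrow>
         (\<forall>K. integrable (M K) (\<lambda>w. (norm (x K K w - stationary_point F))\<^sup>2)) \<and>
         (\<lambda>K. LINT w|M K. (norm (x K K w - stationary_point F))\<^sup>2) \<in> soft_bigo (\<lambda>K. 1 / real K) \<and>
         (\<forall>n\<in>{1..N}.
            (\<forall>K. integrable (M K) (\<lambda>w. (norm (y K n K w - grad (f n) (x K K w)))\<^sup>2)) \<and>
            (\<lambda>K. LINT w|M K. (norm (y K n K w - grad (f n) (x K K w)))\<^sup>2)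
              \<in> soft_bigo (\<lambda>K. 1 / real K)))"
    proof (rule exI[of _ ?c], rule conjI[OF pos(1)], rule exI[of _ ?\<rho>], rule conjI[OF pos(2)],
        intro allI impI, elim conjE)
      fix \<alpha> \<beta> x0 y0 and M :: "nat \<Rightarrow> 'w measure" and \<zeta> \<xi> x y
      assume ss: "step_sizes N (\<lambda>K. ln (real K) / real K) \<alpha> \<beta>"
        and ac: "admissible_constants N ?c ?\<rho> (\<lambda>K. ln (real K) / real K) \<alpha> \<beta>"
        and ar: "\<forall>K. algorithm_run N D loss R C K (\<alpha> K) (\<beta> K) x0 y0 (M K) (\<zeta> K) (\<xi> K) (x K) (y K)"
      note rates = strongly_convex_rates[OF sc[unfolded F_def, THEN conjunct1] sc[unfolded F_def, THEN conjunct2]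
          ss ac ar[rule_format]]
      note int = compressed_momentum_run.integrable_dist[OF run[OF ar[rule_format]]]
        compressed_momentum_run.integrable_err[OF run[OF ar[rule_format]] order_refl]
      show "(\<forall>K. integrable (M K) (\<lambda>w. (norm (x K K w - stationary_point F))\<^sup>2)) \<and>
         (\<lambda>K. LINT w|M K. (norm (x K K w - stationary_point F))\<^sup>2) \<in> soft_bigo (\<lambda>K. 1 / real K) \<and>
         (\<forall>n\<in>{1..N}.
            (\<forall>K. integrable (M K) (\<lambda>w. (norm (y K n K w - grad (f n) (x K K w)))\<^sup>2)) \<and>
            (\<lambda>K. LINT w|M K. (norm (y K n K w - grad (f n) (x K K w)))\<^sup>2)
              \<in> soft_bigo (\<lambda>K. 1 / real K))"
        unfolding f_def F_def by (intro conjI allI ballI rates int)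
    qed
  next
    assume lower: "\<forall>x. C\<^sub>F \<le> F x"
    let ?\<rho> = "max 32 (2 * ((1 / 2 + 2) * (2 + 2 * \<ll>\<^sup>2) + 1))"
    have pos: "0 < ?\<rho>" by (simp add: less_max_iff_disj)
    show "(\<exists>\<rho>>0. \<forall>\<alpha> \<beta> x0 y0 (M :: nat \<Rightarrow> 'w measure) \<zeta> \<xi> x y.
         step_sizes N (\<lambda>K. 1 / sqrt (real K)) \<alpha> \<beta> \<and>
         admissible_constants N 0 \<rho> (\<lambda>K. 1 / sqrt (real K)) \<alpha> \<beta> \<and>
         (\<forall>K. algorithm_run N D loss R C K (\<alpha> K) (\<beta> K) x0 y0 (M K) (\<zeta> K) (\<xi> K) (x K) (y K))
         \<longrightarrow>
         (\<forall>K. \<forall>k<K. integrable (M K) (\<lambda>w. (norm (grad F (x K k w)))\<^sup>2)) \<and>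
         (\<lambda>K. 1 / real K * (\<Sum>k<K. LINT w|M K. (norm (grad F (x K k w)))\<^sup>2))
           \<in> O(\<lambda>K. 1 / sqrt (real K)) \<and>
         (\<forall>n\<in>{1..N}.
            (\<forall>K. \<forall>k<K. integrable (M K) (\<lambda>w. (norm (y K n k w - grad (f n) (x K k w)))\<^sup>2)) \<and>
            (\<lambda>K. 1 / real K * (\<Sum>k<K. LINT w|M K. (norm (y K n k w - grad (f n) (x K k w)))\<^sup>2))
              \<in> O(\<lambda>K. 1 / sqrt (real K))))"
    proof (rule exI[of _ ?\<rho>], rule conjI[OF pos], intro allI impI, elim conjE)
      fix \<alpha> \<beta> x0 y0 and M :: "nat \<Rightarrow> 'w measure" and \<zeta> \<xi> x y
      assume ss: "step_sizes N (\<lambda>K. 1 / sqrt (real K)) \<alpha> \<beta>"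
        and ac: "admissible_constants N 0 ?\<rho> (\<lambda>K. 1 / sqrt (real K)) \<alpha> \<beta>"
        and ar: "\<forall>K. algorithm_run N D loss R C K (\<alpha> K) (\<beta> K) x0 y0 (M K) (\<zeta> K) (\<xi> K) (x K) (y K)"
      note rates = nonconvex_rates[OF lower[unfolded F_def, rule_format] ss ac ar[rule_format]]
      note int = compressed_momentum_run.integrable_grad[OF run[OF ar[rule_format]] less_imp_le]
        compressed_momentum_run.integrable_err[OF run[OF ar[rule_format]] less_imp_le]
      show "(\<forall>K. \<forall>k<K. integrable (M K) (\<lambda>w. (norm (grad F (x K k w)))\<^sup>2)) \<and>
         (\<lambda>K. 1 / real K * (\<Sum>k<K. LINT w|M K. (norm (grad F (x K k w)))\<^sup>2))
           \<in> O(\<lambda>K. 1 / sqrt (real K)) \<and>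
         (\<forall>n\<in>{1..N}.
            (\<forall>K. \<forall>k<K. integrable (M K) (\<lambda>w. (norm (y K n k w - grad (f n) (x K k w)))\<^sup>2)) \<and>
            (\<lambda>K. 1 / real K * (\<Sum>k<K. LINT w|M K. (norm (y K n k w - grad (f n) (x K k w)))\<^sup>2))
              \<in> O(\<lambda>K. 1 / sqrt (real K)))"
        unfolding f_def F_def by (intro conjI allI impI ballI rates int)
    qed
  qed
qed

end
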